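(* Let $V(z)=-iz^3/3$, and let $\Gamma=\gamma_1\cup\gamma\cup\gamma_2$ be the unbounded oriented contour described in the context, built from the critical trajectory $\gamma$ of $Q(z)\,dz^2$ with $Q(z)=-\frac14(z+i)^2(z^2-2iz-3)$. Then $\Gamma$ is a curve with the $S$-property in the external field $\operatorname{Re} V$. In addition, the equilibrium measure on $\Gamma$ in the external field $\operatorname{Re}V$ is the probability measure $\mu$ on $\gamma$ given by $$d\mu(s)=\frac{1}{\pi i}\,Q_+^{1/2}(s)\,ds .$$
   Context: The curve $\gamma$. The polynomial $Q(z)=-\frac14(z+i)^2(z^2-2iz-3)$ has simple zeros $z_1=-\sqrt2+i$, $z_2=\sqrt2+i$ and a double zero at $-i$. There is a critical trajectory $\gamma$ of $Q(z)\,dz^2$ connecting $z_1$ to $z_2$: an analytic arc from $z_1$ to $z_2$, containing no zero of $Q$ in its interior, along which $\frac{1}{\pi i}\int_{z_1}^z Q^{1/2}(s)\,ds$ is real. It is oriented from $z_1$ to $z_2$; the $+$ side (resp. $-$ side) is on the left (resp. right) when traversing $\gamma$ according to its orientation. The square root. $Q^{1/2}(z)$ denotes the branch that is analytic in $\mathbb C\setminus\gamma$ with $$Q^{1/2}(z)=-\tfrac12 i z^2-\tfrac1z+\mathcal O(z^{-2}),\qquad z\to\infty,$$ and $Q_+^{1/2}(s)$, $s\in\gamma$, is its limiting value from the $+$ side of $\gamma$. The contour $\Gamma$. $\Gamma=\gamma_1\cup\gamma\cup\gamma_2$ is the analytic extension of $\gamma$ to an unbounded oriented contour, where $\gamma_1$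 (from $\infty$ to $z_1$) and $\gamma_2$ (from $z_2$ to $\infty$) are such that $\phi_1(z)=\int_{z_1}^z Q^{1/2}(s)\,ds$ is real and positive for $z\in\gamma_1\setminus\{z_1\}$ and $\phi_2(z)=\int_{z_2}^z Q^{1/2}(s)\,ds$ is real and positive for $z\in\gamma_2\setminus\{z_2\}$ (integrals along $\gamma_1$, $\gamma_2$ respectively). Here $\gamma_1$ tends to infinity in the direction $\arg z=5\pi/6$ and $\gamma_2$ in the direction $\arg z=\pi/6$. Equilibrium measure. The equilibrium measure on $\Gamma$ in the external field $\operatorname{Re}V$ is the unique minimizer of $$I_V(\nu)=\iint\log\frac1{|z-s|}\,d\nu(z)\,d\nu(s)+\operatorname{Re}\int V(s)\,d\nu(s)$$ among all Borel probability measures $\nu$ supported on $\Gamma$. $S$-property. Let $\mu$ be the equilibrium measure on $\Gamma$ in the external field $\operatorname{Re}V$ and $U^\mu(z)=\int\log\frac1{|z-s|}\,d\mu(s)$ its logarithmic potential. The analytic contour $\Gamma$ has the $S$-property in the external field $\operatorname{Re}V$ if for every $z$ in the interior of the analytic arcs that constitute $\operatorname{supp}\mu$, $$\frac{\partial}{\partial n_+}\bigl[2U^\mu(z)+\operatorname{Re}V(z)\bigr]=\frac{\partial}{\partial n_-}\bigl[2U^\mu(z)+\operatorname{Re}V(z)\bigr],$$ where $\frac{\partial}{\partial n_\pm}$ are the two normal derivatives taken on either side of $\Gamma$ (each along the normal pointing away from $\Gamma$ into the corresponding side). *)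

theory Defs
  imports "HOL-Probability.Probability" "HOL-Complex_Analysis.Complex_Analysis"
begin

section \<open>Integrals with values in the extended reals, and logarithmic potential theory\<close>

text \<open>
  The integral of the positive part minus the integral of the negative part.
  Subtraction and addition are those of \<^typ>\<open>ereal\<close>, where $\infty - \infty = \infty$.
\<close>

definition ext_integral :: "'a measure \<Rightarrow> ('a \<Rightarrow> ereal) \<Rightarrow> ereal" where
  "ext_integral M f =
     enn2ereal (\<integral>\<^sup>+ x. e2ennreal (f x) \<partial>M) - enn2ereal (\<integral>\<^sup>+ x. e2ennreal (- f x) \<partial>M)"

text \<open>The case distinction is needed because \<^term>\<open>ln (1 / 0 :: real)\<close> is \<^term>\<open>0 :: real\<close>.\<close>

definition log_kernel :: "complex \<Rightarrow> complex \<Rightarrow> ereal" where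
  "log_kernel z s = (if z = s then \<infinity> else ereal (ln (1 / cmod (z - s))))"

definition log_potential :: "complex measure \<Rightarrow> complex \<Rightarrow> ereal" where
  "log_potential \<mu> z = ext_integral \<mu> (log_kernel z)"

text \<open>
  If the real part of \<open>V\<close> has infinite integral, the sum is $\infty$, also when the first summand
  is $-\infty$; this is the usual value of the weighted energy for an external field that grows
  faster than the logarithm on the (unbounded) support.
\<close>

definition weighted_energy :: "(complex \<Rightarrow> complex) \<Rightarrow> complex measure \<Rightarrow> ereal" where
  "weighted_energy V \<nu> =
     ext_integral (\<nu> \<Otimes>\<^sub>M \<nu>) (\<lambda>(z, s). log_kernel z s) + ext_integral \<nu> (\<lambda>s. ereal (Re (V s)))"

definition prob_measures_on :: "complex set \<Rightarrow> complex measure set" where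
  "prob_measures_on S = {\<nu>. prob_space \<nu> \<and> sets \<nu> = sets borel \<and> (AE z in \<nu>. z \<in> S)}"

definition is_equilibrium_measure ::
    "(complex \<Rightarrow> complex) \<Rightarrow> complex set \<Rightarrow> complex measure \<Rightarrow> bool" where
  "is_equilibrium_measure V S \<mu> \<longleftrightarrow>
     \<mu> \<in> prob_measures_on S \<and>
     (\<forall>\<nu> \<in> prob_measures_on S. \<nu> \<noteq> \<mu> \<longrightarrow> weighted_energy V \<mu> < weighted_energy V \<nu>)"

definition msupport :: "'a::topological_space measure \<Rightarrow> 'a set" where
  "msupport \<mu> = {z. \<forall>U. open U \<and> z \<in> U \<longrightarrow> emeasure \<mu> U > 0}"


section \<open>Analytic curves, sides, and the S-property\<close>

text \<open>Analytic curves are required to be regular (non-vanishing derivative).\<close>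

definition analytic_curve_on :: "real set \<Rightarrow> (real \<Rightarrow> complex) \<Rightarrow> bool" where
  "analytic_curve_on I g \<longleftrightarrow>
     (\<exists>F. F analytic_on (complex_of_real ` I) \<and>
          (\<forall>t\<in>I. F (complex_of_real t) = g t \<and> deriv F (complex_of_real t) \<noteq> 0))"

text \<open>The unit normal pointing to the left, that is, to the $+$ side.\<close>

definition left_normal :: "(real \<Rightarrow> complex) \<Rightarrow> real \<Rightarrow> complex" where
  "left_normal g t = \<i> * sgn (vector_derivative g (at t))"

text \<open>
  The limiting value at the point \<open>s\<close> of the open arc \<open>g ` {0<..<1}\<close> from the $+$ side. Near \<open>s\<close>, the
  $+$ side consists of the points \<open>g u + h * left_normal g u\<close> with \<open>u\<close> close to the parameter \<open>t\<close> of
  \<open>s\<close> and small \<open>h > 0\<close>, so this is the unrestricted (not merely the normal) one-sided limit.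
\<close>

definition plus_value :: "(real \<Rightarrow> complex) \<Rightarrow> (complex \<Rightarrow> complex) \<Rightarrow> complex \<Rightarrow> complex" where
  "plus_value g f s =
     (let t = the_inv_into {0<..<1} g s in
      Lim (nhds t \<times>\<^sub>F at_right 0) (\<lambda>(u, h). f (g u + complex_of_real h * left_normal g u)))"

definition has_dir_derivative :: "(complex \<Rightarrow> real) \<Rightarrow> complex \<Rightarrow> complex \<Rightarrow> real \<Rightarrow> bool" where
  "has_dir_derivative f z n D \<longleftrightarrow>
     ((\<lambda>h. f (z + complex_of_real h * n)) has_real_derivative D) (at_right 0)"

text \<open>
  The contour is the range of \<open>G\<close>. The set \<open>J\<close> lists the parameter intervals of the (disjoint) arcs
  that constitute the support of the equilibrium measure.
\<close>

definition S_property :: "(complex \<Rightarrow> complex) \<Rightarrow> (real \<Rightarrow> complex) \<Rightarrow> bool" where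
  "S_property V G \<longleftrightarrow>
     analytic_curve_on UNIV G \<and>
     (\<exists>\<mu> J. is_equilibrium_measure V (range G) \<mu> \<and>
        finite J \<and> (\<forall>(a, b)\<in>J. a < b) \<and> disjoint_family_on (\<lambda>(a, b). {a..b}) J \<and>
        msupport \<mu> = (\<Union>(a, b)\<in>J. G ` {a..b}) \<and>
        (\<forall>(a, b)\<in>J. \<forall>t\<in>{a<..<b}.
           \<exists>D. has_dir_derivative (\<lambda>z. 2 * real_of_ereal (log_potential \<mu> z) + Re (V z))
                  (G t) (left_normal G t) D \<and>
               has_dir_derivative (\<lambda>z. 2 * real_of_ereal (log_potential \<mu> z) + Re (V z))
                  (G t) (- left_normal G t) D))"

text \<open>
  The measure \<open>\<mu>\<close> is the complex measure \<open>f(s) ds\<close> on the path \<open>g\<close>; in particular the latter is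
  real and non-negative.
\<close>

definition is_line_measure ::
    "complex measure \<Rightarrow> (real \<Rightarrow> complex) \<Rightarrow> (complex \<Rightarrow> complex) \<Rightarrow> bool" where
  "is_line_measure \<mu> g f \<longleftrightarrow>
     sets \<mu> = sets borel \<and>
     (\<forall>B\<in>sets borel. ((\<lambda>s. indicator B s * f s) has_contour_integral of_real (measure \<mu> B)) g)"


section \<open>The quadratic differential and the contour\<close>

definition V :: "complex \<Rightarrow> complex" where
  "V z = - \<i> * z ^ 3 / 3"

definition Q :: "complex \<Rightarrow> complex" where
  "Q z = - (1 / 4) * (z + \<i>) ^ 2 * (z ^ 2 - 2 * \<i> * z - 3)"

definition z1 :: complex where "z1 = - complex_of_real (sqrt 2) + \<i>"

definition z2 :: complex where "z2 = complex_of_real (sqrt 2) + \<i>"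

text \<open>
  The square root in the trajectory condition is a continuous branch along the arc; since \<open>Q\<close> has no
  zeros in the interior of the arc, there are exactly two, which differ by the sign.
\<close>

definition critical_trajectory :: "(real \<Rightarrow> complex) \<Rightarrow> bool" where
  "critical_trajectory g \<longleftrightarrow>
     arc g \<and> analytic_curve_on {0..1} g \<and> pathstart g = z1 \<and> pathfinish g = z2 \<and>
     (\<forall>t\<in>{0<..<1}. Q (g t) \<noteq> 0) \<and>
     (\<exists>r. continuous_on (path_image g) r \<and> (\<forall>s\<in>path_image g. r s ^ 2 = Q s) \<and>
          (\<forall>t\<in>{0..1}. 1 / (of_real pi * \<i>) * contour_integral (subpath 0 t g) r \<in> \<real>))"

definition sqrt_Q_branch :: "(real \<Rightarrow> complex) \<Rightarrow> (complex \<Rightarrow> complex) \<Rightarrow> bool" where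
  "sqrt_Q_branch g q \<longleftrightarrow>
     q holomorphic_on (- path_image g) \<and> (\<forall>z\<in>- path_image g. q z ^ 2 = Q z) \<and>
     (\<lambda>z. q z - (- (1 / 2) * \<i> * z ^ 2 - 1 / z)) \<in> O[at_infinity](\<lambda>z. 1 / z ^ 2)"

text \<open>
  \<open>G\<close> parametrizes the whole contour $\Gamma$ over the real line: its restriction to the unit interval
  is $\gamma$, its restrictions to \<open>{..0}\<close> and \<open>{1..}\<close> are $\gamma_1$ and $\gamma_2$. The path
  \<open>subpath u t G\<close> runs from \<open>G u\<close> to \<open>G t\<close>, also for \<open>t < u\<close>.
\<close>

definition Gamma_contour :: "(real \<Rightarrow> complex) \<Rightarrow> (complex \<Rightarrow> complex) \<Rightarrow> bool" where
  "Gamma_contour G q \<longleftrightarrow>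
     critical_trajectory G \<and> sqrt_Q_branch G q \<and>
     inj G \<and> analytic_curve_on UNIV G \<and>
     (\<forall>t<0. contour_integral (subpath 0 t G) q \<in> \<real> \<and>
            Re (contour_integral (subpath 0 t G) q) > 0) \<and>
     (\<forall>t>1. contour_integral (subpath 1 t G) q \<in> \<real> \<and>
            Re (contour_integral (subpath 1 t G) q) > 0) \<and>
     filterlim G at_infinity at_bot \<and> ((\<lambda>t. sgn (G t)) \<longlongrightarrow> cis (5 * pi / 6)) at_bot \<and>
     filterlim G at_infinity at_top \<and> ((\<lambda>t. sgn (G t)) \<longlongrightarrow> cis (pi / 6)) at_top"

end

theory Submission
  imports Defs "HOL-Real_Asymp.Real_Asymp"
begin

text \<open>
  Write $d\mu = \frac{1}{\pi i} q_+\,ds$ on $\gamma$ and let $h$ be its Cauchy transform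
  $\int d\mu(s)/(z-s)$. Everything follows from the identity $h = V'/2 - q$ off $\gamma$
  (\<open>cauchy_transform_eq\<close>). The end points of $\gamma$ are simple zeros of $Q$, so $q$ changes its
  sign across $\gamma$ (\<open>boundary_values_exist\<close>). Cauchy's integral formula on the two sides of
  $\gamma$ therefore shows that $q + h$ extends analytically across $\gamma$, end points
  included; by the prescribed behaviour of $q$ at infinity, $q + h - V'/2$ is an entire function
  that vanishes at infinity. The term $-1/z$ in the expansion of $q$ yields $\mu(\gamma) = 1$.
  The trajectory condition makes the density of $\mu$ real; it has no zero inside $\gamma$,
  hence a constant sign, which is positive because the total mass is.

  By the identity, $W = 2U^\mu + \mathrm{Re}\,V$ has the differential $\mathrm{Re}(2q\,dz)$ off
  $\gamma$. Along $\gamma$ the form $q_+\,dz$ is purely imaginary, so that $W$ is constant there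
  (\<open>W_on_arc\<close>); along $\gamma_1$ and $\gamma_2$ the difference of $W$ to this constant is
  $2\phi_1 > 0$ and $2\phi_2 > 0$ (\<open>W_ge\<close>). The normal derivatives on the two sides of $\gamma$ are
  the real parts of $2q_+n$ and $2q_-(-n)$, which agree since $q_- = -q_+$: this is the
  S-property.

  It remains that the two (in)equalities for $W$, the Frostman conditions, make $\mu$ the unique
  minimizer (\<open>Frostman_imp_equilibrium\<close>). For a competitor $\nu$ of finite energy,
  $I_V(\nu) - I_V(\mu)$ is the logarithmic energy of $\nu - \mu$ plus $\int W\,d(\nu - \mu) \ge 0$,
  and the logarithmic energy of a signed measure of total mass $0$ is positive unless the measure
  vanishes (\<open>log_energy_strictly_positive\<close>): up to a constant, the kernel $\log(1/|z-s|)$ is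
  a superposition of Gaussians $e^{-t|z-s|^2}$, and every Gaussian is a convolution square.

  All local arguments at $\gamma$ take place in the complexified parameter: the real-analytic
  parametrization extends to an injective holomorphic function \<open>F\<close> near the unit interval, which
  turns $\gamma$ into a straight segment.
\<close>

section \<open>Positivity of the logarithmic energy\<close>

text \<open>
  The planar Gaussian around \<open>z\<close>. The integration variable is a pair of reals because Lebesgue
  measure on pairs is a product measure, so that one-dimensional integrals suffice.
\<close>

definition gauss_kernel :: "real \<Rightarrow> complex \<Rightarrow> real \<times> real \<Rightarrow> real" where
  "gauss_kernel \<sigma> z w = normal_density (Re z) \<sigma> (fst w) * normal_density (Im z) \<sigma> (snd w)"

lemma gauss_kernel_nonneg: "gauss_kernel \<sigma> z w \<ge> 0"
  by (simp add: gauss_kernel_def)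

lemma gauss_kernel_measurable [measurable]:
  "case_prod (gauss_kernel \<sigma>) \<in> borel_measurable (borel \<Otimes>\<^sub>M borel)"
proof -
  have [measurable]: "(fst :: real \<times> real \<Rightarrow> real) \<in> borel_measurable borel"
    "(snd :: real \<times> real \<Rightarrow> real) \<in> borel_measurable borel"
    by (intro borel_measurable_continuous_onI continuous_intros)+
  show ?thesis unfolding gauss_kernel_def normal_density_def split_beta' by measurable
qed

lemma gauss_kernel_measurable' [measurable]:
  assumes "f \<in> borel_measurable M" "g \<in> borel_measurable M"
  shows "(\<lambda>x. gauss_kernel \<sigma> (f x) (g x)) \<in> borel_measurable M"
  using measurable_compose[OF measurable_Pair[OF assms] gauss_kernel_measurable] by simp

lemma gauss_kernel_le:
  assumes "\<sigma> > 0" shows "gauss_kernel \<sigma> z w \<le> 1 / (2 * pi * \<sigma>\<^sup>2)"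
proof -
  have b: "normal_density a \<sigma> x \<le> 1 / sqrt (2 * pi * \<sigma>\<^sup>2)" for a x
    unfolding normal_density_def by (intro mult_left_le) auto
  have "gauss_kernel \<sigma> z w \<le> 1 / sqrt (2 * pi * \<sigma>\<^sup>2) * (1 / sqrt (2 * pi * \<sigma>\<^sup>2))"
    unfolding gauss_kernel_def by (intro mult_mono b) auto
  also have "\<dots> = 1 / (2 * pi * \<sigma>\<^sup>2)" by simp
  finally show ?thesis .
qed

text \<open>
  Completing the square around the midpoint of \<open>a\<close> and \<open>b\<close>.
\<close>

lemma normal_density_mult:
  assumes "\<sigma> > 0"
  shows "normal_density a \<sigma> x * normal_density b \<sigma> x =
    1 / sqrt (4 * pi * \<sigma>\<^sup>2) * exp (- (a - b)\<^sup>2 / (4 * \<sigma>\<^sup>2)) * normal_density ((a + b) / 2) (\<sigma> / sqrt 2) x"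
proof -
  have e: "- (x - a)\<^sup>2 / (2 * \<sigma>\<^sup>2) + - (x - b)\<^sup>2 / (2 * \<sigma>\<^sup>2) =
      - (a - b)\<^sup>2 / (4 * \<sigma>\<^sup>2) + - (x - (a + b) / 2)\<^sup>2 / (2 * (\<sigma> / sqrt 2)\<^sup>2)"
    using assms by (simp add: power_divide field_simps power2_eq_square)
  have s: "sqrt (2 * pi * \<sigma>\<^sup>2) * sqrt (2 * pi * \<sigma>\<^sup>2) = sqrt (4 * pi * \<sigma>\<^sup>2) * sqrt (2 * pi * (\<sigma> / sqrt 2)\<^sup>2)"
    using assms by (simp add: real_sqrt_mult power_divide real_sqrt_divide)
  have "normal_density a \<sigma> x * normal_density b \<sigma> x =
     1 / (sqrt (2 * pi * \<sigma>\<^sup>2) * sqrt (2 * pi * \<sigma>\<^sup>2)) * exp (- (x - a)\<^sup>2 / (2 * \<sigma>\<^sup>2) + - (x - b)\<^sup>2 / (2 * \<sigma>\<^sup>2))"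
    unfolding normal_density_def exp_add by simp
  also have "\<dots> = 1 / (sqrt (4 * pi * \<sigma>\<^sup>2) * sqrt (2 * pi * (\<sigma> / sqrt 2)\<^sup>2)) *
     exp (- (a - b)\<^sup>2 / (4 * \<sigma>\<^sup>2) + - (x - (a + b) / 2)\<^sup>2 / (2 * (\<sigma> / sqrt 2)\<^sup>2))"
    unfolding e s ..
  finally show ?thesis unfolding normal_density_def exp_add by simp
qed

lemma nn_integral_normal_density: "\<sigma> > 0 \<Longrightarrow> (\<integral>\<^sup>+x. ennreal (normal_density a \<sigma> x) \<partial>lborel) = 1"
  by (subst nn_integral_eq_integral) auto

lemma nn_integral_prod_fun:
  fixes f g :: "real \<Rightarrow> real"
  assumes [measurable]: "f \<in> borel_measurable borel" "g \<in> borel_measurable borel"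
    and "\<And>x. f x \<ge> 0" "\<And>x. g x \<ge> 0"
  shows "(\<integral>\<^sup>+w. ennreal (f (fst w) * g (snd w)) \<partial>(lborel :: (real \<times> real) measure)) =
     (\<integral>\<^sup>+x. f x \<partial>lborel) * (\<integral>\<^sup>+x. g x \<partial>lborel)"
  unfolding lborel_prod[symmetric]
  by (subst lborel.nn_integral_fst[symmetric])
     (auto simp: ennreal_mult assms nn_integral_cmult nn_integral_multc)

lemma nn_integral_gauss_kernel:
  "\<sigma> > 0 \<Longrightarrow> (\<integral>\<^sup>+w. ennreal (gauss_kernel \<sigma> z w) \<partial>lborel) = 1"
  unfolding gauss_kernel_def by (subst nn_integral_prod_fun) (auto simp: nn_integral_normal_density)

text \<open>
  A Gaussian in the distance of two points is the inner product of two narrower Gaussians centred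
  at these points; this is what makes the Gaussian a positive definite kernel.
\<close>

lemma nn_integral_gauss_kernel_mult:
  assumes "\<sigma> > 0"
  shows "(\<integral>\<^sup>+w. ennreal (gauss_kernel \<sigma> z w * gauss_kernel \<sigma> s w) \<partial>lborel) =
     ennreal (1 / (4 * pi * \<sigma>\<^sup>2) * exp (- (cmod (z - s))\<^sup>2 / (4 * \<sigma>\<^sup>2)))"
proof -
  have 1: "(\<integral>\<^sup>+x. ennreal (normal_density a \<sigma> x * normal_density b \<sigma> x) \<partial>lborel) =
     ennreal (1 / sqrt (4 * pi * \<sigma>\<^sup>2) * exp (- (a - b)\<^sup>2 / (4 * \<sigma>\<^sup>2)))" for a b
    using assms unfolding normal_density_mult[OF assms]
    by (subst ennreal_mult) (auto simp: nn_integral_cmult nn_integral_normal_density)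
  have "(\<integral>\<^sup>+w. ennreal (gauss_kernel \<sigma> z w * gauss_kernel \<sigma> s w) \<partial>lborel) =
    (\<integral>\<^sup>+w. ennreal ((normal_density (Re z) \<sigma> (fst w) * normal_density (Re s) \<sigma> (fst w)) *
        (normal_density (Im z) \<sigma> (snd w) * normal_density (Im s) \<sigma> (snd w))) \<partial>lborel)"
    by (simp add: gauss_kernel_def mult_ac)
  also have "\<dots> = ennreal (1 / sqrt (4 * pi * \<sigma>\<^sup>2) * exp (- (Re z - Re s)\<^sup>2 / (4 * \<sigma>\<^sup>2))) *
      ennreal (1 / sqrt (4 * pi * \<sigma>\<^sup>2) * exp (- (Im z - Im s)\<^sup>2 / (4 * \<sigma>\<^sup>2)))"
    by (subst nn_integral_prod_fun) (auto simp: 1)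
  also have "\<dots> = ennreal ((1 / sqrt (4 * pi * \<sigma>\<^sup>2) * (1 / sqrt (4 * pi * \<sigma>\<^sup>2))) *
       (exp (- (Re z - Re s)\<^sup>2 / (4 * \<sigma>\<^sup>2)) * exp (- (Im z - Im s)\<^sup>2 / (4 * \<sigma>\<^sup>2))))"
    by (subst ennreal_mult[symmetric]) (auto simp: mult_ac)
  also have "(1 / sqrt (4 * pi * \<sigma>\<^sup>2) * (1 / sqrt (4 * pi * \<sigma>\<^sup>2))) = 1 / (4 * pi * \<sigma>\<^sup>2)"
    by simp
  also have "exp (- (Re z - Re s)\<^sup>2 / (4 * \<sigma>\<^sup>2)) * exp (- (Im z - Im s)\<^sup>2 / (4 * \<sigma>\<^sup>2)) =
     exp (- (cmod (z - s))\<^sup>2 / (4 * \<sigma>\<^sup>2))"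
    by (simp add: exp_add[symmetric] cmod_power2 diff_divide_distrib add_divide_distrib)
  finally show ?thesis .
qed

definition gauss_smoothing :: "real \<Rightarrow> complex measure \<Rightarrow> real \<times> real \<Rightarrow> real" where
  "gauss_smoothing \<sigma> M w = (\<integral>z. gauss_kernel \<sigma> z w \<partial>M)"

definition gauss_energy :: "real \<Rightarrow> complex measure \<Rightarrow> complex measure \<Rightarrow> real" where
  "gauss_energy t M N = (\<integral>p. exp (- t * (cmod (fst p - snd p))\<^sup>2) \<partial>(M \<Otimes>\<^sub>M N))"

lemma integrable_gauss_kernel:
  assumes "prob_space M" "sets M = sets borel" "\<sigma> > 0"
  shows "integrable M (\<lambda>z. gauss_kernel \<sigma> z w)"
proof -
  interpret prob_space M by fact
  note [measurable_cong] = assms(2)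
  show ?thesis
    by (rule integrable_const_bound[where B="1 / (2 * pi * \<sigma>\<^sup>2)"])
       (use gauss_kernel_le[OF assms(3)] gauss_kernel_nonneg in auto)
qed

lemma nn_gauss_smoothing:
  assumes "prob_space M" "sets M = sets borel" "\<sigma> > 0"
  shows "ennreal (gauss_smoothing \<sigma> M w) = (\<integral>\<^sup>+z. gauss_kernel \<sigma> z w \<partial>M)"
  unfolding gauss_smoothing_def
  using integrable_gauss_kernel[OF assms] gauss_kernel_nonneg by (subst nn_integral_eq_integral) auto

lemma gauss_smoothing_nonneg: "gauss_smoothing \<sigma> M w \<ge> 0"
  unfolding gauss_smoothing_def by (intro Bochner_Integration.integral_nonneg gauss_kernel_nonneg)

lemma gauss_smoothing_measurable:
  assumes "prob_space M" "sets M = sets borel"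
  shows "gauss_smoothing \<sigma> M \<in> borel_measurable borel"
proof -
  interpret prob_space M by fact
  note [measurable_cong] = assms(2)
  show ?thesis unfolding gauss_smoothing_def by measurable
qed

lemma gauss_energy_eq:
  assumes M: "prob_space M" "sets M = sets borel" and N: "prob_space N" "sets N = sets borel"
    and \<sigma>: "\<sigma> > 0"
  shows "has_bochner_integral lborel (\<lambda>w. gauss_smoothing \<sigma> M w * gauss_smoothing \<sigma> N w)
           (1 / (4 * pi * \<sigma>\<^sup>2) * gauss_energy (1 / (4 * \<sigma>\<^sup>2)) M N)"
proof -
  interpret M: prob_space M by fact
  interpret N: prob_space N by fact
  interpret MN: pair_prob_space M N ..
  interpret MNL: pair_sigma_finite "M \<Otimes>\<^sub>M N" "lborel :: (real \<times> real) measure" ..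
  note [measurable_cong] = M(2) N(2)
  have int: "integrable (M \<Otimes>\<^sub>M N) (\<lambda>p. exp (- t * (cmod (fst p - snd p))\<^sup>2))" if "t \<ge> 0" for t
    by (rule MN.integrable_const_bound[where B=1]) (use that in auto)
  have "(\<integral>\<^sup>+w. ennreal (gauss_smoothing \<sigma> M w * gauss_smoothing \<sigma> N w) \<partial>lborel) =
     (\<integral>\<^sup>+w. (\<integral>\<^sup>+z. \<integral>\<^sup>+s. ennreal (gauss_kernel \<sigma> z w * gauss_kernel \<sigma> s w) \<partial>N \<partial>M) \<partial>lborel)"
    by (simp add: ennreal_mult gauss_smoothing_nonneg nn_gauss_smoothing M N \<sigma> gauss_kernel_nonneg
        nn_integral_cmult nn_integral_multc)
  also have "\<dots> = (\<integral>\<^sup>+w. (\<integral>\<^sup>+p. ennreal (gauss_kernel \<sigma> (fst p) w * gauss_kernel \<sigma> (snd p) w) \<partial>(M \<Otimes>\<^sub>M N)) \<partial>lborel)"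
    by (intro nn_integral_cong) (subst N.nn_integral_fst[symmetric], auto)
  also have "\<dots> = (\<integral>\<^sup>+p. (\<integral>\<^sup>+w. ennreal (gauss_kernel \<sigma> (fst p) w * gauss_kernel \<sigma> (snd p) w) \<partial>lborel) \<partial>(M \<Otimes>\<^sub>M N))"
    by (rule MNL.Fubini') measurable
  also have "\<dots> = (\<integral>\<^sup>+p. ennreal (1 / (4 * pi * \<sigma>\<^sup>2)) * ennreal (exp (- (1 / (4 * \<sigma>\<^sup>2)) * (cmod (fst p - snd p))\<^sup>2)) \<partial>(M \<Otimes>\<^sub>M N))"
    by (intro nn_integral_cong) (subst nn_integral_gauss_kernel_mult[OF \<sigma>], simp add: ennreal_mult[symmetric])
  also have "\<dots> = ennreal (1 / (4 * pi * \<sigma>\<^sup>2)) * ennreal (gauss_energy (1 / (4 * \<sigma>\<^sup>2)) M N)"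
    unfolding gauss_energy_def
    by (subst nn_integral_cmult) (use int[of "1 / (4 * \<sigma>\<^sup>2)"] in \<open>auto simp: nn_integral_eq_integral\<close>)
  also have "\<dots> = ennreal (1 / (4 * pi * \<sigma>\<^sup>2) * gauss_energy (1 / (4 * \<sigma>\<^sup>2)) M N)"
    by (rule ennreal_mult[symmetric]) (auto simp: gauss_energy_def)
  finally have eq: "(\<integral>\<^sup>+w. ennreal (gauss_smoothing \<sigma> M w * gauss_smoothing \<sigma> N w) \<partial>lborel) =
     ennreal (1 / (4 * pi * \<sigma>\<^sup>2) * gauss_energy (1 / (4 * \<sigma>\<^sup>2)) M N)" .
  show ?thesis
    by (rule has_bochner_integral_nn_integral[OF _ _ _ eq])
       (use gauss_smoothing_measurable M N in \<open>auto simp: gauss_smoothing_nonneg gauss_energy_def\<close>)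
qed

text \<open>
  The quadratic form of the Gaussian kernel at \<open>M - N\<close> is, up to a positive factor, the squared
  $L^2$ norm of the difference of the two smoothings.
\<close>

lemma gauss_energy_diff:
  assumes M: "prob_space M" "sets M = sets borel" and N: "prob_space N" "sets N = sets borel"
    and t: "t > 0"
  shows "gauss_energy t M M - 2 * gauss_energy t M N + gauss_energy t N N \<ge> 0"
    and "gauss_energy t M M - 2 * gauss_energy t M N + gauss_energy t N N = 0 \<Longrightarrow>
      AE w in lborel. gauss_smoothing (1 / (2 * sqrt t)) M w = gauss_smoothing (1 / (2 * sqrt t)) N w"
proof -
  define \<sigma> where "\<sigma> = 1 / (2 * sqrt t)"
  have \<sigma>: "\<sigma> > 0" "1 / (4 * \<sigma>\<^sup>2) = t"
    using t by (auto simp: \<sigma>_def power_divide power_mult_distrib)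
  let ?c = "1 / (4 * pi * \<sigma>\<^sup>2)"
  let ?p = "gauss_smoothing \<sigma>"
  note e = gauss_energy_eq[OF M M \<sigma>(1)] gauss_energy_eq[OF M N \<sigma>(1)] gauss_energy_eq[OF N N \<sigma>(1)]
  have b: "has_bochner_integral lborel (\<lambda>w. ?p M w * ?p M w - 2 * (?p M w * ?p N w) + ?p N w * ?p N w)
     (?c * gauss_energy t M M - 2 * (?c * gauss_energy t M N) + ?c * gauss_energy t N N)"
    using e unfolding \<sigma>(2)
    by (intro has_bochner_integral_add has_bochner_integral_diff has_bochner_integral_mult_right)
  have sq: "(\<lambda>w. ?p M w * ?p M w - 2 * (?p M w * ?p N w) + ?p N w * ?p N w) = (\<lambda>w. (?p M w - ?p N w)\<^sup>2)"
    by (auto simp: power2_eq_square algebra_simps)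
  have c: "?c > 0" using \<sigma> by simp
  have v: "?c * gauss_energy t M M - 2 * (?c * gauss_energy t M N) + ?c * gauss_energy t N N =
     ?c * (gauss_energy t M M - 2 * gauss_energy t M N + gauss_energy t N N)"
    by (simp add: algebra_simps add_divide_distrib)
  note b = b[unfolded sq v]
  have "?c * (gauss_energy t M M - 2 * gauss_energy t M N + gauss_energy t N N) \<ge> 0"
    using has_bochner_integral_integral_eq[OF b] by (metis (no_types, lifting) Bochner_Integration.integral_nonneg zero_le_power2)
  then show "gauss_energy t M M - 2 * gauss_energy t M N + gauss_energy t N N \<ge> 0"
    using c by (metis (mono_tags, lifting) linorder_not_le mult_pos_neg)
  assume "gauss_energy t M M - 2 * gauss_energy t M N + gauss_energy t N N = 0"
  with b have "has_bochner_integral lborel (\<lambda>w. (?p M w - ?p N w)\<^sup>2) 0" by simp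
  then have "AE w in lborel. (?p M w - ?p N w)\<^sup>2 = 0"
    using integral_nonneg_eq_0_iff_AE[of lborel "\<lambda>w. (?p M w - ?p N w)\<^sup>2"]
    by (auto simp: has_bochner_integral_iff)
  then show "AE w in lborel. gauss_smoothing (1 / (2 * sqrt t)) M w = gauss_smoothing (1 / (2 * sqrt t)) N w"
    by (simp add: \<sigma>_def)
qed

lemma integral_gauss_kernel_affine:
  fixes f :: "real \<times> real \<Rightarrow> real"
  assumes \<sigma>: "\<sigma> > 0" and [measurable]: "f \<in> borel_measurable borel"
  shows "(\<integral>w. f w * gauss_kernel \<sigma> z w \<partial>lborel) =
     (\<integral>w. f ((Re z, Im z) + \<sigma> *\<^sub>R w) * gauss_kernel 1 0 w \<partial>lborel)"
proof -
  have nd: "\<sigma> * normal_density a \<sigma> (a + \<sigma> * x) = normal_density 0 1 x" for a x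
    using \<sigma> by (simp add: normal_density_def power_mult_distrib real_sqrt_mult field_simps)
  have k: "\<sigma>\<^sup>2 * gauss_kernel \<sigma> z ((Re z, Im z) + \<sigma> *\<^sub>R w) = gauss_kernel 1 0 w" for w
    using nd[of "Re z" "fst w"] nd[of "Im z" "snd w"]
    unfolding gauss_kernel_def by (simp add: power2_eq_square mult_ac) (metis mult.assoc mult.commute)
  have "(\<integral>w. f w * gauss_kernel \<sigma> z w \<partial>lborel) =
     (\<integral>w. f w * gauss_kernel \<sigma> z w
        \<partial>density (distr lborel borel (\<lambda>x. (Re z, Im z) + \<sigma> *\<^sub>R x)) (\<lambda>_. \<bar>\<sigma>\<bar>^DIM(real \<times> real)))"
    using \<sigma> by (subst lborel_affine[of \<sigma> "(Re z, Im z)"]) auto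
  also have "\<dots> = (\<integral>w. (f ((Re z, Im z) + \<sigma> *\<^sub>R w) * (\<sigma>\<^sup>2 * gauss_kernel \<sigma> z ((Re z, Im z) + \<sigma> *\<^sub>R w))) \<partial>lborel)"
    using \<sigma> by (subst integral_real_density) (auto simp: integral_distr mult_ac power2_eq_square)
  finally show ?thesis unfolding k .
qed

lemma integrable_gauss_kernel_lborel: "\<sigma> > 0 \<Longrightarrow> integrable lborel (gauss_kernel \<sigma> z)"
  using nn_integral_gauss_kernel[of \<sigma> z] gauss_kernel_nonneg by (intro integrableI_nonneg) auto

text \<open>
  Integrating against the smoothed measure means averaging over a Gaussian displacement of size
  \<open>\<sigma>\<close>. In this form the limit \<open>\<sigma> \<rightarrow> 0\<close> is a matter of dominated convergence.
\<close>

lemma integral_gauss_smoothing: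
  fixes f :: "complex \<Rightarrow> real"
  assumes M: "prob_space M" "sets M = sets borel" and \<sigma>: "\<sigma> > 0"
    and f[measurable]: "f \<in> borel_measurable borel" and B: "\<And>z. \<bar>f z\<bar> \<le> B"
  shows "(\<integral>w. f (Complex (fst w) (snd w)) * gauss_smoothing \<sigma> M w \<partial>lborel) =
     (\<integral>z. (\<integral>w. f (z + \<sigma> *\<^sub>R Complex (fst w) (snd w)) * gauss_kernel 1 0 w \<partial>lborel) \<partial>M)"
proof -
  interpret M: prob_space M by fact
  interpret MW: pair_sigma_finite M "lborel :: (real \<times> real) measure" ..
  note [measurable_cong] = M(2)
  have [measurable]: "(\<lambda>w. Complex (fst w) (snd w)) \<in> borel_measurable borel"
    by (intro borel_measurable_continuous_onI) (simp add: Complex_eq, intro continuous_intros)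
  have int: "integrable lborel (\<lambda>w. f (Complex (fst w) (snd w)) * gauss_kernel \<sigma> z w)" for z
  proof (rule Bochner_Integration.integrable_bound)
    show "integrable lborel (\<lambda>w. B * gauss_kernel \<sigma> z w)"
      using integrable_gauss_kernel_lborel[OF \<sigma>] by simp
    show "AE w in lborel. norm (f (Complex (fst w) (snd w)) * gauss_kernel \<sigma> z w) \<le> norm (B * gauss_kernel \<sigma> z w)"
      using B by (auto simp: abs_mult intro!: mult_right_mono order_trans[OF B abs_ge_self])
  qed measurable
  have bnd: "norm (\<integral>w. norm (f (Complex (fst w) (snd w)) * gauss_kernel \<sigma> z w) \<partial>lborel) \<le> B" for z
  proof -
    have "(\<integral>w. norm (f (Complex (fst w) (snd w)) * gauss_kernel \<sigma> z w) \<partial>lborel) \<le> (\<integral>w. B * gauss_kernel \<sigma> z w \<partial>lborel)"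
      using integrable_gauss_kernel_lborel[OF \<sigma>] B
      by (intro integral_mono integrable_norm int) (auto simp: abs_mult gauss_kernel_nonneg intro!: mult_right_mono)
    also have "(\<integral>w. gauss_kernel \<sigma> z w \<partial>lborel) = 1"
      using nn_integral_gauss_kernel[OF \<sigma>, of z] gauss_kernel_nonneg
      by (subst integral_eq_nn_integral) auto
    then have "(\<integral>w. B * gauss_kernel \<sigma> z w \<partial>lborel) = B" by simp
    finally show ?thesis by (simp add: Bochner_Integration.integral_nonneg)
  qed
  have "integrable (M \<Otimes>\<^sub>M lborel) (\<lambda>p. f (Complex (fst (snd p)) (snd (snd p))) * gauss_kernel \<sigma> (fst p) (snd p))"
  proof (rule MW.Fubini_integrable)
    show "(\<lambda>p. f (Complex (fst (snd p)) (snd (snd p))) * gauss_kernel \<sigma> (fst p) (snd p)) \<in> borel_measurable (M \<Otimes>\<^sub>M lborel)"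
    proof -
      have "(\<lambda>w. f (Complex (fst w) (snd w))) \<circ> snd \<in> borel_measurable (M \<Otimes>\<^sub>M lborel)"
        by measurable
      then have [measurable]: "(\<lambda>p. f (Complex (fst (snd p)) (snd (snd p)))) \<in> borel_measurable (M \<Otimes>\<^sub>M lborel)"
        by (simp add: comp_def)
      show ?thesis by measurable
    qed
    show "integrable M (\<lambda>x. LINT y|lborel. norm (f (Complex (fst (snd (x, y))) (snd (snd (x, y)))) * gauss_kernel \<sigma> (fst (x, y)) (snd (x, y))))"
      by (rule M.integrable_const_bound[where B=B]) (use bnd in auto)
  qed (use int in auto)
  then have "integrable (M \<Otimes>\<^sub>M lborel) (\<lambda>(z, w). f (Complex (fst w) (snd w)) * gauss_kernel \<sigma> z w)"
    by (simp add: split_beta')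
  from MW.Fubini_integral[OF this]
  have "(\<integral>w. f (Complex (fst w) (snd w)) * gauss_smoothing \<sigma> M w \<partial>lborel) =
    (\<integral>z. (\<integral>w. f (Complex (fst w) (snd w)) * gauss_kernel \<sigma> z w \<partial>lborel) \<partial>M)"
    by (simp add: gauss_smoothing_def)
  also have "\<dots> = (\<integral>z. (\<integral>w. f (z + \<sigma> *\<^sub>R Complex (fst w) (snd w)) * gauss_kernel 1 0 w \<partial>lborel) \<partial>M)"
    by (subst integral_gauss_kernel_affine[OF \<sigma>]) (auto simp: complex_eq_iff intro!: Bochner_Integration.integral_cong arg_cong[where f=f])
  finally show ?thesis .
qed

lemma gauss_smoothing_tendsto:
  fixes f :: "complex \<Rightarrow> real"
  assumes M: "prob_space M" "sets M = sets borel" and \<sigma>: "\<And>n. \<sigma> n > 0" "\<sigma> \<longlonglongrightarrow> 0"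
    and f: "continuous_on UNIV f" and B: "\<And>z. \<bar>f z\<bar> \<le> B"
  shows "(\<lambda>n. \<integral>w. f (Complex (fst w) (snd w)) * gauss_smoothing (\<sigma> n) M w \<partial>lborel) \<longlonglongrightarrow> (\<integral>z. f z \<partial>M)"
proof -
  interpret M: prob_space M by fact
  note [measurable_cong] = M(2)
  have [measurable]: "f \<in> borel_measurable borel" using f by (rule borel_measurable_continuous_onI)
  have [measurable]: "(\<lambda>w. Complex (fst w) (snd w)) \<in> borel_measurable borel"
    by (intro borel_measurable_continuous_onI) (simp add: Complex_eq, intro continuous_intros)
  have one: "(\<integral>w. gauss_kernel 1 0 w \<partial>lborel) = 1"
    using nn_integral_gauss_kernel[of 1 0] gauss_kernel_nonneg by (subst integral_eq_nn_integral) auto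
  let ?h = "\<lambda>n z w. f (z + \<sigma> n *\<^sub>R Complex (fst w) (snd w)) * gauss_kernel 1 0 w"
  have bd: "norm (?h n z w) \<le> B * gauss_kernel 1 0 w" for n z w
    using B by (auto simp: abs_mult gauss_kernel_nonneg intro!: mult_right_mono)
  have intB: "integrable lborel (\<lambda>w. B * gauss_kernel 1 0 w)"
    using integrable_gauss_kernel_lborel[of 1 0] by simp
  have meas: "(\<lambda>w. ?h n z w) \<in> borel_measurable lborel" for n z by measurable
  have lim: "(\<lambda>n. \<integral>w. ?h n z w \<partial>lborel) \<longlonglongrightarrow> f z" for z
  proof -
    have "(\<lambda>n. \<integral>w. ?h n z w \<partial>lborel) \<longlonglongrightarrow> (\<integral>w. f z * gauss_kernel 1 0 w \<partial>lborel)"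
    proof (rule integral_dominated_convergence[OF _ meas intB])
      have "(\<lambda>n. ?h n z w) \<longlonglongrightarrow> f z * gauss_kernel 1 0 w" for w
      proof -
        have "(\<lambda>n. z + \<sigma> n *\<^sub>R Complex (fst w) (snd w)) \<longlonglongrightarrow> z + 0 *\<^sub>R Complex (fst w) (snd w)"
          by (intro tendsto_intros \<sigma>)
        then have "(\<lambda>n. f (z + \<sigma> n *\<^sub>R Complex (fst w) (snd w))) \<longlonglongrightarrow> f z"
          using continuous_on_tendsto_compose[OF f, of _ z sequentially] by simp
        then show ?thesis by (intro tendsto_intros)
      qed
      then show "AE w in lborel. (\<lambda>n. ?h n z w) \<longlonglongrightarrow> f z * gauss_kernel 1 0 w" by simp
    qed (use bd in auto)
    then show ?thesis by (simp add: one)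
  qed
  have "(\<lambda>n. \<integral>z. (\<integral>w. ?h n z w \<partial>lborel) \<partial>M) \<longlonglongrightarrow> (\<integral>z. f z \<partial>M)"
  proof (rule integral_dominated_convergence[where w="\<lambda>_. B"])
    show "(\<lambda>z. \<integral>w. ?h n z w \<partial>lborel) \<in> borel_measurable M" for n
    proof -
      have "(\<lambda>p. z + p) \<in> borel_measurable borel" for z :: complex by measurable
      have "(\<lambda>p. fst p + \<sigma> n *\<^sub>R (\<lambda>w. Complex (fst w) (snd w)) (snd p)) \<in> borel_measurable (M \<Otimes>\<^sub>M lborel)"
        by measurable
      then have "(\<lambda>p. f (fst p + \<sigma> n *\<^sub>R Complex (fst (snd p)) (snd (snd p)))) \<in> borel_measurable (M \<Otimes>\<^sub>M lborel)"
        by (rule measurable_compose) simp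
      then have "(\<lambda>p. ?h n (fst p) (snd p)) \<in> borel_measurable (M \<Otimes>\<^sub>M lborel)"
        by measurable
      then show ?thesis by (intro lborel.borel_measurable_lebesgue_integral) (simp add: split_beta')
    qed
    show "AE z in M. norm (\<integral>w. ?h n z w \<partial>lborel) \<le> B" for n
    proof (rule AE_I2)
      fix z
      have "norm (\<integral>w. ?h n z w \<partial>lborel) \<le> (\<integral>w. B * gauss_kernel 1 0 w \<partial>lborel)"
        by (rule order_trans[OF integral_norm_bound], rule integral_mono')
           (use intB bd gauss_kernel_nonneg B[of 0] in \<open>auto\<close>)
      then show "norm (\<integral>w. ?h n z w \<partial>lborel) \<le> B" by (simp add: one)
    qed
  qed (use lim in auto)
  then show ?thesis
    by (subst integral_gauss_smoothing[OF M \<sigma>(1) _ B]) auto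
qed

text \<open>
  The indicator of an open set is the limit of continuous functions with values in the unit
  interval, truncated multiples of the distance to the complement.
\<close>

lemma measure_eqI_continuous:
  fixes M N :: "complex measure"
  assumes M: "prob_space M" "sets M = sets borel" and N: "prob_space N" "sets N = sets borel"
    and eq: "\<And>f B. continuous_on UNIV f \<Longrightarrow> (\<And>z. \<bar>f z\<bar> \<le> B) \<Longrightarrow> (\<integral>z. f z \<partial>M) = (\<integral>z. (f z::real) \<partial>N)"
  shows "M = N"
proof (rule measure_eqI_generator_eq[where E="{S. open S}" and \<Omega>=UNIV and A="\<lambda>_. UNIV"])
  interpret M: prob_space M by fact
  interpret N: prob_space N by fact
  show "Int_stable {S::complex set. open S}" by (auto simp: Int_stable_def)
  show "sets M = sigma_sets UNIV {S. open S}" "sets N = sigma_sets UNIV {S. open S}"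
    using M N by (auto simp: borel_def)
  show "emeasure M X = emeasure N X" if "X \<in> {S. open S}" for X
  proof (cases "X = UNIV")
    case True
    then show ?thesis using M.emeasure_space_1 N.emeasure_space_1 sets_eq_imp_space_eq[OF M(2)] sets_eq_imp_space_eq[OF N(2)] by simp
  next
    case False
    define f where "f n z = min 1 (real n * infdist z (- X))" for n z
    have cf: "continuous_on UNIV (f n)" for n unfolding f_def by (intro continuous_intros)
    have bf: "\<bar>f n z\<bar> \<le> 1" for n z by (auto simp: f_def infdist_nonneg)
    have lim: "(\<lambda>n. f n z) \<longlonglongrightarrow> indicator X z" for z
    proof (cases "z \<in> X")
      case True
      then have p: "infdist z (- X) > 0"
        using that False by (metis (no_types, lifting) Compl_UNIV_eq ComplD closed_Compl compl_eq_compl_iff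
            in_closed_iff_infdist_zero infdist_nonneg less_eq_real_def mem_Collect_eq)
      obtain k where k: "real k * infdist z (- X) > 1" using reals_Archimedean3[OF p] by blast
      have "\<forall>\<^sub>F n in sequentially. f n z = indicator X z"
      proof (rule eventually_sequentiallyI)
        fix n assume "n \<ge> k"
        then have "real n * infdist z (- X) \<ge> real k * infdist z (- X)"
          using p by (intro mult_right_mono) auto
        then show "f n z = indicator X z" using k True by (simp add: f_def)
      qed
      then show ?thesis by (rule tendsto_eventually)
    qed (simp add: f_def)
    have "(\<lambda>n. \<integral>z. f n z \<partial>L) \<longlonglongrightarrow> measure L X" if L: "prob_space L" "sets L = sets borel" for L
    proof -
      interpret L: prob_space L by fact
      note [measurable_cong] = L(2)
      have [measurable]: "X \<in> sets L" "f n \<in> borel_measurable borel" for n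
        using \<open>X \<in> {S. open S}\<close> L cf by (auto intro: borel_measurable_continuous_onI)
      have "(\<lambda>n. \<integral>z. f n z \<partial>L) \<longlonglongrightarrow> (\<integral>z. indicator X z \<partial>L)"
        by (rule integral_dominated_convergence[where w="\<lambda>_. 1"]) (use lim bf in auto)
      then show ?thesis by simp
    qed
    from this[OF M] this[OF N] have "measure M X = measure N X"
      using eq[OF cf bf] by (simp add: LIMSEQ_unique)
    then show ?thesis by (simp add: M.emeasure_eq_measure N.emeasure_eq_measure)
  qed
  show "emeasure M UNIV \<noteq> \<infinity>" by simp
qed auto

lemma gauss_smoothing_eq_imp_eq:
  assumes M: "prob_space M" "sets M = sets borel" and N: "prob_space N" "sets N = sets borel"
    and \<sigma>: "\<And>n. \<sigma> n > 0" "\<sigma> \<longlonglongrightarrow> 0"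
    and eq: "\<And>n. AE w in lborel. gauss_smoothing (\<sigma> n) M w = gauss_smoothing (\<sigma> n) N w"
  shows "M = N"
proof (rule measure_eqI_continuous[OF M N])
  fix f :: "complex \<Rightarrow> real" and B assume f: "continuous_on UNIV f" and B: "\<And>z. \<bar>f z\<bar> \<le> B"
  have [measurable]: "f \<in> borel_measurable borel" using f by (rule borel_measurable_continuous_onI)
  have [measurable]: "(\<lambda>w. Complex (fst w) (snd w)) \<in> borel_measurable borel"
    by (intro borel_measurable_continuous_onI) (simp add: Complex_eq, intro continuous_intros)
  note [measurable] = gauss_smoothing_measurable[OF M] gauss_smoothing_measurable[OF N]
  have "(\<integral>w. f (Complex (fst w) (snd w)) * gauss_smoothing (\<sigma> n) M w \<partial>lborel) =
     (\<integral>w. f (Complex (fst w) (snd w)) * gauss_smoothing (\<sigma> n) N w \<partial>lborel)" for n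
  proof (rule integral_cong_AE)
    show "AE w in lborel. f (Complex (fst w) (snd w)) * gauss_smoothing (\<sigma> n) M w =
       f (Complex (fst w) (snd w)) * gauss_smoothing (\<sigma> n) N w"
      using eq[of n] by eventually_elim simp
  qed measurable
  then show "(\<integral>z. f z \<partial>M) = (\<integral>z. f z \<partial>N)"
    using gauss_smoothing_tendsto[OF M \<sigma> f B] gauss_smoothing_tendsto[OF N \<sigma> f B]
    by (simp add: LIMSEQ_unique)
qed

text \<open>
  The integrand of Frullani's integral for $-\ln x$ over the positive half line.
\<close>

definition frullani :: "real \<Rightarrow> real \<Rightarrow> real" where
  "frullani x t = indicator {0<..} t * ((exp (- t * x) - exp (- t)) / t)"

text \<open>
  The integrand is $\int_a^b e^{-tu}\,du$; exchanging the integrals leaves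
  $\int_a^b du/u$.
\<close>

lemma nn_integral_frullani:
  assumes "0 < a" "a \<le> b"
  shows "(\<integral>\<^sup>+t. ennreal (indicator {0<..} t * ((exp (- t * a) - exp (- t * b)) / t)) \<partial>lborel) = ennreal (ln b - ln a)"
proof -
  have 1: "(\<integral>\<^sup>+u. ennreal (exp (- t * u)) * indicator {a..b} u \<partial>lborel) = ennreal ((exp (- t * a) - exp (- t * b)) / t)" if "t > 0" for t
  proof -
    have "(\<integral>\<^sup>+u. ennreal (exp (- t * u)) * indicator {a..b} u \<partial>lborel) = ennreal (- exp (- t * b) / t - - exp (- t * a) / t)"
      by (rule nn_integral_FTC_Icc) (use assms that in \<open>auto intro!: derivative_eq_intros\<close>)
    then show ?thesis by (simp add: diff_divide_distrib)
  qed
  have 2: "(\<integral>\<^sup>+t. ennreal (exp (- t * u)) * indicator {0<..} t \<partial>lborel) = ennreal (1 / u)" if "u > 0" for u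
  proof -
    have "(\<integral>\<^sup>+t. ennreal (exp (- t * u)) * indicator {0<..} t \<partial>lborel) =
       (\<integral>\<^sup>+t. ennreal (exp (- t * u)) * indicator {0..} t \<partial>lborel)"
      by (rule nn_integral_cong_AE) (use AE_lborel_singleton[of 0] in \<open>eventually_elim, auto simp: indicator_def\<close>)
    also have "\<dots> = ennreal (0 - - exp (- 0 * u) / u)"
    proof (rule nn_integral_FTC_atLeast)
      show "((\<lambda>t. - exp (- t * u) / u) \<longlongrightarrow> 0) at_top" using that by real_asymp
    qed (use that in \<open>auto intro!: derivative_eq_intros\<close>)
    finally show ?thesis by simp
  qed
  have "(\<integral>\<^sup>+t. ennreal (indicator {0<..} t * ((exp (- t * a) - exp (- t * b)) / t)) \<partial>lborel) =
     (\<integral>\<^sup>+t. (\<integral>\<^sup>+u. ennreal (exp (- t * u)) * indicator {a..b} u * indicator {0<..} t \<partial>lborel) \<partial>lborel)"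
  proof (rule nn_integral_cong)
    fix t :: real
    show "ennreal (indicator {0<..} t * ((exp (- t * a) - exp (- t * b)) / t)) =
      (\<integral>\<^sup>+u. ennreal (exp (- t * u)) * indicator {a..b} u * indicator {0<..} t \<partial>lborel)"
      using 1[of t] by (cases "t > 0") simp_all
  qed
  also have "\<dots> = (\<integral>\<^sup>+u. (\<integral>\<^sup>+t. ennreal (exp (- t * u)) * indicator {a..b} u * indicator {0<..} t \<partial>lborel) \<partial>lborel)"
    by (rule lborel_pair.Fubini') measurable
  also have "\<dots> = (\<integral>\<^sup>+u. ennreal (1 / u) * indicator {a..b} u \<partial>lborel)"
  proof (rule nn_integral_cong)
    fix u :: real
    show "(\<integral>\<^sup>+t. ennreal (exp (- t * u)) * indicator {a..b} u * indicator {0<..} t \<partial>lborel) =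
       ennreal (1 / u) * indicator {a..b} u"
      using assms 2[of u] by (cases "u \<in> {a..b}") auto
  qed
  also have "\<dots> = ennreal (ln b - ln a)"
    by (rule nn_integral_FTC_Icc) (use assms in \<open>auto intro!: derivative_eq_intros simp: divide_inverse\<close>)
  finally show ?thesis .
qed

text \<open>
  The integrand has constant sign, so it is absolutely integrable with integral $|\ln x|$. Hence
  the integrability of the logarithmic kernel, with a null diagonal, is exactly what Fubini's theorem
  needs in the next lemma.
\<close>

lemma frullani_integral:
  assumes "x > 0"
  shows "has_bochner_integral lborel (frullani x) (- ln x)"
    and "has_bochner_integral lborel (\<lambda>t. \<bar>frullani x t\<bar>) \<bar>ln x\<bar>"
proof -
  have "has_bochner_integral lborel (frullani x) (- ln x) \<and> has_bochner_integral lborel (\<lambda>t. \<bar>frullani x t\<bar>) \<bar>ln x\<bar>"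
  proof (cases "x \<le> 1")
    case True
    have nn: "frullani x t \<ge> 0" for t
      using True by (auto simp: frullani_def indicator_def mult_left_le intro!: divide_nonneg_pos)
    have "has_bochner_integral lborel (frullani x) (- ln x)"
      by (rule has_bochner_integral_nn_integral)
         (use nn_integral_frullani[OF assms True] nn True assms in \<open>auto simp: frullani_def[abs_def]\<close>)
    then show ?thesis using nn True assms by simp
  next
    case False
    have np: "frullani x t \<le> 0" for t
      using False by (auto simp: frullani_def indicator_def intro!: divide_nonpos_pos)
    have "has_bochner_integral lborel (\<lambda>t. - frullani x t) (ln x)"
    proof (rule has_bochner_integral_nn_integral)
      have "- frullani x t = indicator {0<..} t * ((exp (- t * 1) - exp (- t * x)) / t)" for t
        by (auto simp: frullani_def indicator_def diff_divide_distrib)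
      then show "(\<integral>\<^sup>+t. ennreal (- frullani x t) \<partial>lborel) = ennreal (ln x)"
        using nn_integral_frullani[of 1 x] False by simp
    qed (use np False in \<open>auto simp: frullani_def[abs_def]\<close>)
    then have "has_bochner_integral lborel (\<lambda>t. - (- frullani x t)) (- ln x)"
      "has_bochner_integral lborel (\<lambda>t. \<bar>frullani x t\<bar>) (ln x)"
      using np has_bochner_integral_minus[of lborel "\<lambda>t. - frullani x t" "ln x"] by auto
    then show ?thesis using False by simp
  qed
  then show "has_bochner_integral lborel (frullani x) (- ln x)"
    "has_bochner_integral lborel (\<lambda>t. \<bar>frullani x t\<bar>) \<bar>ln x\<bar>" by auto
qed

text \<open>
  Frullani's integral at $x = |z-s|^2$; the square accounts for the factor 2.
\<close>

lemma log_energy_eq: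
  assumes M: "prob_space M" "sets M = sets borel" and N: "prob_space N" "sets N = sets borel"
    and int: "integrable (M \<Otimes>\<^sub>M N) (\<lambda>p. ln (cmod (fst p - snd p)))"
    and diag: "AE p in M \<Otimes>\<^sub>M N. fst p \<noteq> snd p"
  shows "has_bochner_integral lborel (\<lambda>t. indicator {0<..} t * ((gauss_energy t M N - exp (- t)) / t))
           (- 2 * (\<integral>p. ln (cmod (fst p - snd p)) \<partial>(M \<Otimes>\<^sub>M N)))"
proof -
  interpret M: prob_space M by fact
  interpret N: prob_space N by fact
  interpret MN: pair_prob_space M N ..
  interpret MNL: pair_sigma_finite "M \<Otimes>\<^sub>M N" "lborel :: real measure" ..
  note [measurable_cong] = M(2) N(2)
  let ?d = "\<lambda>p. (cmod (fst p - snd p))\<^sup>2"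
  have ln: "ln (?d p) = 2 * ln (cmod (fst p - snd p))" for p
    by (cases "fst p = snd p") (auto simp: ln_realpow)
  have [measurable]: "(\<lambda>p. frullani (?d (fst p)) (snd p)) \<in> borel_measurable ((M \<Otimes>\<^sub>M N) \<Otimes>\<^sub>M lborel)"
    unfolding frullani_def by measurable
  have I: "integrable ((M \<Otimes>\<^sub>M N) \<Otimes>\<^sub>M lborel) (\<lambda>p. frullani (?d (fst p)) (snd p))"
  proof (rule MNL.Fubini_integrable)
    have "integrable (M \<Otimes>\<^sub>M N) (\<lambda>p. \<bar>ln (?d p)\<bar>)"
      unfolding ln using int by (intro integrable_abs) simp
    then show "integrable (M \<Otimes>\<^sub>M N) (\<lambda>p. LBINT t. norm (frullani (?d (fst (p, t))) (snd (p, t))))"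
    proof (rule integrable_cong_AE_imp)
      show "AE p in M \<Otimes>\<^sub>M N. \<bar>ln (?d p)\<bar> = (LBINT t. norm (frullani (?d (fst (p, t))) (snd (p, t))))"
        using diag
      proof eventually_elim
        case (elim p)
        then have "?d p > 0" by simp
        from has_bochner_integral_integral_eq[OF frullani_integral(2)[OF this]] show ?case by simp
      qed
    qed measurable
    show "AE p in M \<Otimes>\<^sub>M N. integrable lborel (\<lambda>t. frullani (?d (fst (p, t))) (snd (p, t)))"
      using diag
    proof eventually_elim
      case (elim p)
      then have "?d p > 0" by simp
      from frullani_integral(1)[OF this] show ?case by (simp add: has_bochner_integral_iff)
    qed
  qed measurable
  have g: "(\<integral>p. frullani (?d p) t \<partial>(M \<Otimes>\<^sub>M N)) = indicator {0<..} t * ((gauss_energy t M N - exp (- t)) / t)" for t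
  proof (cases "t > 0")
    case True
    have "integrable (M \<Otimes>\<^sub>M N) (\<lambda>p. exp (- t * ?d p))"
      by (rule MN.integrable_const_bound[where B=1]) (use True in auto)
    then show ?thesis using True MN.prob_space
      by (simp add: frullani_def gauss_energy_def)
  qed (simp add: frullani_def)
  have "(\<integral>t. (\<integral>p. frullani (?d p) t \<partial>(M \<Otimes>\<^sub>M N)) \<partial>lborel) = (\<integral>p. (\<integral>t. frullani (?d p) t \<partial>lborel) \<partial>(M \<Otimes>\<^sub>M N))"
    using MNL.Fubini_integral[of "\<lambda>p t. frullani (?d p) t"] I by (simp add: split_beta')
  also have "\<dots> = (\<integral>p. - 2 * ln (cmod (fst p - snd p)) \<partial>(M \<Otimes>\<^sub>M N))"
  proof (rule integral_cong_AE)
    show "AE p in M \<Otimes>\<^sub>M N. (\<integral>t. frullani (?d p) t \<partial>lborel) = - 2 * ln (cmod (fst p - snd p))"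
      using diag
    proof eventually_elim
      case (elim p)
      then have "?d p > 0" by simp
      from has_bochner_integral_integral_eq[OF frullani_integral(1)[OF this]] show ?case by (simp add: ln)
    qed
    have "(\<lambda>p. \<integral>t. (\<lambda>x. frullani (?d (fst x)) (snd x)) (p, t) \<partial>lborel) \<in> borel_measurable (M \<Otimes>\<^sub>M N)"
      by measurable
    then show "(\<lambda>p. \<integral>t. frullani (?d p) t \<partial>lborel) \<in> borel_measurable (M \<Otimes>\<^sub>M N)" by simp
  qed measurable
  finally show ?thesis
    using MNL.integrable_snd[of "\<lambda>p t. frullani (?d p) t"] I
    unfolding g by (simp add: has_bochner_integral_iff split_beta' g)
qed

text \<open>
  In the combination belonging to \<open>M - N\<close> the terms \<open>exp (- t)\<close> of Frullani's integral cancel, as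
  both measures have mass 1. What remains is an integral of the nonnegative Gaussian forms. If it
  vanished, so would the forms for arbitrarily large \<open>t\<close>, and \<open>M\<close> and \<open>N\<close> would have the same
  smoothings at arbitrarily small scales.
\<close>

theorem log_energy_strictly_positive:
  assumes M: "prob_space M" "sets M = sets borel" and N: "prob_space N" "sets N = sets borel"
    and int: "integrable (M \<Otimes>\<^sub>M M) (\<lambda>p. ln (cmod (fst p - snd p)))"
       "integrable (M \<Otimes>\<^sub>M N) (\<lambda>p. ln (cmod (fst p - snd p)))"
       "integrable (N \<Otimes>\<^sub>M N) (\<lambda>p. ln (cmod (fst p - snd p)))"
    and diag: "AE p in M \<Otimes>\<^sub>M M. fst p \<noteq> snd p" "AE p in M \<Otimes>\<^sub>M N. fst p \<noteq> snd p" "AE p in N \<Otimes>\<^sub>M N. fst p \<noteq> snd p"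
    and "M \<noteq> N"
  shows "(\<integral>p. ln (cmod (fst p - snd p)) \<partial>(M \<Otimes>\<^sub>M M)) + (\<integral>p. ln (cmod (fst p - snd p)) \<partial>(N \<Otimes>\<^sub>M N))
      < 2 * (\<integral>p. ln (cmod (fst p - snd p)) \<partial>(M \<Otimes>\<^sub>M N))"
proof (rule ccontr)
  let ?L = "\<lambda>A B. \<integral>p. ln (cmod (fst p - snd p)) \<partial>(A \<Otimes>\<^sub>M B)"
  let ?h = "\<lambda>A B t. indicator {0<..} t * ((gauss_energy t A B - exp (- t)) / t)"
  let ?D = "\<lambda>t. gauss_energy t M M - 2 * gauss_energy t M N + gauss_energy t N N"
  assume contra: "\<not> ?thesis"
  note e = log_energy_eq[OF M M int(1) diag(1)] log_energy_eq[OF M N int(2) diag(2)] log_energy_eq[OF N N int(3) diag(3)]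
  have hb: "has_bochner_integral lborel (\<lambda>t. ?h M M t - 2 * ?h M N t + ?h N N t)
     (- 2 * ?L M M - 2 * (- 2 * ?L M N) + - 2 * ?L N N)"
    by (intro has_bochner_integral_add has_bochner_integral_diff has_bochner_integral_mult_right e)
  have eq: "?h M M t - 2 * ?h M N t + ?h N N t = indicator {0<..} t * (?D t / t)" for t
    by (auto simp: indicator_def field_simps)
  have nn: "indicator {0<..} t * (?D t / t) \<ge> 0" for t :: real
    using gauss_energy_diff(1)[OF M N, of t] by (auto simp: indicator_def)
  note hb = hb[unfolded eq]
  have "integral\<^sup>L lborel (\<lambda>t. indicator {0<..} t * (?D t / t)) \<ge> 0"
    by (rule Bochner_Integration.integral_nonneg) (rule nn)
  with contra has_bochner_integral_integral_eq[OF hb]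
  have "integral\<^sup>L lborel (\<lambda>t. indicator {0<..} t * (?D t / t)) = 0" by simp
  then have "AE t in lborel. indicator {0<..} t * (?D t / t) = 0"
    using integral_nonneg_eq_0_iff_AE[of lborel "\<lambda>t. indicator {0<..} t * (?D t / t)"] nn hb
    by (auto simp: has_bochner_integral_iff)
  then have ae: "AE t in lborel. t > 0 \<longrightarrow> ?D t = 0"
    by eventually_elim (auto simp: indicator_def split: if_splits)
  have "\<exists>t. t > real n + 1 \<and> ?D t = 0" for n
  proof (rule ccontr)
    assume "\<not> ?thesis"
    with ae have "AE t in lborel. t \<notin> {real n + 1<..<real n + 2}"
      by (auto elim!: eventually_mono)
    then have "{real n + 1<..<real n + 2} \<in> null_sets lborel"
      by (subst AE_iff_null_sets) auto
    then have "emeasure lborel {real n + 1<..<real n + 2} = 0" by blast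
    then show False by simp
  qed
  then obtain t where t: "\<And>n. t n > real n + 1" "\<And>n. ?D (t n) = 0" by metis
  have tpos: "t n > 0" for n using t(1)[of n] by linarith
  have "filterlim t at_top sequentially"
    by (rule filterlim_at_top_mono[OF filterlim_real_sequentially])
       (use t(1) in \<open>auto intro!: eventuallyI less_imp_le order.strict_trans[OF _ t(1)]\<close>)
  then have lim: "(\<lambda>n. 1 / (2 * sqrt (t n))) \<longlonglongrightarrow> 0"
    by (intro real_tendsto_divide_at_top[OF tendsto_const] filterlim_tendsto_pos_mult_at_top[OF tendsto_const]
          filterlim_compose[OF sqrt_at_top]) auto
  have "M = N"
    by (rule gauss_smoothing_eq_imp_eq[OF M N _ lim gauss_energy_diff(2)[OF M N]]) (use tpos t(2) in auto)
  with \<open>M \<noteq> N\<close> show False ..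
qed

section \<open>Frostman conditions imply minimality\<close>

lemma ext_integral_eq:
  assumes int: "integrable M g" and eq: "AE x in M. f x = ereal (g x)"
  shows "ext_integral M f = ereal (\<integral>x. g x \<partial>M)"
proof -
  have 1: "(\<integral>\<^sup>+ x. e2ennreal (f x) \<partial>M) = (\<integral>\<^sup>+ x. ennreal (g x) \<partial>M)"
    "(\<integral>\<^sup>+ x. e2ennreal (- f x) \<partial>M) = (\<integral>\<^sup>+ x. ennreal (- g x) \<partial>M)"
    by (rule nn_integral_cong_AE, use eq in eventually_elim, simp add: ennreal.abs_eq e2ennreal_ereal)+
  have fin: "(\<integral>\<^sup>+ x. ennreal (g x) \<partial>M) < \<top>" "(\<integral>\<^sup>+ x. ennreal (- g x) \<partial>M) < \<top>"
    using int by (auto simp: real_integrable_def top.not_eq_extremum)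
  then obtain a b where ab: "(\<integral>\<^sup>+ x. ennreal (g x) \<partial>M) = ennreal a" "a \<ge> 0"
    "(\<integral>\<^sup>+ x. ennreal (- g x) \<partial>M) = ennreal b" "b \<ge> 0"
    by (metis ennreal_cases less_irrefl)
  have "(\<integral>x. g x \<partial>M) = a - b"
    using real_lebesgue_integral_def[OF int] ab by simp
  then show ?thesis unfolding ext_integral_def 1 ab(1,3) using ab by (simp add: enn2ereal_ennreal)
qed

lemma log_kernel_measurable: "(\<lambda>p. log_kernel (fst p) (snd p)) \<in> borel_measurable (borel \<Otimes>\<^sub>M borel)"
  unfolding log_kernel_def by measurable

lemma ln_max:
  fixes e x :: real
  assumes "e > 0" "x > 0"
  shows "ln (max e x) = ln x + max 0 (ln (e / x))"
proof (cases "x \<le> e")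
  case True
  then have "ln x \<le> ln e" using assms by (subst ln_le_cancel_iff) auto
  then show ?thesis using True assms by (simp add: ln_div max_def)
next
  case False
  then have "ln e \<le> ln x" using assms by (subst ln_le_cancel_iff) auto
  then show ?thesis using False assms by (simp add: ln_div max_def)
qed

definition potential :: "complex measure \<Rightarrow> complex \<Rightarrow> real" where
  "potential \<mu> z = - (\<integral>s. ln (norm (z - s)) \<partial>\<mu>)"

text \<open>
  The part of the kernel at distance less than \<open>\<epsilon>\<close> contributes at most a multiple of \<open>\<epsilon>\<close> to the
  potential, uniformly in the plane. Atoms have to be excluded separately: they are invisible to
  this bound, as \<^term>\<open>ln (\<epsilon> / 0 :: real)\<close> is \<^term>\<open>0 :: real\<close>.
\<close>

locale log_regular = prob_space \<mu> for \<mu> :: "complex measure" +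
  fixes C R :: real
  assumes sets_eq: "sets \<mu> = sets borel"
    and C_nonneg: "C \<ge> 0"
    and bounded: "AE s in \<mu>. norm s \<le> R"
    and no_atoms: "\<And>z. AE s in \<mu>. s \<noteq> z"
    and small_singularity: "\<And>z \<epsilon>. \<epsilon> > 0 \<Longrightarrow> (\<integral>\<^sup>+s. ennreal (max 0 (ln (\<epsilon> / norm (z - s)))) \<partial>\<mu>) \<le> ennreal (C * \<epsilon>)"
begin

declare sets_eq [measurable_cong]

abbreviation U :: "complex \<Rightarrow> real" where "U \<equiv> potential \<mu>"

lemma pos_part_integral:
  assumes "\<epsilon> > 0"
  shows "integrable \<mu> (\<lambda>s. max 0 (ln (\<epsilon> / norm (z - s))))"
    and "(\<integral>s. max 0 (ln (\<epsilon> / norm (z - s))) \<partial>\<mu>) \<le> C * \<epsilon>"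
proof -
  let ?f = "\<lambda>s. max 0 (ln (\<epsilon> / norm (z - s)))"
  show int: "integrable \<mu> ?f"
    using small_singularity[OF assms, of z]
    by (intro integrableI_nonneg) (auto intro: order.strict_trans1)
  have "ennreal (\<integral>s. ?f s \<partial>\<mu>) \<le> ennreal (C * \<epsilon>)"
    using small_singularity[OF assms, of z] by (subst nn_integral_eq_integral[OF int, symmetric]) auto
  then show "(\<integral>s. ?f s \<partial>\<mu>) \<le> C * \<epsilon>"
    using mult_nonneg_nonneg[OF C_nonneg less_imp_le[OF assms]] by (simp only: ennreal_le_iff)
qed

lemma abs_ln_le: "x \<ge> 0 \<Longrightarrow> \<bar>ln x\<bar> \<le> max 0 (ln (1 / x)) + (x::real)"
proof (cases "x = 0")
  case False
  assume "x \<ge> 0"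
  with False have x: "x > 0" by simp
  have "ln x \<le> x" using ln_less_self[OF x] by simp
  then show ?thesis using x by (auto simp: ln_div max_def abs_if)
qed simp

lemma ln_integrable: "integrable \<mu> (\<lambda>s. ln (norm (z - s)))"
  and abs_ln_integral: "(\<integral>s. \<bar>ln (norm (z - s))\<bar> \<partial>\<mu>) \<le> C + (norm z + R)"
proof -
  let ?b = "\<lambda>s. max 0 (ln (1 / norm (z - s))) + (norm z + R)"
  have b: "integrable \<mu> ?b" using pos_part_integral(1)[of 1 z] by simp
  have le: "AE s in \<mu>. \<bar>ln (norm (z - s))\<bar> \<le> ?b s"
    using bounded
  proof eventually_elim
    case (elim s)
    have "norm (z - s) \<le> norm z + R" using norm_triangle_ineq4[of z s] elim by simp
    then show ?case using abs_ln_le[of "norm (z - s)"] by simp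
  qed
  show int: "integrable \<mu> (\<lambda>s. ln (norm (z - s)))"
    by (rule Bochner_Integration.integrable_bound[OF b]) (use le in \<open>auto elim!: eventually_mono\<close>)
  have "(\<integral>s. \<bar>ln (norm (z - s))\<bar> \<partial>\<mu>) \<le> (\<integral>s. ?b s \<partial>\<mu>)"
    by (rule integral_mono_AE[OF _ b le]) (use int in simp)
  also have "\<dots> \<le> C + (norm z + R)"
    using pos_part_integral[of 1 z] by (simp add: prob_space)
  finally show "(\<integral>s. \<bar>ln (norm (z - s))\<bar> \<partial>\<mu>) \<le> C + (norm z + R)" .
qed

lemma log_potential_eq: "log_potential \<mu> z = ereal (U z)"
proof -
  have "log_potential \<mu> z = ereal (\<integral>s. - ln (norm (z - s)) \<partial>\<mu>)"
    unfolding log_potential_def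
  proof (rule ext_integral_eq)
    show "integrable \<mu> (\<lambda>s. - ln (norm (z - s)))" using ln_integrable by simp
    show "AE s in \<mu>. log_kernel z s = ereal (- ln (norm (z - s)))"
      using no_atoms[of z] by eventually_elim (auto simp: log_kernel_def ln_div)
  qed
  then show ?thesis by (simp add: potential_def)
qed

text \<open>
  Truncating the kernel at distance \<open>\<epsilon>\<close> gives a continuous function that differs from the potential
  by at most \<open>C * \<epsilon>\<close>, so the potential is a uniform limit of continuous functions.
\<close>

lemma U_continuous: "continuous_on UNIV U"
proof -
  define T where "T n z = - (\<integral>s. ln (max (1 / real (Suc n)) (norm (z - s))) \<partial>\<mu>)" for n z
  have Tcont: "continuous_on UNIV (T n)" for n
  proof (rule continuous_at_imp_continuous_on, rule ballI)
    fix z0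
    let ?e = "1 / real (Suc n)"
    have e: "?e > 0" by simp
    have "isCont (\<lambda>z. \<integral>s. ln (max ?e (norm (z - s))) \<partial>\<mu>) z0"
      unfolding continuous_at_sequentially o_def
    proof (intro allI impI)
      fix x assume x: "x \<longlonglongrightarrow> z0"
      then have "Bseq x" by (intro convergent_imp_Bseq convergentI)
      then obtain B where B: "\<And>k. norm (x k) \<le> B" by (rule BseqE) (rule that, blast)
      let ?w = "\<bar>ln ?e\<bar> + (?e + (B + R))"
      show "(\<lambda>k. \<integral>s. ln (max ?e (norm (x k - s))) \<partial>\<mu>) \<longlonglongrightarrow> (\<integral>s. ln (max ?e (norm (z0 - s))) \<partial>\<mu>)"
      proof (rule integral_dominated_convergence[where w="\<lambda>_. ?w"])
        have "(\<lambda>k. ln (max ?e (norm (x k - s)))) \<longlonglongrightarrow> ln (max ?e (norm (z0 - s)))" for s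
        proof (rule tendsto_ln)
          show "max ?e (norm (z0 - s)) \<noteq> 0" using e by (metis less_max_iff_disj less_irrefl)
        qed (intro tendsto_intros x)
        then show "AE s in \<mu>. (\<lambda>k. ln (max ?e (norm (x k - s)))) \<longlonglongrightarrow> ln (max ?e (norm (z0 - s)))" by simp
        show "AE s in \<mu>. norm (ln (max ?e (norm (x k - s)))) \<le> ?w" for k
          using bounded
        proof eventually_elim
          case (elim s)
          let ?m = "max ?e (norm (x k - s))"
          have m: "?m > 0" "?m \<ge> ?e" using e by (auto simp: less_max_iff_disj)
          have xs: "norm (x k - s) \<le> B + R" using norm_triangle_ineq4[of "x k" s] elim B[of k] by simp
          then have BR: "0 \<le> B + R" by (rule order_trans[OF norm_ge_zero])
          with xs have "?m \<le> ?e + (B + R)" using e by (intro max.boundedI) linarith+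
          with ln_less_self[OF m(1)] have "ln ?m \<le> ?e + (B + R)" by (rule order_trans[OF less_imp_le])
          moreover have "ln ?e \<le> ln ?m" using m e by (subst ln_le_cancel_iff) auto
          ultimately show ?case using BR e unfolding real_norm_def by (intro abs_leI) linarith+
        qed
      qed measurable
    qed
    then show "isCont (T n) z0" unfolding T_def by (rule continuous_minus)
  qed
  have close: "\<bar>T n z - U z\<bar> \<le> C * (1 / real (Suc n))" for n z
  proof -
    let ?e = "1 / real (Suc n)"
    have e: "?e > 0" by simp
    have eq: "AE s in \<mu>. ln (max ?e (norm (z - s))) = ln (norm (z - s)) + max 0 (ln (?e / norm (z - s)))"
      using no_atoms[of z]
    proof eventually_elim
      case (elim s)
      then have p: "norm (z - s) > 0" by simp
      show ?case by (rule ln_max[OF e p])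
    qed
    have "(\<integral>s. ln (max ?e (norm (z - s))) \<partial>\<mu>) = (\<integral>s. ln (norm (z - s)) + max 0 (ln (?e / norm (z - s))) \<partial>\<mu>)"
      by (rule integral_cong_AE[OF _ _ eq]) measurable
    also have "\<dots> = (\<integral>s. ln (norm (z - s)) \<partial>\<mu>) + (\<integral>s. max 0 (ln (?e / norm (z - s))) \<partial>\<mu>)"
      by (rule Bochner_Integration.integral_add[OF ln_integrable pos_part_integral(1)[OF e]])
    finally have "T n z - U z = - (\<integral>s. max 0 (ln (?e / norm (z - s))) \<partial>\<mu>)"
      by (simp add: T_def potential_def)
    moreover have "(\<integral>s. max 0 (ln (?e / norm (z - s))) \<partial>\<mu>) \<ge> 0" by (rule Bochner_Integration.integral_nonneg) simp
    ultimately show ?thesis using pos_part_integral(2)[OF e, of z] by simp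
  qed
  have "uniform_limit UNIV T U sequentially"
  proof (rule uniform_limitI)
    fix e :: real assume "e > 0"
    have "(\<lambda>n. C * (1 / real (Suc n))) \<longlonglongrightarrow> 0" by real_asymp
    then have "\<forall>\<^sub>F n in sequentially. C * (1 / real (Suc n)) < e"
      using \<open>e > 0\<close> by (rule order_tendstoD)
    then show "\<forall>\<^sub>F n in sequentially. \<forall>z\<in>UNIV. dist (T n z) (U z) < e"
      by eventually_elim (use close in \<open>auto simp: dist_real_def intro: le_less_trans\<close>)
  qed
  then show ?thesis by (rule uniform_limit_theorem[rotated]) (use Tcont in auto)
qed

lemma U_measurable [measurable]: "U \<in> borel_measurable borel"
  using U_continuous by (rule borel_measurable_continuous_onI)

text \<open>
  The integral of the absolute kernel with respect to \<open>\<mu>\<close> grows at most linearly in the other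
  variable, so Fubini's theorem applies as soon as \<open>N\<close> has a finite first moment.
\<close>

lemma cross_energy:
  assumes N: "prob_space N" "sets N = sets borel" and int: "integrable N norm"
  shows "integrable (N \<Otimes>\<^sub>M \<mu>) (\<lambda>p. ln (norm (fst p - snd p)))"
    and "(\<integral>p. ln (norm (fst p - snd p)) \<partial>(N \<Otimes>\<^sub>M \<mu>)) = - (\<integral>z. U z \<partial>N)"
    and "integrable N U"
    and "AE p in N \<Otimes>\<^sub>M \<mu>. fst p \<noteq> snd p"
proof -
  interpret N: prob_space N by fact
  interpret NM: pair_sigma_finite N \<mu> ..
  note [measurable_cong] = N(2)
  show I: "integrable (N \<Otimes>\<^sub>M \<mu>) (\<lambda>p. ln (norm (fst p - snd p)))"
  proof (rule NM.Fubini_integrable)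
    show "integrable N (\<lambda>x. LINT y|\<mu>. norm (ln (norm (fst (x, y) - snd (x, y)))))"
    proof (rule Bochner_Integration.integrable_bound)
      show "integrable N (\<lambda>z. C + (norm z + R))" using int by simp
      show "AE z in N. norm (LINT y|\<mu>. norm (ln (norm (fst (z, y) - snd (z, y))))) \<le> norm (C + (norm z + R))"
      proof (rule AE_I2)
        fix z
        have "(LINT y|\<mu>. \<bar>ln (norm (z - y))\<bar>) \<ge> 0" by (rule Bochner_Integration.integral_nonneg) simp
        with abs_ln_integral[of z]
        show "norm (LINT y|\<mu>. norm (ln (norm (fst (z, y) - snd (z, y))))) \<le> norm (C + (norm z + R))" by simp
      qed
    qed measurable
    show "AE x in N. integrable \<mu> (\<lambda>y. ln (norm (fst (x, y) - snd (x, y))))" using ln_integrable by simp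
  qed measurable
  show "(\<integral>p. ln (norm (fst p - snd p)) \<partial>(N \<Otimes>\<^sub>M \<mu>)) = - (\<integral>z. U z \<partial>N)"
    using NM.integral_fst'[OF I] by (simp add: potential_def)
  show "integrable N U" using NM.integrable_fst'[OF I] by (simp add: potential_def[abs_def])
  have "AE z in N. AE s in \<mu>. z \<noteq> s"   proof (rule AE_I2)
    fix z show "AE s in \<mu>. z \<noteq> s" using no_atoms[of z] by eventually_elim simp
  qed
  then show "AE p in N \<Otimes>\<^sub>M \<mu>. fst p \<noteq> snd p"
    by (intro NM.AE_pair_measure) simp_all
qed

lemma norm_integrable: "integrable \<mu> norm"
  by (rule integrable_const_bound[where B=R]) (use bounded in auto)

text \<open>
  With $L(\alpha,\beta) = \iint \ln|z-s|\,d\alpha\,d\beta$, positivity of the energy of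
  $\nu - \mu$ gives $-L(\nu,\nu) > L(\mu,\mu) - 2L(\nu,\mu)$, and therefore
  $I_V(\nu) > L(\mu,\mu) + \int (2U^\mu + \mathrm{Re}\,V)\,d\nu \ge L(\mu,\mu) + c = I_V(\mu)$.
  This presupposes a finite energy of \<open>\<nu>\<close>. The growth condition rules out the value $-\infty$: if
  $\int \mathrm{Re}\,V\,d\nu$ is finite then \<open>\<nu>\<close> has a first moment, which bounds the negative part of
  the kernel.
\<close>

theorem Frostman_imp_equilibrium:
  fixes V :: "complex \<Rightarrow> complex" and S :: "complex set" and \<alpha> \<beta> c :: real
  assumes S: "AE z in \<mu>. z \<in> S"
    and V: "(\<lambda>z. Re (V z)) \<in> borel_measurable borel" "integrable \<mu> (\<lambda>z. Re (V z))"
    and growth: "\<alpha> > 0" "\<And>z. z \<in> S \<Longrightarrow> Re (V z) \<ge> \<alpha> * norm z - \<beta>"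
    and eq: "AE z in \<mu>. 2 * U z + Re (V z) = c"
    and ge: "\<And>z. z \<in> S \<Longrightarrow> 2 * U z + Re (V z) \<ge> c"
  shows "is_equilibrium_measure V S \<mu>"
  unfolding is_equilibrium_measure_def
proof (intro conjI ballI impI)
  note [measurable] = V(1)
  show "\<mu> \<in> prob_measures_on S" using S sets_eq prob_space_axioms by (simp add: prob_measures_on_def)
  let ?L = "\<lambda>A B. \<integral>p. ln (norm (fst p - snd p)) \<partial>(A \<Otimes>\<^sub>M B)"
  have energy: "weighted_energy V N = ereal (- ?L N N + (\<integral>z. Re (V z) \<partial>N))"
    if "integrable (N \<Otimes>\<^sub>M N) (\<lambda>p. ln (norm (fst p - snd p)))" "AE p in N \<Otimes>\<^sub>M N. fst p \<noteq> snd p" "integrable N (\<lambda>z. Re (V z))" for N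
  proof -
    have "ext_integral (N \<Otimes>\<^sub>M N) (\<lambda>(z, s). log_kernel z s) = ereal (\<integral>p. - ln (norm (fst p - snd p)) \<partial>(N \<Otimes>\<^sub>M N))"
      by (rule ext_integral_eq) (use that in \<open>auto simp: log_kernel_def ln_div elim!: eventually_mono\<close>)
    moreover have "ext_integral N (\<lambda>s. ereal (Re (V s))) = ereal (\<integral>z. Re (V z) \<partial>N)"
      by (rule ext_integral_eq) (use that in auto)
    ultimately show ?thesis by (simp add: weighted_energy_def)
  qed
  note cmm = cross_energy[OF prob_space_axioms sets_eq norm_integrable]
  have Emu: "weighted_energy V \<mu> = ereal (?L \<mu> \<mu> + c)"
  proof -
    have "(\<integral>z. 2 * U z + Re (V z) \<partial>\<mu>) = (\<integral>z. c \<partial>\<mu>)"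
      by (rule integral_cong_AE[OF _ _ eq]) measurable
    then have "2 * (\<integral>z. U z \<partial>\<mu>) + (\<integral>z. Re (V z) \<partial>\<mu>) = c"
      using cmm(3) V(2) by (simp add: prob_space)
    then show ?thesis using energy[OF cmm(1,4) V(2)] cmm(2) by simp
  qed
  fix \<nu> assume \<nu>: "\<nu> \<in> prob_measures_on S" "\<nu> \<noteq> \<mu>"
  then have N: "prob_space \<nu>" "sets \<nu> = sets borel" and NS: "AE z in \<nu>. z \<in> S" by (auto simp: prob_measures_on_def)
  interpret \<nu>: prob_space \<nu> by fact
  interpret NN: pair_prob_space \<nu> \<nu> ..
  note [measurable_cong] = N(2)
  show "weighted_energy V \<mu> < weighted_energy V \<nu>"
  proof (cases "(\<integral>\<^sup>+ z. ennreal (Re (V z)) \<partial>\<nu>) = \<top>")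
    case True
    then have "ext_integral \<nu> (\<lambda>s. ereal (Re (V s))) = \<infinity>"
      by (simp add: ext_integral_def e2ennreal_ereal)
    then show ?thesis unfolding Emu unfolding weighted_energy_def by simp
  next
    case Afin: False
    have "(\<integral>\<^sup>+ z. ennreal (- Re (V z)) \<partial>\<nu>) \<le> (\<integral>\<^sup>+ z. ennreal \<bar>\<beta>\<bar> \<partial>\<nu>)"
    proof (rule nn_integral_mono_AE)
      show "AE z in \<nu>. ennreal (- Re (V z)) \<le> ennreal \<bar>\<beta>\<bar>"
        using NS
      proof eventually_elim
        case (elim z)
        have "\<alpha> * norm z \<ge> 0" using growth(1) by simp
        then show ?case using growth(2)[OF elim] by (intro ennreal_leI) linarith
      qed
    qed
    also have "\<dots> < \<top>" by (simp add: \<nu>.emeasure_space_1)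
    finally have Bfin: "(\<integral>\<^sup>+ z. ennreal (- Re (V z)) \<partial>\<nu>) \<noteq> \<top>" by simp
    have intV: "integrable \<nu> (\<lambda>z. Re (V z))"
      using Afin Bfin by (simp add: real_integrable_def)
    have intn: "integrable \<nu> norm"
    proof (rule Bochner_Integration.integrable_bound)
      show "integrable \<nu> (\<lambda>z. (Re (V z) + \<beta>) / \<alpha>)" using intV by simp
      show "AE z in \<nu>. norm (norm z) \<le> norm ((Re (V z) + \<beta>) / \<alpha>)"
        using NS
      proof eventually_elim
        case (elim z)
        have "norm z \<le> (Re (V z) + \<beta>) / \<alpha>" using growth(2)[OF elim] growth(1) by (simp add: field_simps)
        then show ?case by (simp only: real_norm_def abs_norm_cancel)
      qed
    qed measurable
    have intnn: "integrable (\<nu> \<Otimes>\<^sub>M \<nu>) (\<lambda>p. norm (fst p) + norm (snd p))"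
    proof (rule Bochner_Integration.integrable_add)
      show "integrable (\<nu> \<Otimes>\<^sub>M \<nu>) (\<lambda>p. norm (fst p))"
        by (rule NN.Fubini_integrable) (use intn \<nu>.prob_space in auto)
      show "integrable (\<nu> \<Otimes>\<^sub>M \<nu>) (\<lambda>p. norm (snd p))"
        by (rule NN.Fubini_integrable) (use intn \<nu>.prob_space in auto)
    qed
    have lk: "(\<lambda>p. log_kernel (fst p) (snd p)) \<in> borel_measurable (\<nu> \<Otimes>\<^sub>M \<nu>)"
      using log_kernel_measurable by measurable
    let ?Pk = "\<integral>\<^sup>+ p. e2ennreal (log_kernel (fst p) (snd p)) \<partial>(\<nu> \<Otimes>\<^sub>M \<nu>)"
    let ?Nk = "\<integral>\<^sup>+ p. e2ennreal (- log_kernel (fst p) (snd p)) \<partial>(\<nu> \<Otimes>\<^sub>M \<nu>)"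
    have Vreal: "ext_integral \<nu> (\<lambda>s. ereal (Re (V s))) = ereal (\<integral>z. Re (V z) \<partial>\<nu>)"
      by (rule ext_integral_eq) (use intV in auto)
    have lnle: "ln (norm (z - s)) \<le> norm z + norm s" for z s :: complex
    proof (cases "z = s")
      case False
      then have "norm (z - s) > 0" by simp
      then have "ln (norm (z - s)) \<le> norm (z - s)" by (rule less_imp_le[OF ln_less_self])
      then show ?thesis using norm_triangle_ineq4[of z s] by linarith
    qed simp
    show ?thesis
    proof (cases "?Pk = \<top>")
      case True
      then have "ext_integral (\<nu> \<Otimes>\<^sub>M \<nu>) (\<lambda>(z, s). log_kernel z s) = \<infinity>"
        by (simp add: ext_integral_def split_beta')
      then show ?thesis unfolding Emu unfolding weighted_energy_def Vreal by simp
    next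
      case False
      have "AE p in \<nu> \<Otimes>\<^sub>M \<nu>. e2ennreal (log_kernel (fst p) (snd p)) \<noteq> \<top>"
        by (rule nn_integral_PInf_AE[OF _ False[folded infinity_ennreal_def], unfolded infinity_ennreal_def]) (use lk in measurable)
      then have diag: "AE p in \<nu> \<Otimes>\<^sub>M \<nu>. fst p \<noteq> snd p"
        by eventually_elim (auto simp: log_kernel_def e2ennreal_infty)
      have intl: "integrable (\<nu> \<Otimes>\<^sub>M \<nu>) (\<lambda>p. ln (norm (fst p - snd p)))"
        unfolding real_integrable_def
      proof (intro conjI)
        show "(\<lambda>p. ln (norm (fst p - snd p))) \<in> borel_measurable (\<nu> \<Otimes>\<^sub>M \<nu>)" by measurable
        have "(\<integral>\<^sup>+ p. ennreal (ln (norm (fst p - snd p))) \<partial>(\<nu> \<Otimes>\<^sub>M \<nu>)) \<le> (\<integral>\<^sup>+ p. ennreal (norm (fst p) + norm (snd p)) \<partial>(\<nu> \<Otimes>\<^sub>M \<nu>))"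
          by (intro nn_integral_mono ennreal_leI lnle)
        also have "\<dots> < \<top>" using intnn by (subst nn_integral_eq_integral) auto
        finally show "(\<integral>\<^sup>+ p. ennreal (ln (norm (fst p - snd p))) \<partial>(\<nu> \<Otimes>\<^sub>M \<nu>)) \<noteq> \<infinity>" by simp
        have "(\<integral>\<^sup>+ p. ennreal (- ln (norm (fst p - snd p))) \<partial>(\<nu> \<Otimes>\<^sub>M \<nu>)) = ?Pk"
          by (rule nn_integral_cong_AE, use diag in eventually_elim) (auto simp: log_kernel_def ln_div e2ennreal_ereal)
        then show "(\<integral>\<^sup>+ p. ennreal (- ln (norm (fst p - snd p))) \<partial>(\<nu> \<Otimes>\<^sub>M \<nu>)) \<noteq> \<infinity>" using False by simp
      qed
      note cnm = cross_energy[OF N intn]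
      have pos: "?L \<nu> \<nu> + ?L \<mu> \<mu> < 2 * ?L \<nu> \<mu>"
        by (rule log_energy_strictly_positive[OF N prob_space_axioms sets_eq intl cnm(1) cmm(1) diag cnm(4) cmm(4) \<nu>(2)])
      have "c = (\<integral>z. c \<partial>\<nu>)" by (simp add: \<nu>.prob_space)
      also have "\<dots> \<le> (\<integral>z. 2 * U z + Re (V z) \<partial>\<nu>)"
        by (rule integral_mono_AE) (use cnm(3) intV NS ge in \<open>auto elim!: eventually_mono\<close>)
      also have "\<dots> = 2 * (\<integral>z. U z \<partial>\<nu>) + (\<integral>z. Re (V z) \<partial>\<nu>)" using cnm(3) intV by simp
      finally have "c \<le> - 2 * ?L \<nu> \<mu> + (\<integral>z. Re (V z) \<partial>\<nu>)" using cnm(2) by simp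
      then show ?thesis using pos unfolding Emu energy[OF intl diag intV] by simp
    qed
  qed
qed

end

text \<open>
  Where it is positive, $\ln(\eta/|t-\tau|)$ is the integral of $1/u$ from $|t-\tau|$ to $\eta$, and
  the points \<open>t\<close> with $|t-\tau| \le u$ form an interval of length $2u$.
\<close>

lemma nn_integral_log_pole:
  fixes \<tau> \<eta> :: real
  assumes "\<eta> > 0"
  shows "(\<integral>\<^sup>+t. ennreal (max 0 (ln (\<eta> / \<bar>t - \<tau>\<bar>))) \<partial>lborel) \<le> ennreal (2 * \<eta>)"
proof -
  let ?k = "\<lambda>t u. if \<bar>t - \<tau>\<bar> \<le> u \<and> u \<le> \<eta> then ennreal (1 / u) else 0"
  have inner: "ennreal (max 0 (ln (\<eta> / \<bar>t - \<tau>\<bar>))) = (\<integral>\<^sup>+u. ?k t u \<partial>lborel)" if t: "t \<noteq> \<tau>" for t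
  proof -
    have p: "\<bar>t - \<tau>\<bar> > 0" using t by simp
    show ?thesis
    proof (cases "\<bar>t - \<tau>\<bar> \<le> \<eta>")
      case True
      have "(\<integral>\<^sup>+u. ?k t u \<partial>lborel) = (\<integral>\<^sup>+u. ennreal (1 / u) * indicator {\<bar>t - \<tau>\<bar>..\<eta>} u \<partial>lborel)"
        by (rule nn_integral_cong) (simp add: indicator_def)
      also have "\<dots> = ennreal (ln \<eta> - ln \<bar>t - \<tau>\<bar>)"
        by (rule nn_integral_FTC_Icc) (use p True in \<open>auto intro!: derivative_eq_intros simp: divide_inverse\<close>)
      also have "ln \<eta> - ln \<bar>t - \<tau>\<bar> = max 0 (ln (\<eta> / \<bar>t - \<tau>\<bar>))"
      proof -
        have "ln \<bar>t - \<tau>\<bar> \<le> ln \<eta>" using p True assms by (subst ln_le_cancel_iff) auto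
        then show ?thesis using p assms by (simp add: ln_div)
      qed
      finally show ?thesis by simp
    next
      case False
      then have "(\<integral>\<^sup>+u. ?k t u \<partial>lborel) = (\<integral>\<^sup>+u. 0 \<partial>(lborel :: real measure))"
        by (intro nn_integral_cong) auto
      moreover have "ln (\<eta> / \<bar>t - \<tau>\<bar>) \<le> 0" using False p assms by (simp add: ln_le_zero_iff)
      ultimately show ?thesis by simp
    qed
  qed
  have "(\<integral>\<^sup>+t. ennreal (max 0 (ln (\<eta> / \<bar>t - \<tau>\<bar>))) \<partial>lborel) = (\<integral>\<^sup>+t. \<integral>\<^sup>+u. ?k t u \<partial>lborel \<partial>lborel)"
    by (rule nn_integral_cong_AE, use AE_lborel_singleton[of \<tau>] in eventually_elim) (rule inner)
  also have "\<dots> = (\<integral>\<^sup>+u. \<integral>\<^sup>+t. ?k t u \<partial>lborel \<partial>lborel)"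
    by (rule lborel_pair.Fubini') measurable
  also have "\<dots> \<le> (\<integral>\<^sup>+u. 2 * indicator {0..\<eta>} u \<partial>lborel)"
  proof (rule nn_integral_mono_AE, use AE_lborel_singleton[of 0] in eventually_elim)
    fix u :: real assume u: "u \<noteq> 0"
    show "(\<integral>\<^sup>+t. ?k t u \<partial>lborel) \<le> 2 * indicator {0..\<eta>} u"
    proof (cases "u > 0 \<and> u \<le> \<eta>")
      case True
      have "(\<integral>\<^sup>+t. ?k t u \<partial>lborel) = (\<integral>\<^sup>+t. ennreal (1 / u) * indicator {\<tau> - u..\<tau> + u} t \<partial>lborel)"
        using True by (intro nn_integral_cong) (auto simp: indicator_def abs_le_iff)
      also have "\<dots> = ennreal (1 / u) * ennreal (2 * u)"
        using True by (simp add: nn_integral_cmult_indicator)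
      also have "\<dots> = ennreal 2" using True by (subst ennreal_mult[symmetric]) auto
      finally show ?thesis using True by simp
    next
      case False
      then have "(\<integral>\<^sup>+t. ?k t u \<partial>lborel) = (\<integral>\<^sup>+t. 0 \<partial>(lborel :: real measure))"
        using u by (intro nn_integral_cong) auto
      then show ?thesis by simp
    qed
  qed
  also have "\<dots> = ennreal (2 * \<eta>)"
    using assms by (simp add: nn_integral_cmult_indicator ennreal_mult)
  finally show ?thesis .
qed

section \<open>Straightening an analytic arc\<close>

lemma analytic_curve_C1:
  assumes "analytic_curve_on UNIV g"
  obtains g' where "continuous_on UNIV g'" "\<And>t. (g has_vector_derivative g' t) (at t)"
proof -
  obtain H where H: "H analytic_on range complex_of_real" "\<And>t. H (complex_of_real t) = g t"
    using assms unfolding analytic_curve_on_def by auto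
  obtain T where T: "open T" "range complex_of_real \<subseteq> T" "H holomorphic_on T"
    using H(1) unfolding analytic_on_holomorphic by blast
  show ?thesis
  proof (rule that[of "\<lambda>t. deriv H (complex_of_real t)"])
    show "continuous_on UNIV (\<lambda>t. deriv H (complex_of_real t))"
      using T(2) by (intro continuous_on_compose2[OF holomorphic_on_imp_continuous_on[OF holomorphic_deriv[OF T(3,1)]]])
          (auto intro!: continuous_intros)
    fix t
    have "(H has_field_derivative deriv H (complex_of_real t)) (at (complex_of_real t))"
      by (rule holomorphic_derivI[OF T(3,1)]) (use T(2) in blast)
    from has_vector_derivative_real_field[OF this]
    show "(g has_vector_derivative deriv H (complex_of_real t)) (at t)" by (simp add: H(2))
  qed
qed

definition slab :: "real \<Rightarrow> complex set" where
  "slab d = {w. - d < Re w \<and> Re w < 1 + d \<and> - d < Im w \<and> Im w < d}"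

lemma slab_eq_box: "slab d = box (Complex (- d) (- d)) (Complex (1 + d) d)"
  by (auto simp: slab_def in_box_complex_iff)

lemma open_slab: "open (slab d)" and convex_slab: "convex (slab d)"
  by (simp_all add: slab_eq_box open_box)

lemma slab_of_real [simp]: "d > 0 \<Longrightarrow> complex_of_real t \<in> slab d \<longleftrightarrow> - d < t \<and> t < 1 + d"
  by (auto simp: slab_def)

text \<open>
  Otherwise there are two sequences of distinct points with equal images that approach \<open>K\<close>. Their
  limits in \<open>K\<close> have the same image, hence coincide, and there \<open>f\<close> is locally injective.
\<close>

lemma injective_near_compact:
  assumes holf: "f holomorphic_on U" and "open U" and K: "compact K" "K \<subseteq> U"
    and inj: "inj_on f K" and dnz: "\<And>x. x \<in> K \<Longrightarrow> deriv f x \<noteq> 0"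
    and ne: "K \<noteq> {}"
  obtains e where "e > 0" "{z. infdist z K < e} \<subseteq> U" "inj_on f {z \<in> U. infdist z K < e}"
proof -
  obtain e0 where e0: "e0 > 0" "{x. infdist x K < e0} \<subseteq> U"
  proof -
    obtain e where "e > 0" "(\<Union>x\<in>K. cball x e) \<subseteq> U"
      using compact_subset_open_imp_cball_epsilon_subset[OF K(1) \<open>open U\<close> K(2)] by metis
    moreover have "{x. infdist x K < e} \<subseteq> (\<Union>x\<in>K. cball x e)"
    proof
      fix x assume "x \<in> {x. infdist x K < e}"
      moreover obtain k where "k \<in> K" "infdist x K = dist x k"
        using infdist_attains_inf[OF compact_imp_closed[OF K(1)] ne] by blast
      ultimately show "x \<in> (\<Union>x\<in>K. cball x e)" by (auto simp: dist_commute intro!: bexI[of _ k] less_imp_le)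
    qed
    ultimately show ?thesis using that[of e] by blast
  qed
  have "\<exists>e>0. e \<le> e0 \<and> inj_on f {z \<in> U. infdist z K < e}"
  proof (rule ccontr)
    assume contra: "\<not> ?thesis"
    have "\<exists>a b. a \<in> U \<and> b \<in> U \<and> infdist a K < e0 / real (Suc n) \<and> infdist b K < e0 / real (Suc n) \<and> a \<noteq> b \<and> f a = f b" for n
    proof -
      have "e0 / real (Suc n) > 0" "e0 / real (Suc n) \<le> e0" using e0 by (auto simp: field_simps)
      with contra have "\<not> inj_on f {z \<in> U. infdist z K < e0 / real (Suc n)}" by blast
      then show ?thesis unfolding inj_on_def by blast
    qed
    then obtain a b where ab: "\<And>n. a n \<in> U" "\<And>n. b n \<in> U" "\<And>n. infdist (a n) K < e0 / real (Suc n)"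
      "\<And>n. infdist (b n) K < e0 / real (Suc n)" "\<And>n. a n \<noteq> b n" "\<And>n. f (a n) = f (b n)" by metis
    have "\<exists>k\<in>K. infdist x K = dist x k" for x
      using infdist_attains_inf[OF compact_imp_closed[OF K(1)] ne] by blast
    then obtain p where p: "\<And>x. p x \<in> K" "\<And>x. infdist x K = dist x (p x)" by metis
    have lim0: "(\<lambda>n. e0 / real (Suc n)) \<longlonglongrightarrow> 0" by real_asymp
    have sc: "\<exists>l r. l \<in> K \<and> strict_mono r \<and> (h \<circ> r) \<longlonglongrightarrow> l" if "\<And>n::nat. h n \<in> K" for h
      using compact_imp_seq_compact[OF K(1), unfolded seq_compact_def, rule_format, of h] that by blast
    obtain l r where l: "l \<in> K" "strict_mono r" "((p \<circ> a) \<circ> r) \<longlonglongrightarrow> l"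
      using sc[of "p \<circ> a"] p(1) unfolding comp_apply by blast
    obtain m s where m: "m \<in> K" "strict_mono s" "((p \<circ> b \<circ> r) \<circ> s) \<longlonglongrightarrow> m"
      using sc[of "p \<circ> b \<circ> r"] p(1) unfolding comp_apply by blast
    let ?r = "r \<circ> s"
    have sr: "strict_mono ?r" using l m by (simp add: strict_mono_o)
    have l': "(\<lambda>n. p (a (?r n))) \<longlonglongrightarrow> l" using LIMSEQ_subseq_LIMSEQ[OF l(3) m(2)] by (simp add: o_def)
    have m': "(\<lambda>n. p (b (?r n))) \<longlonglongrightarrow> m" using m(3) by (simp add: o_def)
    have da: "(\<lambda>n. dist (a (?r n)) (p (a (?r n)))) \<longlonglongrightarrow> 0"
      by (rule tendsto_sandwich[OF _ _ tendsto_const LIMSEQ_subseq_LIMSEQ[OF lim0 sr]])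
         (use ab(3) p(2) in \<open>auto intro!: always_eventually less_imp_le simp del: of_nat_Suc\<close>)
    have db: "(\<lambda>n. dist (b (?r n)) (p (b (?r n)))) \<longlonglongrightarrow> 0"
      by (rule tendsto_sandwich[OF _ _ tendsto_const LIMSEQ_subseq_LIMSEQ[OF lim0 sr]])
         (use ab(4) p(2) in \<open>auto intro!: always_eventually less_imp_le simp del: of_nat_Suc\<close>)
    have al: "(\<lambda>n. a (?r n)) \<longlonglongrightarrow> l"
      using tendsto_add[OF tendsto_norm_zero_cancel[OF da[unfolded dist_norm]] l'] by simp
    have bl: "(\<lambda>n. b (?r n)) \<longlonglongrightarrow> m"
      using tendsto_add[OF tendsto_norm_zero_cancel[OF db[unfolded dist_norm]] m'] by simp
    have cf: "isCont f x" if "x \<in> K" for x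
      using holf \<open>open U\<close> that K by (meson continuous_on_eq_continuous_at holomorphic_on_imp_continuous_on subsetD)
    have "(\<lambda>n. f (a (?r n))) \<longlonglongrightarrow> f l" "(\<lambda>n. f (b (?r n))) \<longlonglongrightarrow> f m"
      using isCont_tendsto_compose[OF cf al] isCont_tendsto_compose[OF cf bl] l m by auto
    then have "f l = f m" using ab(6) by (simp add: LIMSEQ_unique)
    then have lm: "l = m" using inj l m by (auto simp: inj_on_def)
    obtain \<rho> where \<rho>: "\<rho> > 0" "ball l \<rho> \<subseteq> U" "inj_on f (ball l \<rho>)"
      using has_complex_derivative_locally_injective[OF holf _ \<open>open U\<close> dnz[OF l(1)]] l K by blast
    have "\<forall>\<^sub>F n in sequentially. a (?r n) \<in> ball l \<rho>" "\<forall>\<^sub>F n in sequentially. b (?r n) \<in> ball l \<rho>"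
      using topological_tendstoD[OF al, of "ball l \<rho>"] topological_tendstoD[OF bl, of "ball l \<rho>"] \<rho> lm by auto
    then have "\<forall>\<^sub>F n in sequentially. False"
    proof eventually_elim
      case (elim n)
      from inj_onD[OF \<rho>(3) ab(6) this] ab(5) show False by blast
    qed
    then show False by simp
  qed
  then obtain e where e: "e > 0" "e \<le> e0" "inj_on f {z \<in> U. infdist z K < e}" by blast
  have "{z. infdist z K < e} \<subseteq> U"
  proof
    fix z assume "z \<in> {z. infdist z K < e}"
    then have "z \<in> {z. infdist z K < e0}" using e(2) by simp
    then show "z \<in> U" using e0(2) by blast
  qed
  then show ?thesis using that e(1,3) by blast
qed

text \<open>
  The analytic extension of the parametrization is injective on the unit interval, hence near it.
  A point \<open>p\<close> off the arc can be avoided as well; this will be the double zero of \<open>Q\<close>.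
\<close>

lemma straightening_exists:
  assumes G: "analytic_curve_on UNIV G" "inj G" and p: "p \<notin> G ` {0..1}"
  obtains F d where "d > 0" "F holomorphic_on slab d" "inj_on F (slab d)" "p \<notin> F ` slab d"
    "\<And>t. - d < t \<Longrightarrow> t < 1 + d \<Longrightarrow> F (complex_of_real t) = G t"
    "\<And>w. w \<in> slab d \<Longrightarrow> deriv F w \<noteq> 0"
proof -
  obtain F where F: "F analytic_on range complex_of_real" "\<And>t. F (complex_of_real t) = G t" "\<And>t. deriv F (complex_of_real t) \<noteq> 0"
    using G(1) unfolding analytic_curve_on_def by auto
  obtain T where T: "open T" "range complex_of_real \<subseteq> T" "F holomorphic_on T"
    using F(1) unfolding analytic_on_holomorphic by blast
  define U where "U = {w \<in> T. F w \<noteq> p}"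
  have "U = T \<inter> F -` (- {p})" by (auto simp: U_def)
  then have U: "open U"
    using T continuous_open_preimage[of T F "- {p}"] by (auto intro: holomorphic_on_imp_continuous_on)
  define K where "K = complex_of_real ` {0..1}"
  have K: "compact K" "K \<subseteq> U" "K \<noteq> {}"
    using p T(2) unfolding K_def by (auto simp: U_def F(2) intro!: compact_continuous_image continuous_intros)
  have holU: "F holomorphic_on U" using T by (auto simp: U_def intro: holomorphic_on_subset)
  have injK: "inj_on F K" using G(2) by (auto simp: K_def inj_on_def F(2))
  obtain e where e: "e > 0" "{z. infdist z K < e} \<subseteq> U" "inj_on F {z \<in> U. infdist z K < e}"
  proof (rule injective_near_compact[OF holU U K(1,2) injK _ K(3)])
    show "deriv F x \<noteq> 0" if "x \<in> K" for x using that F(3) by (auto simp: K_def)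
  qed
  \<comment> \<open>a point of the slab has distance less than 2 * d from the unit interval\<close>
  define d where "d = e / 3"
  have d: "d > 0" using e by (simp add: d_def)
  have sub: "slab d \<subseteq> {z. infdist z K < e}"
  proof
    fix w assume w: "w \<in> slab d"
    define x where "x = max 0 (min 1 (Re w))"
    have "infdist w K \<le> dist w (of_real x)" by (rule infdist_le) (auto simp: K_def x_def)
    also have "\<dots> \<le> \<bar>Re (w - of_real x)\<bar> + \<bar>Im (w - of_real x)\<bar>" unfolding dist_norm by (rule cmod_le)
    also have "\<dots> < d + d" using w by (auto simp: slab_def x_def max_def min_def abs_if)
    also have "\<dots> < e" using e by (simp add: d_def)
    finally show "w \<in> {z. infdist z K < e}" by simp
  qed
  have subU: "slab d \<subseteq> U" using sub e(2) by (rule subset_trans)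
  have hol: "F holomorphic_on slab d" using holU subU by (rule holomorphic_on_subset)
  have inj: "inj_on F (slab d)" by (rule inj_on_subset[OF e(3)]) (use sub subU in blast)
  show ?thesis
  proof (rule that[OF d hol inj])
    show "p \<notin> F ` slab d" using subU by (auto simp: U_def)
    show "deriv F w \<noteq> 0" if "w \<in> slab d" for w
      using holomorphic_injective_imp_regular[OF hol open_slab inj that] .
  qed (use F in auto)
qed

section \<open>Boundary values of the square root on the two sides of the cut\<close>

text \<open>
  The quotient is continuous with values in \<open>{1, -1}\<close>.
\<close>

lemma eq_up_to_sign:
  fixes f g :: "'a::topological_space \<Rightarrow> complex"
  assumes "connected S" "continuous_on S f" "continuous_on S g"
    and "\<And>x. x \<in> S \<Longrightarrow> (f x)\<^sup>2 = (g x)\<^sup>2" "\<And>x. x \<in> S \<Longrightarrow> g x \<noteq> 0"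
  obtains c where "c = 1 \<or> c = -1" "\<And>x. x \<in> S \<Longrightarrow> f x = c * g x"
proof -
  have v: "f x / g x \<in> {1, -1}" if x: "x \<in> S" for x
  proof -
    from assms(4)[OF x] have "f x = g x \<or> f x = - g x" by (simp only: power2_eq_iff)
    then show ?thesis
    proof
      assume e: "f x = g x" show ?thesis unfolding e using assms(5)[OF x] by simp
    next
      assume e: "f x = - g x" show ?thesis unfolding e using assms(5)[OF x] by simp
    qed
  qed
  then have "(\<lambda>x. f x / g x) ` S \<subseteq> {1, -1}" by (rule image_subsetI)
  then have fin: "finite ((\<lambda>x. f x / g x) ` S)" by (rule finite_subset) simp
  have cont: "continuous_on S (\<lambda>x. f x / g x)"
    using assms(5) by (intro continuous_on_divide[OF assms(2,3)]) blast
  obtain c where c: "\<And>x. x \<in> S \<Longrightarrow> f x / g x = c"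
    using continuous_finite_range_constant[OF assms(1) cont fin] unfolding constant_on_def by blast
  show ?thesis
  proof (cases "S = {}")
    case False
    then obtain x where x: "x \<in> S" by blast
    show ?thesis
    proof (rule that)
      have "c \<in> {1, -1}" using v[OF x] by (simp only: c[OF x])
      then show "c = 1 \<or> c = -1" by simp
      show "f y = c * g y" if "y \<in> S" for y
        using c[OF that] assms(5)[OF that] by (simp add: divide_eq_eq)
    qed
  next
    case True
    show ?thesis by (rule that[of 1]) (simp_all add: True)
  qed
qed

lemma continuous_on_csqrt_Re_nonneg: "continuous_on {z. Re z \<ge> 0} csqrt"
proof (rule continuous_at_imp_continuous_on[of "{z. Re z \<ge> 0}" csqrt], rule ballI)
  fix z assume z: "z \<in> {z. Re z \<ge> 0}"
  show "isCont csqrt z"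
  proof (cases "z = 0")
    case True
    have "((\<lambda>w::complex. sqrt (norm w)) \<longlongrightarrow> sqrt (norm (0::complex))) (at 0)"
      by (rule tendsto_real_sqrt[OF tendsto_norm[OF tendsto_ident_at]])
    then have "((\<lambda>w. norm (csqrt w)) \<longlongrightarrow> 0) (at 0)"
      by (simp only: norm_csqrt norm_zero real_sqrt_zero)
    then have "(csqrt \<longlongrightarrow> 0) (at 0)" by (rule tendsto_norm_zero_cancel)
    then show ?thesis by (simp only: True isCont_def csqrt_0)
  next
    case False
    have "z \<notin> \<real>\<^sub>\<le>\<^sub>0"
    proof
      assume "z \<in> \<real>\<^sub>\<le>\<^sub>0"
      then have "Re z \<le> 0" "Im z = 0" by (simp_all add: complex_nonpos_Reals_iff)
      with z False show False by (simp add: complex_eq_iff)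
    qed
    then show ?thesis by (rule continuous_at_csqrt)
  qed
qed

text \<open>
  Two square roots of \<open>- (w * (w - 1))\<close>, one continuous on the closed upper and one on the closed lower
  half plane: the factors \<open>- \<i>\<close> and \<open>\<i>\<close> rotate these half planes into the closed right half plane,
  where \<^const>\<open>csqrt\<close> is continuous.
\<close>

definition sqrt_up :: "complex \<Rightarrow> complex" where
  "sqrt_up w = csqrt (- \<i> * w) * csqrt (- \<i> * (w - 1))"

definition sqrt_low :: "complex \<Rightarrow> complex" where
  "sqrt_low w = csqrt (\<i> * w) * csqrt (\<i> * (w - 1))"

lemma sqrt_up_low_sq: "(sqrt_up w)\<^sup>2 = - (w * (w - 1))" "(sqrt_low w)\<^sup>2 = - (w * (w - 1))"
proof -
  have "(sqrt_up w)\<^sup>2 = (- \<i> * w) * (- \<i> * (w - 1))" "(sqrt_low w)\<^sup>2 = (\<i> * w) * (\<i> * (w - 1))"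
    unfolding sqrt_up_def sqrt_low_def power_mult_distrib power2_csqrt by (rule refl)+
  moreover have "(- \<i> * a) * (- \<i> * b) = - (a * b)" "(\<i> * a) * (\<i> * b) = - (a * b)" for a b
  proof -
    have "(k * a) * (k * b) = (k * k) * (a * b)" for k :: complex by (simp only: mult_ac)
    from this[of "- \<i>"] this[of \<i>]
    show "(- \<i> * a) * (- \<i> * b) = - (a * b)" "(\<i> * a) * (\<i> * b) = - (a * b)" by simp_all
  qed
  ultimately show "(sqrt_up w)\<^sup>2 = - (w * (w - 1))" "(sqrt_low w)\<^sup>2 = - (w * (w - 1))"
    by (simp_all only:)
qed

lemma continuous_on_sqrt_up: "continuous_on {w. Im w \<ge> 0} sqrt_up"
  and continuous_on_sqrt_low: "continuous_on {w. Im w \<le> 0} sqrt_low"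
proof -
  have c: "continuous_on S (\<lambda>w. csqrt (a * (w - b)))" if "\<And>w. w \<in> S \<Longrightarrow> Re (a * (w - b)) \<ge> 0" for S a b
    by (rule continuous_on_compose2[OF continuous_on_csqrt_Re_nonneg]) (use that in \<open>auto intro!: continuous_on_mult continuous_on_diff continuous_on_const continuous_on_id\<close>)
  have "continuous_on {w. Im w \<ge> 0} (\<lambda>w. csqrt (- \<i> * (w - 0)) * csqrt (- \<i> * (w - 1)))"
    by (intro continuous_on_mult c) simp_all
  then show "continuous_on {w. Im w \<ge> 0} sqrt_up" by (simp add: sqrt_up_def[abs_def])
  have "continuous_on {w. Im w \<le> 0} (\<lambda>w. csqrt (\<i> * (w - 0)) * csqrt (\<i> * (w - 1)))"
    by (intro continuous_on_mult c) simp_all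
  then show "continuous_on {w. Im w \<le> 0} sqrt_low" by (simp add: sqrt_low_def[abs_def])
qed

text \<open>
  On the real axis the two roots are complex conjugates of each other. Their square \<open>x * (1 - x)\<close> is
  nonnegative on the unit interval, where they are real, and negative outside, where they are
  imaginary.
\<close>

lemma sqrt_low_of_real:
  "sqrt_low (complex_of_real x) = (if x \<in> {0..1} then sqrt_up (complex_of_real x) else - sqrt_up (complex_of_real x))"
proof -
  have c: "csqrt (\<i> * complex_of_real y) = cnj (csqrt (- \<i> * complex_of_real y))" for y
    by (cases "y = 0") (auto simp: cnj_csqrt complex_nonpos_Reals_iff)
  let ?s = "sqrt_up (complex_of_real x)"
  have cs: "sqrt_low (complex_of_real x) = cnj ?s"
    using c[of x] c[of "x - 1"] by (simp add: sqrt_up_def sqrt_low_def)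
  have "?s\<^sup>2 = complex_of_real (x * (1 - x))" by (simp add: sqrt_up_low_sq algebra_simps)
  then have im: "Re ?s * Im ?s = 0" and re: "(Re ?s)\<^sup>2 - (Im ?s)\<^sup>2 = x * (1 - x)"
    by (auto simp: complex_eq_iff power2_eq_square)
  show ?thesis
  proof (cases "x \<in> {0..1}")
    case True
    then have "x * (1 - x) \<ge> 0" by simp
    have "Im ?s = 0"
    proof (rule ccontr)
      assume "Im ?s \<noteq> 0"
      with im have "Re ?s = 0" by simp
      with re have "x * (1 - x) = - (Im ?s)\<^sup>2" by simp
      moreover have "(Im ?s)\<^sup>2 > 0" using \<open>Im ?s \<noteq> 0\<close> by simp
      ultimately show False using \<open>x * (1 - x) \<ge> 0\<close> by linarith
    qed
    then show ?thesis using True cs by (simp add: complex_eq_iff)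
  next
    case False
    then have "x * (1 - x) < 0" by (auto simp: mult_less_0_iff)
    have "Re ?s = 0"
    proof (rule ccontr)
      assume "Re ?s \<noteq> 0"
      with im have "Im ?s = 0" by simp
      with re \<open>x * (1 - x) < 0\<close> show False by (metis diff_zero not_less zero_le_power2 zero_power2)
    qed
    then show ?thesis using False cs by (auto simp: complex_eq_iff)
  qed
qed

text \<open>
  The sign of \<open>s\<close> selects the approach from above or from below the real axis.
\<close>

lemma eq_by_vertical_limit:
  fixes f g :: "complex \<Rightarrow> complex"
  assumes "continuous_on A f" "continuous_on B g" "complex_of_real x \<in> A" "complex_of_real x \<in> B"
    and ev: "\<forall>\<^sub>F h in at_right 0. Complex x (s * h) \<in> A \<inter> B \<and> f (Complex x (s * h)) = g (Complex x (s * h))"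
  shows "f (complex_of_real x) = g (complex_of_real x)"
proof -
  have l: "((\<lambda>h. Complex x (s * h)) \<longlongrightarrow> complex_of_real x) (at_right 0)"
  proof -
    have "((\<lambda>h. complex_of_real x + \<i> * complex_of_real (s * h)) \<longlongrightarrow> complex_of_real x + \<i> * complex_of_real (s * 0)) (at_right 0)"
      by (intro tendsto_intros)
    then show ?thesis by (simp add: Complex_eq)
  qed
  have l1: "((\<lambda>h. f (Complex x (s * h))) \<longlongrightarrow> f (complex_of_real x)) (at_right 0)"
    by (rule continuous_on_tendsto_compose[OF assms(1) l assms(3)]) (use ev in \<open>auto elim: eventually_mono\<close>)
  have "((\<lambda>h. g (Complex x (s * h))) \<longlongrightarrow> g (complex_of_real x)) (at_right 0)"
    by (rule continuous_on_tendsto_compose[OF assms(2) l assms(4)]) (use ev in \<open>auto elim: eventually_mono\<close>)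
  then have l2: "((\<lambda>h. f (Complex x (s * h))) \<longlongrightarrow> g (complex_of_real x)) (at_right 0)"
    by (rule Lim_transform_eventually) (use ev in \<open>auto elim!: eventually_mono\<close>)
  show ?thesis by (rule tendsto_unique[OF _ l1 l2]) simp
qed

text \<open>
  In the straightened coordinate \<open>Q\<close> has simple zeros at 0 and 1 and no others, so it equals
  \<open>(c w)\<^sup>2 * - (w * (w - 1))\<close> with a holomorphic function \<open>c\<close> without zeros. Hence \<open>q\<close> is \<open>c * sqrt_up\<close> above and
  \<open>c * sqrt_low\<close> below the real axis, up to a sign in each case. To the left of 0 the two expressions
  must agree, and there \<open>sqrt_low\<close> is \<open>- sqrt_up\<close>: the signs are opposite. On the unit interval, where
  \<open>sqrt_low\<close> is \<open>sqrt_up\<close>, the function \<open>q\<close> thus changes its sign across the cut.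
\<close>

lemma boundary_values_exist:
  assumes d: "d > 0" and F: "F holomorphic_on slab d" "inj_on F (slab d)" "- \<i> \<notin> F ` slab d"
    "F 0 = z1" "F 1 = z2"
    and q: "continuous_on (slab d - complex_of_real ` {0..1}) (\<lambda>w. q (F w))"
       "\<And>w. w \<in> slab d - complex_of_real ` {0..1} \<Longrightarrow> (q (F w))\<^sup>2 = Q (F w)"
  obtains qp qm where
    "continuous_on (slab d \<inter> {w. Im w \<ge> 0}) qp" "continuous_on (slab d \<inter> {w. Im w \<le> 0}) qm"
    "\<And>w. w \<in> slab d - complex_of_real ` {0..1} \<Longrightarrow> Im w \<ge> 0 \<Longrightarrow> qp w = q (F w)"
    "\<And>w. w \<in> slab d - complex_of_real ` {0..1} \<Longrightarrow> Im w \<le> 0 \<Longrightarrow> qm w = q (F w)"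
    "\<And>t. t \<in> {0..1} \<Longrightarrow> qm (complex_of_real t) = - qp (complex_of_real t)"
    "\<And>t. t \<in> {0..1} \<Longrightarrow> (qp (complex_of_real t))\<^sup>2 = Q (F (complex_of_real t))"
    "\<And>t. t \<in> {0<..<1} \<Longrightarrow> qp (complex_of_real t) \<noteq> 0"
proof -
  define sl where "sl a w = (if w = a then deriv F a else (F w - F a) / (w - a))" for a w
  define k where "k w = (F w + \<i>)\<^sup>2 * sl 0 w * sl 1 w / 4" for w
  have in01: "0 \<in> slab d" "1 \<in> slab d" using d by (auto simp: slab_def)
  have sl_nz: "sl a w \<noteq> 0" if "a \<in> slab d" "w \<in> slab d" for a w
    using that F(2) holomorphic_injective_imp_regular[OF F(1) open_slab F(2) that(1)]
    by (auto simp: sl_def inj_on_def)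
  have k_hol: "k holomorphic_on slab d"
    unfolding k_def sl_def by (intro holomorphic_intros F pole_lemma_open open_slab) auto
  have k_nz: "k w \<noteq> 0" if "w \<in> slab d" for w
    using that F(3) sl_nz[OF in01(1) that] sl_nz[OF in01(2) that]
    by (auto simp: k_def add_eq_0_iff2 intro: rev_image_eqI)
  have Qfac: "Q z = - (1 / 4) * (z + \<i>)\<^sup>2 * ((z - z1) * (z - z2))" for z
  proof -
    have "complex_of_real (sqrt 2) * complex_of_real (sqrt 2) = 2" by (simp flip: of_real_mult)
    then have "(z - z1) * (z - z2) = z\<^sup>2 - 2 * \<i> * z - 3"
      unfolding z1_def z2_def by (simp add: algebra_simps power2_eq_square)
    then show ?thesis unfolding Q_def by simp
  qed
  have Qk: "Q (F w) = k w * (- (w * (w - 1)))" if "w \<in> slab d" for w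
  proof -
    have "F w - z1 = w * sl 0 w" "F w - z2 = (w - 1) * sl 1 w"
      using F(4,5) by (auto simp: sl_def)
    then show ?thesis unfolding Qfac k_def by simp
  qed
  have "contractible (slab d)" by (intro convex_imp_contractible convex_slab)
  then obtain c where c: "c holomorphic_on slab d" "\<And>w. w \<in> slab d \<Longrightarrow> k w = (c w)\<^sup>2"
    using contractible_imp_holomorphic_sqrt[OF k_hol _ k_nz] by blast
  have c_nz: "c w \<noteq> 0" if "w \<in> slab d" for w using k_nz[OF that] c(2)[OF that] by auto
  have Qc: "(c w * sqrt_up w)\<^sup>2 = Q (F w)" "(c w * sqrt_low w)\<^sup>2 = Q (F w)" if "w \<in> slab d" for w
    using Qk[OF that] c(2)[OF that] by (simp_all add: power_mult_distrib sqrt_up_low_sq)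
  have cont_c: "continuous_on (slab d \<inter> A) c" for A
    using c(1) by (intro continuous_on_subset[OF holomorphic_on_imp_continuous_on]) auto
  have up_nz: "sqrt_up w \<noteq> 0" "sqrt_low w \<noteq> 0" if "w \<noteq> 0" "w \<noteq> 1" for w
    using that by (auto simp: sqrt_up_def sqrt_low_def)
  have sub: "slab d \<inter> {w. Im w > 0} \<subseteq> slab d - complex_of_real ` {0..1}"
    "slab d \<inter> {w. Im w < 0} \<subseteq> slab d - complex_of_real ` {0..1}" by auto
  have cup: "continuous_on (slab d \<inter> {w. Im w \<ge> 0}) (\<lambda>w. c w * sqrt_up w)"
    by (intro continuous_intros cont_c continuous_on_subset[OF continuous_on_sqrt_up]) auto
  have clow: "continuous_on (slab d \<inter> {w. Im w \<le> 0}) (\<lambda>w. c w * sqrt_low w)"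
    by (intro continuous_intros cont_c continuous_on_subset[OF continuous_on_sqrt_low]) auto
  obtain a where a: "a = 1 \<or> a = -1" "\<And>w. w \<in> slab d \<inter> {w. Im w > 0} \<Longrightarrow> q (F w) = a * (c w * sqrt_up w)"
  proof (rule eq_up_to_sign[of "slab d \<inter> {w. Im w > 0}" "\<lambda>w. q (F w)" "\<lambda>w. c w * sqrt_up w"])
    show "connected (slab d \<inter> {w. Im w > 0})"
      by (intro convex_connected convex_Int convex_slab convex_halfspace_Im_gt)
    show "c w * sqrt_up w \<noteq> 0" if "w \<in> slab d \<inter> {w. Im w > 0}" for w
      using that c_nz[of w] up_nz(1)[of w] by (cases "w = 0 \<or> w = 1") auto
  qed (use q sub Qc in \<open>auto intro: continuous_on_subset[OF q(1)] continuous_on_subset[OF cup]\<close>)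
  obtain b where b: "b = 1 \<or> b = -1" "\<And>w. w \<in> slab d \<inter> {w. Im w < 0} \<Longrightarrow> q (F w) = b * (c w * sqrt_low w)"
  proof (rule eq_up_to_sign[of "slab d \<inter> {w. Im w < 0}" "\<lambda>w. q (F w)" "\<lambda>w. c w * sqrt_low w"])
    show "connected (slab d \<inter> {w. Im w < 0})"
      by (intro convex_connected convex_Int convex_slab convex_halfspace_Im_lt)
    show "c w * sqrt_low w \<noteq> 0" if "w \<in> slab d \<inter> {w. Im w < 0}" for w
      using that c_nz[of w] up_nz(2)[of w] by (cases "w = 0 \<or> w = 1") auto
  qed (use q sub Qc in \<open>auto intro: continuous_on_subset[OF q(1)] continuous_on_subset[OF clow]\<close>)
  define qp where "qp w = a * (c w * sqrt_up w)" for w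
  define qm where "qm w = b * (c w * sqrt_low w)" for w
  have contp: "continuous_on (slab d \<inter> {w. Im w \<ge> 0}) qp"
    unfolding qp_def by (intro continuous_on_mult continuous_on_const cup)
  have contm: "continuous_on (slab d \<inter> {w. Im w \<le> 0}) qm"
    unfolding qm_def by (intro continuous_on_mult continuous_on_const clow)
  have near: "\<forall>\<^sub>F h in at_right 0. 0 < h \<and> h < d" using d eventually_at_right_less[of 0] eventually_at_right_real[OF d] by auto
  have realp: "qp (complex_of_real x) = q (F (complex_of_real x))" if "- d < x" "x < 1 + d" "x \<notin> {0..1}" for x
  proof (rule eq_by_vertical_limit[OF contp q(1), where s=1])
    show "\<forall>\<^sub>F h in at_right 0. Complex x (1 * h) \<in> slab d \<inter> {w. 0 \<le> Im w} \<inter> (slab d - complex_of_real ` {0..1}) \<and> qp (Complex x (1 * h)) = q (F (Complex x (1 * h)))"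
      using near
    proof eventually_elim
      case (elim h)
      have "Complex x h \<in> slab d" using that elim by (auto simp: slab_def)
      moreover have "Complex x h \<notin> complex_of_real ` {0..1}" using elim by (auto simp: complex_eq_iff)
      moreover have "qp (Complex x h) = q (F (Complex x h))"
        using a(2)[of "Complex x h"] elim \<open>Complex x h \<in> slab d\<close> by (simp add: qp_def)
      ultimately show ?case using elim by simp
    qed
  qed (use that d in auto)
  have realm: "qm (complex_of_real x) = q (F (complex_of_real x))" if "- d < x" "x < 1 + d" "x \<notin> {0..1}" for x
  proof (rule eq_by_vertical_limit[OF contm q(1), where s="-1"])
    show "\<forall>\<^sub>F h in at_right 0. Complex x (-1 * h) \<in> slab d \<inter> {w. Im w \<le> 0} \<inter> (slab d - complex_of_real ` {0..1}) \<and> qm (Complex x (-1 * h)) = q (F (Complex x (-1 * h)))"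
      using near
    proof eventually_elim
      case (elim h)
      have "Complex x (- h) \<in> slab d" using that elim by (auto simp: slab_def)
      moreover have "Complex x (- h) \<notin> complex_of_real ` {0..1}" using elim by (auto simp: complex_eq_iff)
      moreover have "qm (Complex x (- h)) = q (F (Complex x (- h)))"
        using b(2)[of "Complex x (- h)"] elim \<open>Complex x (- h) \<in> slab d\<close> by (simp add: qm_def)
      ultimately show ?case using elim by simp
    qed
  qed (use that d in auto)
  have ba: "b = - a"
  proof -
    \<comment> \<open>any real point of the slab to the left of 0 would do\<close>
    let ?x = "complex_of_real (- d / 2)"
    have "a * (c ?x * sqrt_up ?x) = b * (c ?x * sqrt_low ?x)"
      using realp[of "- d / 2"] realm[of "- d / 2"] d by (simp add: qp_def qm_def)
    also have "sqrt_low ?x = - sqrt_up ?x" using d sqrt_low_of_real[of "- d / 2"] by simp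
    finally have "(a + b) * (c ?x * sqrt_up ?x) = 0" by (simp add: algebra_simps)
    moreover have "c ?x \<noteq> 0" using d slab_of_real[of d "- d / 2"] by (intro c_nz) simp
    moreover have "sqrt_up ?x \<noteq> 0" using d by (intro up_nz) (auto simp: complex_eq_iff)
    ultimately show ?thesis by (simp add: add_eq_0_iff2 add_eq_0_iff)
  qed
  have a2: "a\<^sup>2 = 1" using a(1) by auto
  show ?thesis
  proof (rule that[OF contp contm])
    show "qp w = q (F w)" if "w \<in> slab d - complex_of_real ` {0..1}" "Im w \<ge> 0" for w
    proof (cases "Im w = 0")
      case True
      then have "w = complex_of_real (Re w)" by (simp add: complex_eq_iff)
      then show ?thesis using that realp[of "Re w"] d by (metis DiffE imageI slab_of_real)
    qed (use that a(2)[of w] in \<open>auto simp: qp_def\<close>)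
    show "qm w = q (F w)" if "w \<in> slab d - complex_of_real ` {0..1}" "Im w \<le> 0" for w
    proof (cases "Im w = 0")
      case True
      then have "w = complex_of_real (Re w)" by (simp add: complex_eq_iff)
      then show ?thesis using that realm[of "Re w"] d by (metis DiffE imageI slab_of_real)
    qed (use that b(2)[of w] in \<open>auto simp: qm_def\<close>)
    show "qm (complex_of_real t) = - qp (complex_of_real t)" if "t \<in> {0..1}" for t
      using that by (simp add: qm_def qp_def ba sqrt_low_of_real)
    show "(qp (complex_of_real t))\<^sup>2 = Q (F (complex_of_real t))" if "t \<in> {0..1}" for t
      using that d a2 Qc(1)[of "complex_of_real t"] by (simp add: qp_def power_mult_distrib)
    show "qp (complex_of_real t) \<noteq> 0" if "t \<in> {0<..<1}" for t
      using that d a(1) c_nz[of "complex_of_real t"] up_nz(1)[of "complex_of_real t"] by (auto simp: qp_def)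
  qed
qed

section \<open>Cauchy type integrals\<close>

lemma cauchy_type_integral_holomorphic:
  fixes \<phi> \<psi> :: "real \<Rightarrow> complex"
  assumes \<phi>: "continuous_on {0..1} \<phi>" and \<psi>: "continuous_on {0..1} \<psi>"
  shows "(\<lambda>z. integral {0..1} (\<lambda>t. \<phi> t / (\<psi> t - z))) holomorphic_on - \<psi> ` {0..1}"
proof -
  have cl: "closed (\<psi> ` {0..1})" using \<psi> by (intro compact_imp_closed compact_continuous_image) auto
  have "(\<lambda>z. integral {0..1} (\<lambda>t. \<phi> t / (\<psi> t - z))) field_differentiable at z0" if z0: "z0 \<in> - \<psi> ` {0..1}" for z0
  proof -
    obtain r where r: "r > 0" "ball z0 r \<subseteq> - \<psi> ` {0..1}"
      using open_contains_ball_eq[OF open_Compl[OF cl]] z0 by blast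
    have "(\<lambda>z. integral (cbox 0 1) (\<lambda>t. \<phi> t / (\<psi> t - z))) holomorphic_on ball z0 r"
    proof (rule leibniz_rule_holomorphic)
      fix z t assume zt: "z \<in> ball z0 r" "t \<in> cbox 0 (1::real)"
      then have "\<psi> t - z \<noteq> 0" using r by auto
      then show "((\<lambda>z. \<phi> t / (\<psi> t - z)) has_field_derivative \<phi> t / (\<psi> t - z)\<^sup>2) (at z within ball z0 r)"
        by (auto intro!: derivative_eq_intros simp: power2_eq_square)
    next
      fix z assume z: "z \<in> ball z0 r"
      then have "\<psi> t - z \<noteq> 0" if "t \<in> {0..1}" for t using r that by auto
      then show "(\<lambda>t. \<phi> t / (\<psi> t - z)) integrable_on cbox 0 1"
        by (auto intro!: integrable_continuous_real continuous_intros \<phi> \<psi>)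
    next
      have nz: "\<psi> (snd p) - fst p \<noteq> 0" if "p \<in> ball z0 r \<times> cbox 0 1" for p
        using r(2) that by (cases p) auto
      show "continuous_on (ball z0 r \<times> cbox 0 1) (\<lambda>(z, t). \<phi> t / (\<psi> t - z)\<^sup>2)"
        unfolding split_beta'
        by (intro continuous_intros continuous_on_compose2[OF \<phi>] continuous_on_compose2[OF \<psi>]) (use nz in auto)
    qed auto
    then show ?thesis using r by (simp add: holomorphic_on_imp_differentiable_at)
  qed
  then show ?thesis by (simp add: holomorphic_on_def field_differentiable_at_within)
qed

lemma cauchy_type_integral_tendsto_0:
  fixes \<phi> \<psi> :: "real \<Rightarrow> complex"
  assumes \<phi>: "continuous_on {0..1} \<phi>" and \<psi>: "continuous_on {0..1} \<psi>"
  shows "((\<lambda>z. integral {0..1} (\<lambda>t. \<phi> t / (\<psi> t - z))) \<longlongrightarrow> 0) at_infinity"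
proof -
  have "bounded (\<phi> ` {0..1})" "bounded (\<psi> ` {0..1})"
    using \<phi> \<psi> by (auto intro!: compact_imp_bounded compact_continuous_image)
  then obtain A B where A: "\<And>t. t \<in> {0..1} \<Longrightarrow> norm (\<phi> t) \<le> A" and B: "\<And>t. t \<in> {0..1} \<Longrightarrow> norm (\<psi> t) \<le> B"
    unfolding bounded_iff by fastforce
  have A0: "A \<ge> 0" using order_trans[OF norm_ge_zero A[of 0]] by simp
  have b: "norm (integral {0..1} (\<lambda>t. \<phi> t / (\<psi> t - z))) \<le> A / (norm z - B)" if "norm z > B" for z
  proof -
    have nz: "norm (\<psi> t - z) \<ge> norm z - B" if "t \<in> {0..1}" for t
      using norm_triangle_ineq2[of z "\<psi> t"] B[OF that] by (simp add: norm_minus_commute)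
    have nz0: "\<psi> t - z \<noteq> 0" if "t \<in> {0..1}" for t using nz[OF that] \<open>norm z > B\<close> by auto
    have "norm (integral {0..1} (\<lambda>t. \<phi> t / (\<psi> t - z))) \<le> (A / (norm z - B)) * (1 - 0)"
    proof (rule integral_bound)
      show "continuous_on {0..1} (\<lambda>t. \<phi> t / (\<psi> t - z))"
        using nz0 by (intro continuous_intros \<phi> \<psi>) auto
      show "norm (\<phi> t / (\<psi> t - z)) \<le> A / (norm z - B)" if "t \<in> {0..1}" for t
        unfolding norm_divide using that A nz A0 \<open>norm z > B\<close> by (intro frac_le) auto
    qed auto
    then show ?thesis by simp
  qed
  show ?thesis
  proof (rule Lim_null_comparison)
    have "filterlim (\<lambda>z::complex. norm z - B) at_top at_infinity"
      using filterlim_tendsto_add_at_top[OF tendsto_const[of "- B"] filterlim_norm_at_top] by simp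
    then show "((\<lambda>z::complex. A / (norm z - B)) \<longlongrightarrow> 0) at_infinity"
      by (intro real_tendsto_divide_at_top[OF tendsto_const])
    show "\<forall>\<^sub>F z in at_infinity. norm (integral {0..1} (\<lambda>t. \<phi> t / (\<psi> t - z))) \<le> A / (norm z - B)"
      using b by (auto simp: eventually_at_infinity intro!: exI[of _ "B + 1"])
  qed
qed

lemma contour_integral_rectpath:
  assumes "Re a \<le> Re b" "Im a \<le> Im b" "continuous_on (path_image (rectpath a b)) f"
  shows "contour_integral (rectpath a b) f =
     contour_integral (linepath a (Complex (Re b) (Im a))) f + contour_integral (linepath (Complex (Re b) (Im a)) b) f +
     contour_integral (linepath b (Complex (Re a) (Im b))) f + contour_integral (linepath (Complex (Re a) (Im b)) a) f"
proof -
  let ?a2 = "Complex (Re b) (Im a)" and ?a4 = "Complex (Re a) (Im b)"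
  have im: "path_image (rectpath a b) = closed_segment a ?a2 \<union> (closed_segment ?a2 b \<union> (closed_segment b ?a4 \<union> closed_segment ?a4 a))"
    by (simp add: rectpath_def Let_def path_image_join)
  have "f contour_integrable_on linepath a ?a2" "f contour_integrable_on linepath ?a2 b"
    "f contour_integrable_on linepath b ?a4" "f contour_integrable_on linepath ?a4 a"
    by (intro contour_integrable_continuous_linepath continuous_on_subset[OF assms(3)]; use im in blast)+
  then show ?thesis
    by (simp add: rectpath_def Let_def contour_integrable_join valid_path_join)
qed

lemma bigo_imp_tendsto_0:
  fixes f g :: "'a \<Rightarrow> complex"
  assumes "f \<in> O[A](g)" "(g \<longlongrightarrow> 0) A"
  shows "(f \<longlongrightarrow> 0) A"
proof -
  obtain c where "\<forall>\<^sub>F x in A. norm (f x) \<le> c * norm (g x)" using landau_o.bigE[OF assms(1)] by blast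
  moreover have "((\<lambda>x. c * norm (g x)) \<longlongrightarrow> 0) A"
    using tendsto_mult[OF tendsto_const[of c] tendsto_norm[OF assms(2)]] by simp
  ultimately show ?thesis by (rule Lim_null_comparison)
qed

section \<open>The straightened contour\<close>

text \<open>
  A contour with its straightening map: \<open>F\<close> extends \<open>G\<close> to a neighbourhood of the unit interval, and \<open>qp\<close>
  and \<open>qm\<close> are \<open>q\<close> in the straightened coordinate, continued to the cut from above (the $+$ side) and
  from below (the $-$ side).
\<close>

locale straightened =
  fixes G :: "real \<Rightarrow> complex" and q :: "complex \<Rightarrow> complex" and F :: "complex \<Rightarrow> complex" and d :: real
    and qp qm :: "complex \<Rightarrow> complex"
  assumes contour: "Gamma_contour G q"
    and d_pos: "d > 0"
    and F_hol: "F holomorphic_on slab d"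
    and F_inj: "inj_on F (slab d)"
    and F_real: "\<And>t. - d < t \<Longrightarrow> t < 1 + d \<Longrightarrow> F (complex_of_real t) = G t"
    and F_deriv: "\<And>w. w \<in> slab d \<Longrightarrow> deriv F w \<noteq> 0"
    and qp_cont: "continuous_on (slab d \<inter> {w. Im w \<ge> 0}) qp"
    and qm_cont: "continuous_on (slab d \<inter> {w. Im w \<le> 0}) qm"
    and qp_eq: "\<And>w. w \<in> slab d - complex_of_real ` {0..1} \<Longrightarrow> Im w \<ge> 0 \<Longrightarrow> qp w = q (F w)"
    and qm_eq: "\<And>w. w \<in> slab d - complex_of_real ` {0..1} \<Longrightarrow> Im w \<le> 0 \<Longrightarrow> qm w = q (F w)"
    and qm_qp: "\<And>t. t \<in> {0..1} \<Longrightarrow> qm (complex_of_real t) = - qp (complex_of_real t)"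
    and qp_sq: "\<And>t. t \<in> {0..1} \<Longrightarrow> (qp (complex_of_real t))\<^sup>2 = Q (G t)"
    and qp_nz: "\<And>t. t \<in> {0<..<1} \<Longrightarrow> qp (complex_of_real t) \<noteq> 0"
begin

lemma G_inj: "inj G" and branch: "sqrt_Q_branch G q" and crit: "critical_trajectory G"
  and G_analytic: "analytic_curve_on UNIV G"
  using contour by (auto simp: Gamma_contour_def)

lemma path_image_G: "path_image G = G ` {0..1}" by (simp add: path_image_def)

lemma slab_01 [simp]: "t \<in> {0..1} \<Longrightarrow> complex_of_real t \<in> slab d"
  using d_pos by auto

lemma F_01: "t \<in> {0..1} \<Longrightarrow> F (complex_of_real t) = G t"
  using d_pos F_real by auto

lemma F_in_arc: "w \<in> slab d \<Longrightarrow> F w \<in> path_image G \<longleftrightarrow> w \<in> complex_of_real ` {0..1}"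
proof
  assume w: "w \<in> slab d" and "F w \<in> path_image G"
  then obtain t where t: "t \<in> {0..1}" "F w = F (complex_of_real t)" by (auto simp: path_image_G F_01)
  then have "w = complex_of_real t" using F_inj w by (auto simp: inj_on_def)
  then show "w \<in> complex_of_real ` {0..1}" using t by blast
qed (auto simp: path_image_G F_01)

lemma F_diff: "w \<in> slab d \<Longrightarrow> (F has_field_derivative deriv F w) (at w)"
  using F_hol open_slab holomorphic_derivI by blast

lemma dF_hol: "deriv F holomorphic_on slab d"
  using F_hol open_slab by (rule holomorphic_deriv)

lemma F_cont: "continuous_on (slab d) F" and dF_cont: "continuous_on (slab d) (deriv F)"
  using F_hol dF_hol by (auto intro: holomorphic_on_imp_continuous_on)

lemma G_continuous: "continuous_on {0..1} G"
proof -
  have "continuous_on {0..1} (\<lambda>t. F (complex_of_real t))"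
    by (rule continuous_on_compose2[OF F_cont]) (auto intro!: continuous_intros)
  then show ?thesis by (rule continuous_on_eq) (simp add: F_01)
qed

lemma closed_arc: "closed (path_image G)" and compact_arc: "compact (path_image G)"
  using G_continuous by (auto simp: path_image_G intro!: compact_imp_closed compact_continuous_image)

lemma q_hol: "q holomorphic_on - path_image G"
  using branch by (simp add: sqrt_Q_branch_def)

section \<open>The Cauchy transform of the density\<close>

text \<open>
  The density of the complex measure $\frac{1}{\pi i} q_+\,ds$ with respect to the parameter.
\<close>

definition dens :: "real \<Rightarrow> complex" where
  "dens t = 1 / (of_real pi * \<i>) * qp (complex_of_real t) * deriv F (complex_of_real t)"

lemma dens_cont: "continuous_on {0..1} dens"
  unfolding dens_def
  by (intro continuous_intros continuous_on_compose2[OF qp_cont] continuous_on_compose2[OF dF_cont]) auto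

definition cauchy_transform :: "complex \<Rightarrow> complex" where
  "cauchy_transform z = integral {0..1} (\<lambda>t. dens t / (z - G t))"

lemma cauchy_transform_alt: "cauchy_transform z = integral {0..1} (\<lambda>t. (- dens t) / (G t - z))"
proof -
  have "dens t / (z - G t) = - dens t / (G t - z)" for t
    by (metis minus_diff_eq minus_divide_divide)
  then show ?thesis by (simp only: cauchy_transform_def)
qed

lemma cauchy_transform_hol: "cauchy_transform holomorphic_on - path_image G"
  unfolding cauchy_transform_alt[abs_def] path_image_G
  by (rule cauchy_type_integral_holomorphic) (intro continuous_intros dens_cont G_continuous)+

lemma cauchy_transform_tendsto: "(cauchy_transform \<longlongrightarrow> 0) at_infinity"
  unfolding cauchy_transform_alt[abs_def]
  by (rule cauchy_type_integral_tendsto_0) (intro continuous_intros dens_cont G_continuous)+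

text \<open>
  Since $z/(z-s) = 1 + s/(z-s)$, the product is the total mass plus a Cauchy type integral, which
  vanishes at infinity.
\<close>

lemma cauchy_transform_asymp: "((\<lambda>z. z * cauchy_transform z) \<longlongrightarrow> integral {0..1} dens) at_infinity"
proof -
  have ev: "\<forall>\<^sub>F z in at_infinity. z \<notin> path_image G"
  proof -
    obtain B where "\<And>x. x \<in> path_image G \<Longrightarrow> norm x \<le> B"
      using compact_imp_bounded[OF compact_arc] unfolding bounded_iff by blast
    then have "z \<notin> path_image G" if "norm z \<ge> B + 1" for z using that by fastforce
    then show ?thesis unfolding eventually_at_infinity by blast
  qed
  have "((\<lambda>z. integral {0..1} dens + integral {0..1} (\<lambda>t. (- dens t * G t) / (G t - z))) \<longlongrightarrow> integral {0..1} dens + 0) at_infinity"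
    by (intro tendsto_intros cauchy_type_integral_tendsto_0 continuous_intros dens_cont G_continuous)
  then have "((\<lambda>z. z * cauchy_transform z) \<longlongrightarrow> integral {0..1} dens + 0) at_infinity"
  proof (rule Lim_transform_eventually)
    show "\<forall>\<^sub>F z in at_infinity. integral {0..1} dens + integral {0..1} (\<lambda>t. (- dens t * G t) / (G t - z)) = z * cauchy_transform z"
      using ev
    proof eventually_elim
      case (elim z)
      then have nz: "G t - z \<noteq> 0" "z - G t \<noteq> 0" if "t \<in> {0..1}" for t using that by (auto simp: path_image_G)
      have "z * cauchy_transform z = integral {0..1} (\<lambda>t. z * (dens t / (z - G t)))"
        unfolding cauchy_transform_def by (rule integral_mult_right[symmetric])
      also have "\<dots> = integral {0..1} (\<lambda>t. dens t + (- dens t * G t) / (G t - z))"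
        by (rule integral_cong) (use nz in \<open>auto simp: divide_simps\<close>, simp_all add: algebra_simps)
      also have "\<dots> = integral {0..1} dens + integral {0..1} (\<lambda>t. (- dens t * G t) / (G t - z))"
        by (rule integral_add; rule integrable_continuous_real; (rule dens_cont)?)
           (use nz in \<open>intro continuous_intros dens_cont G_continuous, auto\<close>)
      finally show ?case ..
    qed
  qed
  then show ?thesis by simp
qed

text \<open>
  The function $(w-w_0)F'(w)/(F(w)-F(w_0))$ has a removable singularity with value 1 at $w_0$. So the
  integral is that of \<open>p w / (w - w0)\<close> up to a factor that does not affect the residue. The rectangle
  may have a side on the cut, where \<open>p\<close> is merely continuous.
\<close>

lemma rect_inside:
  assumes sub: "cbox a b \<subseteq> slab d" and p: "continuous_on (cbox a b) p" "p holomorphic_on box a b"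
    and w0: "w0 \<in> box a b"
  shows "contour_integral (rectpath a b) (\<lambda>w. p w * deriv F w / (F w - F w0)) = 2 * pi * \<i> * p w0"
    and "continuous_on (path_image (rectpath a b)) (\<lambda>w. p w * deriv F w / (F w - F w0))"
proof -
  have w0': "w0 \<in> slab d" "w0 \<in> cbox a b" using w0 sub box_subset_cbox by blast+
  have ab: "Re a < Re b" "Im a < Im b" using w0 by (auto simp: in_box_complex_iff)
  define sl where "sl w = (if w = w0 then deriv F w0 else (F w - F w0) / (w - w0))" for w
  have sl_hol: "sl holomorphic_on slab d"
    unfolding sl_def by (intro pole_lemma_open F_hol open_slab)
  have sl_nz: "sl w \<noteq> 0" if "w \<in> slab d" for w
    using that F_deriv[OF w0'(1)] F_inj w0' by (auto simp: sl_def inj_on_def)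
  define f where "f w = p w * deriv F w / sl w" for w
  have pi: "path_image (rectpath a b) \<subseteq> cbox a b - {w0}"
    using path_image_rectpath_cbox_minus_box[of a b] ab w0 by auto
  have "((\<lambda>w. f w / (w - w0)) has_contour_integral (2*pi * \<i> * winding_number (rectpath a b) w0 * f w0)) (rectpath a b)"
  proof (rule Cauchy_integral_formula_weak[where S="cbox a b" and k="{}"])
    show "continuous_on (cbox a b) f"
      unfolding f_def using sl_nz sub
      by (intro continuous_intros p continuous_on_subset[OF dF_cont sub]
           continuous_on_subset[OF holomorphic_on_imp_continuous_on[OF sl_hol] sub]) blast
    have "f holomorphic_on box a b"
      unfolding f_def using sl_nz sub box_subset_cbox[of a b]
      by (intro holomorphic_intros p holomorphic_on_subset[OF dF_hol] holomorphic_on_subset[OF sl_hol]) blast+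
    then show "f field_differentiable at x" if "x \<in> interior (cbox a b) - {}" for x
      using that holomorphic_on_imp_differentiable_at[of f "box a b" x] by (simp add: interior_cbox open_box)
  qed (use w0 pi in \<open>auto simp: interior_cbox\<close>)
  then have "((\<lambda>w. p w * deriv F w / (F w - F w0)) has_contour_integral (2*pi * \<i> * winding_number (rectpath a b) w0 * f w0)) (rectpath a b)"
    by (rule has_contour_integral_eq) (use pi in \<open>auto simp: f_def sl_def\<close>)
  moreover have "winding_number (rectpath a b) w0 = 1" by (rule winding_number_rectpath[OF w0])
  moreover have "f w0 = p w0" using F_deriv[OF w0'(1)] by (simp add: f_def sl_def)
  ultimately show "contour_integral (rectpath a b) (\<lambda>w. p w * deriv F w / (F w - F w0)) = 2 * pi * \<i> * p w0"
    by (simp add: contour_integral_unique)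
  have "F w - F w0 \<noteq> 0" if "w \<in> cbox a b - {w0}" for w
    using that sub F_inj w0' by (auto simp: inj_on_def)
  then show "continuous_on (path_image (rectpath a b)) (\<lambda>w. p w * deriv F w / (F w - F w0))"
    using pi sub by (intro continuous_intros continuous_on_subset[OF p(1)] continuous_on_subset[OF dF_cont] continuous_on_subset[OF F_cont]) blast+
qed

lemma rect_outside:
  assumes sub: "cbox a b \<subseteq> slab d" and p: "continuous_on (cbox a b) p" "p holomorphic_on box a b"
    and w0: "w0 \<in> slab d - cbox a b" and ab: "Re a \<le> Re b" "Im a \<le> Im b"
  shows "contour_integral (rectpath a b) (\<lambda>w. p w * deriv F w / (F w - F w0)) = 0"
    and "continuous_on (path_image (rectpath a b)) (\<lambda>w. p w * deriv F w / (F w - F w0))"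
proof -
  have nz: "F w - F w0 \<noteq> 0" if "w \<in> cbox a b" for w
    using that sub F_inj w0 by (auto simp: inj_on_def)
  have pi: "path_image (rectpath a b) \<subseteq> cbox a b" by (rule path_image_rectpath_subset_cbox[OF ab])
  have c: "continuous_on (cbox a b) (\<lambda>w. p w * deriv F w / (F w - F w0))"
    using nz by (intro continuous_intros p continuous_on_subset[OF dF_cont sub] continuous_on_subset[OF F_cont sub]) auto
  then show "continuous_on (path_image (rectpath a b)) (\<lambda>w. p w * deriv F w / (F w - F w0))"
    using pi by (rule continuous_on_subset)
  have "(\<lambda>w. p w * deriv F w / (F w - F w0)) holomorphic_on box a b"
    using nz sub box_subset_cbox[of a b]
    by (intro holomorphic_intros p holomorphic_on_subset[OF dF_hol] holomorphic_on_subset[OF F_hol]) blast+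
  then have "((\<lambda>w. p w * deriv F w / (F w - F w0)) has_contour_integral 0) (rectpath a b)"
    using pi holomorphic_on_imp_differentiable_at[of _ "box a b"]
    by (intro Cauchy_theorem_convex[where S="cbox a b" and K="{}"] c) (auto simp: interior_cbox open_box)
  then show "contour_integral (rectpath a b) (\<lambda>w. p w * deriv F w / (F w - F w0)) = 0"
    by (rule contour_integral_unique)
qed

definition seg_int :: "(complex \<Rightarrow> complex) \<Rightarrow> complex \<Rightarrow> complex \<Rightarrow> complex \<Rightarrow> complex" where
  "seg_int p a b z = contour_integral (linepath a b) (\<lambda>w. p w * deriv F w / (F w - z))"

lemma seg_int_hol:
  assumes sub: "closed_segment a b \<subseteq> slab d" and p: "continuous_on (closed_segment a b) p"
  shows "seg_int p a b holomorphic_on - F ` closed_segment a b"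
proof -
  let ?l = "linepath a b"
  have eq: "seg_int p a b z = integral {0..1} (\<lambda>t. (p (?l t) * deriv F (?l t) * (b - a)) / (F (?l t) - z))" for z
    unfolding seg_int_def contour_integral_integral by (simp add: mult_ac)
  have l: "?l ` {0..1} \<subseteq> closed_segment a b" by (simp add: linepath_image_01)
  have "(\<lambda>z. integral {0..1} (\<lambda>t. (p (?l t) * deriv F (?l t) * (b - a)) / (F (?l t) - z))) holomorphic_on - (\<lambda>t. F (?l t)) ` {0..1}"
    using l sub
    by (intro cauchy_type_integral_holomorphic continuous_intros continuous_on_compose2[OF p]
          continuous_on_compose2[OF F_cont] continuous_on_compose2[OF dF_cont]) auto
  moreover have "(\<lambda>t. F (?l t)) ` {0..1} = F ` closed_segment a b"
    by (simp add: linepath_image_01[symmetric] image_image)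
  ultimately show ?thesis unfolding eq[abs_def] by simp
qed

abbreviation (input) "corner_a \<equiv> Complex (- d / 2) (- d / 2)"
abbreviation (input) "corner_b \<equiv> Complex (1 + d / 2) (d / 2)"
abbreviation (input) "mid_a \<equiv> Complex (- d / 2) 0"
abbreviation (input) "mid_b \<equiv> Complex (1 + d / 2) 0"

text \<open>
  A rectangle around the unit interval. The real axis divides it into the two half rectangles
  to which Cauchy's formula will be applied.
\<close>

definition core :: "complex set" where "core = box corner_a corner_b"

lemma core_subset: "core \<subseteq> slab d" and cbox_subset_slab: "cbox corner_a corner_b \<subseteq> slab d"
  and open_core: "open core"
  using d_pos by (auto simp: core_def slab_def in_box_complex_iff in_cbox_complex_iff open_box)

lemma arc_in_core: "t \<in> {0..1} \<Longrightarrow> complex_of_real t \<in> core"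
  using d_pos by (auto simp: core_def in_box_complex_iff)

text \<open>
  The integrals over the six sides of the two half rectangles that do not lie on the real axis.
\<close>

definition outer :: "complex \<Rightarrow> complex" where
  "outer z = seg_int qp mid_b corner_b z + seg_int qp corner_b (Complex (- d / 2) (d / 2)) z
     + seg_int qp (Complex (- d / 2) (d / 2)) mid_a z
     + seg_int qm corner_a (Complex (1 + d / 2) (- d / 2)) z + seg_int qm (Complex (1 + d / 2) (- d / 2)) mid_b z
     + seg_int qm mid_a corner_a z"

lemma qp_hol: "qp holomorphic_on slab d \<inter> {w. Im w > 0}"
proof (rule holomorphic_transform)
  show "(\<lambda>w. q (F w)) holomorphic_on slab d \<inter> {w. Im w > 0}"
    by (intro holomorphic_on_compose_gen[OF _ q_hol, unfolded o_def] holomorphic_on_subset[OF F_hol])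
       (auto simp: F_in_arc)
  show "\<And>w. w \<in> slab d \<inter> {w. Im w > 0} \<Longrightarrow> q (F w) = qp w"
    by (subst qp_eq) auto
qed

lemma qm_hol: "qm holomorphic_on slab d \<inter> {w. Im w < 0}"
proof (rule holomorphic_transform)
  show "(\<lambda>w. q (F w)) holomorphic_on slab d \<inter> {w. Im w < 0}"
    by (intro holomorphic_on_compose_gen[OF _ q_hol, unfolded o_def] holomorphic_on_subset[OF F_hol])
       (auto simp: F_in_arc)
  show "\<And>w. w \<in> slab d \<inter> {w. Im w < 0} \<Longrightarrow> q (F w) = qm w"
    by (subst qm_eq) auto
qed

lemma outer_hol: "outer holomorphic_on F ` core"
proof -
  have *: "seg_int p a b holomorphic_on F ` core"
    if ab: "a \<in> cbox corner_a corner_b" "b \<in> cbox corner_a corner_b"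
      and out: "\<And>w. w \<in> closed_segment a b \<Longrightarrow> w \<notin> core" and p: "continuous_on (closed_segment a b) p"
    for a b p
  proof (rule holomorphic_on_subset[OF seg_int_hol[OF _ p]])
    have cs: "closed_segment a b \<subseteq> cbox corner_a corner_b"
      by (rule closed_segment_subset[OF ab]) simp
    then show "closed_segment a b \<subseteq> slab d" using cbox_subset_slab by blast
    then have ne: "F w \<noteq> F v" if wv: "w \<in> core" "v \<in> closed_segment a b" for w v
      using inj_onD[OF F_inj, of w v] out[OF wv(2)] wv core_subset by blast
    show "F ` core \<subseteq> - F ` closed_segment a b"
    proof (intro subsetI ComplI)
      fix z assume "z \<in> F ` core" "z \<in> F ` closed_segment a b"
      then obtain w v where "w \<in> core" "z = F w" "v \<in> closed_segment a b" "z = F v" by (elim imageE) simp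
      then show False using ne[of w v] by simp
    qed
  qed
  have cp: "continuous_on (closed_segment a b) qp"
    if "a \<in> cbox mid_a corner_b" "b \<in> cbox mid_a corner_b" for a b
  proof (rule continuous_on_subset[OF qp_cont])
    have "closed_segment a b \<subseteq> cbox mid_a corner_b"
      by (rule closed_segment_subset[OF that]) simp
    also have "\<dots> \<subseteq> slab d \<inter> {w. Im w \<ge> 0}"
      using d_pos by (auto simp: slab_def in_cbox_complex_iff)
    finally show "closed_segment a b \<subseteq> slab d \<inter> {w. Im w \<ge> 0}" .
  qed
  have cm: "continuous_on (closed_segment a b) qm"
    if "a \<in> cbox corner_a mid_b" "b \<in> cbox corner_a mid_b" for a b
  proof (rule continuous_on_subset[OF qm_cont])
    have "closed_segment a b \<subseteq> cbox corner_a mid_b"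
      by (rule closed_segment_subset[OF that]) simp
    also have "\<dots> \<subseteq> slab d \<inter> {w. Im w \<le> 0}"
      using d_pos by (auto simp: slab_def in_cbox_complex_iff)
    finally show "closed_segment a b \<subseteq> slab d \<inter> {w. Im w \<le> 0}" .
  qed
  show ?thesis
    unfolding outer_def
    by (intro holomorphic_on_add * cp cm)
       (use d_pos in \<open>auto simp: in_cbox_complex_iff core_def in_box_complex_iff closed_segment_same_Re closed_segment_same_Im\<close>)
qed

text \<open>
  The two half rectangles are traversed in opposite directions along the real axis. Outside the unit
  interval \<open>qp\<close> and \<open>qm\<close> agree and the integrands cancel; on it their difference is \<open>2 * qp\<close>.
\<close>

lemma middle_integral:
  assumes w0: "w0 \<in> slab d" "Im w0 \<noteq> 0"
  shows "seg_int qp mid_a mid_b (F w0) + seg_int qm mid_b mid_a (F w0) = - (2 * pi * \<i> * cauchy_transform (F w0))"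
proof -
  let ?K = "\<lambda>p w. p w * deriv F w / (F w - F w0)"
  have mids: "mid_a = complex_of_real (- d / 2)" "mid_b = complex_of_real (1 + d / 2)" by (auto simp: complex_eq_iff)
  have seg: "closed_segment mid_a mid_b \<subseteq> slab d \<inter> {w. Im w = 0}"
    using d_pos by (auto simp: slab_def closed_segment_same_Im closed_segment_eq_real_ivl)
  have nz: "F w - F w0 \<noteq> 0" if "w \<in> closed_segment mid_a mid_b" for w
    using that seg w0 F_inj by (auto simp: inj_on_def)
  have cont: "continuous_on (closed_segment mid_a mid_b) (?K qp)" "continuous_on (closed_segment mid_a mid_b) (?K qm)"
    using seg nz by (intro continuous_intros continuous_on_subset[OF qp_cont] continuous_on_subset[OF qm_cont]
        continuous_on_subset[OF dF_cont] continuous_on_subset[OF F_cont]; force)+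
  have int: "?K qp contour_integrable_on linepath mid_a mid_b" "?K qm contour_integrable_on linepath mid_a mid_b"
    using cont by (auto intro: contour_integrable_continuous_linepath)
  have "seg_int qp mid_a mid_b (F w0) + seg_int qm mid_b mid_a (F w0) =
      contour_integral (linepath mid_a mid_b) (?K qp) - contour_integral (linepath mid_a mid_b) (?K qm)"
    unfolding seg_int_def contour_integral_reverse_linepath[OF cont(2)] by simp
  also have "\<dots> = contour_integral (linepath mid_a mid_b) (\<lambda>w. ?K qp w - ?K qm w)"
    using contour_integral_diff[OF int] by simp
  also have "\<dots> = integral {- d / 2..1 + d / 2} (\<lambda>t. ?K qp (complex_of_real t) - ?K qm (complex_of_real t))"
    using d_pos by (subst contour_integral_linepath_Reals_eq) (auto simp: complex_is_Real_iff)
  also have "\<dots> = integral {- d / 2..1 + d / 2} (\<lambda>t. if t \<in> {0..1} then - (2 * pi * \<i>) * (dens t / (F w0 - G t)) else 0)"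
  proof (rule integral_cong)
    fix t assume t: "t \<in> {- d / 2..1 + d / 2}"
    show "?K qp (complex_of_real t) - ?K qm (complex_of_real t) = (if t \<in> {0..1} then - (2 * pi * \<i>) * (dens t / (F w0 - G t)) else 0)"
    proof (cases "t \<in> {0..1}")
      case True
      have gnz: "G t - F w0 \<noteq> 0" "F w0 - G t \<noteq> 0"
        using nz[of "complex_of_real t"] True d_pos mids F_01[OF True]
        by (auto simp: closed_segment_same_Im closed_segment_eq_real_ivl)
      have "?K qp (complex_of_real t) - ?K qm (complex_of_real t) = 2 * qp (complex_of_real t) * deriv F (complex_of_real t) / (G t - F w0)"
        using True by (simp add: qm_qp F_01 add_divide_distrib[symmetric])
      also have "\<dots> = - (2 * pi * \<i>) * (dens t / (F w0 - G t))"
        using gnz by (simp add: dens_def field_simps)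
      finally show ?thesis using True by simp
    next
      case False
      have "complex_of_real t \<in> slab d - complex_of_real ` {0..1}" using t False d_pos by auto
      then show ?thesis
        unfolding if_not_P[OF False] using qp_eq[of "complex_of_real t"] qm_eq[of "complex_of_real t"] by simp
    qed
  qed
  also have "\<dots> = integral {0..1} (\<lambda>t. - (2 * pi * \<i>) * (dens t / (F w0 - G t)))"
  proof -
    have "{- d / 2..1 + d / 2} \<inter> {0..1} = {0..1}" using d_pos by auto
    then show ?thesis
      using integral_restrict_Int[of "{- d / 2..1 + d / 2}" "{0..1}" "\<lambda>t. - (2 * pi * \<i>) * (dens t / (F w0 - G t))"]
      by (simp add: Int_commute)
  qed
  also have "\<dots> = - (2 * pi * \<i>) * integral {0..1} (\<lambda>t. dens t / (F w0 - G t))"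
    by (rule integral_mult_right)
  finally show ?thesis by (simp add: cauchy_transform_def)
qed

text \<open>
  Apply Cauchy's formula to both half rectangles and add. One of them contains \<open>w0\<close> and contributes the
  value of \<open>q\<close>; the other one contributes 0.
\<close>

lemma jump_relation:
  assumes w0: "w0 \<in> core" "Im w0 \<noteq> 0"
  shows "2 * pi * \<i> * (q (F w0) + cauchy_transform (F w0)) = outer (F w0)"
proof -
  have w0s: "w0 \<in> slab d" using w0 core_subset by blast
  let ?K = "\<lambda>p w. p w * deriv F w / (F w - F w0)"
  have upsub: "cbox mid_a corner_b \<subseteq> slab d \<inter> {w. Im w \<ge> 0}" "box mid_a corner_b \<subseteq> slab d \<inter> {w. Im w > 0}"
    and losub: "cbox corner_a mid_b \<subseteq> slab d \<inter> {w. Im w \<le> 0}" "box corner_a mid_b \<subseteq> slab d \<inter> {w. Im w < 0}"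
    using d_pos by (auto simp: slab_def in_cbox_complex_iff in_box_complex_iff)
  have up: "cbox mid_a corner_b \<subseteq> slab d" "continuous_on (cbox mid_a corner_b) qp" "qp holomorphic_on box mid_a corner_b"
    and lo: "cbox corner_a mid_b \<subseteq> slab d" "continuous_on (cbox corner_a mid_b) qm" "qm holomorphic_on box corner_a mid_b"
    using upsub losub continuous_on_subset[OF qp_cont] continuous_on_subset[OF qm_cont]
      holomorphic_on_subset[OF qp_hol] holomorphic_on_subset[OF qm_hol] by blast+
  have notarc: "w0 \<in> slab d - complex_of_real ` {0..1}" using w0 w0s by auto
  have total: "contour_integral (rectpath mid_a corner_b) (?K qp) + contour_integral (rectpath corner_a mid_b) (?K qm)
      = 2 * pi * \<i> * q (F w0) \<and> continuous_on (path_image (rectpath mid_a corner_b)) (?K qp)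
      \<and> continuous_on (path_image (rectpath corner_a mid_b)) (?K qm)"
  proof (cases "Im w0 > 0")
    case True
    then have i: "w0 \<in> box mid_a corner_b" and o: "w0 \<in> slab d - cbox corner_a mid_b"
      using w0 w0s by (auto simp: core_def in_box_complex_iff in_cbox_complex_iff)
    have "qp w0 = q (F w0)" using qp_eq[OF notarc] True by simp
    then show ?thesis using rect_inside[OF up i] rect_outside[OF lo o] d_pos by simp
  next
    case False
    then have i: "w0 \<in> box corner_a mid_b" and o: "w0 \<in> slab d - cbox mid_a corner_b"
      using w0 w0s by (auto simp: core_def in_box_complex_iff in_cbox_complex_iff)
    have "qm w0 = q (F w0)" using qm_eq[OF notarc] False by simp
    then show ?thesis using rect_inside[OF lo i] rect_outside[OF up o] d_pos by simp
  qed
  have u: "contour_integral (rectpath mid_a corner_b) (?K qp) = seg_int qp mid_a mid_b (F w0) + seg_int qp mid_b corner_b (F w0)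
     + seg_int qp corner_b (Complex (- d / 2) (d / 2)) (F w0) + seg_int qp (Complex (- d / 2) (d / 2)) mid_a (F w0)"
    using contour_integral_rectpath[of mid_a corner_b "?K qp"] total d_pos
    unfolding seg_int_def by (simp only: complex.sel)
  have l: "contour_integral (rectpath corner_a mid_b) (?K qm) = seg_int qm corner_a (Complex (1 + d / 2) (- d / 2)) (F w0)
     + seg_int qm (Complex (1 + d / 2) (- d / 2)) mid_b (F w0) + seg_int qm mid_b mid_a (F w0) + seg_int qm mid_a corner_a (F w0)"
    using contour_integral_rectpath[of corner_a mid_b "?K qm"] total d_pos
    unfolding seg_int_def by (simp only: complex.sel)
  have "2 * pi * \<i> * q (F w0) = outer (F w0) + (seg_int qp mid_a mid_b (F w0) + seg_int qm mid_b mid_a (F w0))"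
    unfolding conjunct1[OF total, symmetric] u l outer_def by (simp only: add_ac)
  then show ?thesis unfolding middle_integral[OF w0s w0(2)] by (simp add: algebra_simps)
qed

text \<open>
  The points of the real axis next to the unit interval follow by continuity.
\<close>

lemma jump_relation_off_arc:
  assumes w0: "w0 \<in> core - complex_of_real ` {0..1}"
  shows "2 * pi * \<i> * (q (F w0) + cauchy_transform (F w0)) = outer (F w0)"
proof (cases "Im w0 = 0")
  case False
  then show ?thesis using jump_relation w0 by simp
next
  case True
  then have w0r: "w0 = complex_of_real (Re w0)" by (simp add: complex_eq_iff)
  let ?A = "core - complex_of_real ` {0..1}"
  have arc: "F w \<in> - path_image G" if "w \<in> ?A" for w using that core_subset F_in_arc by blast
  have c1: "continuous_on ?A (\<lambda>w. 2 * pi * \<i> * (q (F w) + cauchy_transform (F w)))"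
    using core_subset arc
    by (intro continuous_intros continuous_on_compose2[OF holomorphic_on_imp_continuous_on[OF q_hol]]
          continuous_on_compose2[OF holomorphic_on_imp_continuous_on[OF cauchy_transform_hol]]
          continuous_on_subset[OF F_cont]) blast+
  have c2: "continuous_on core (\<lambda>w. outer (F w))"
    by (intro continuous_on_compose2[OF holomorphic_on_imp_continuous_on[OF outer_hol]] continuous_on_subset[OF F_cont] core_subset) blast
  have near: "\<forall>\<^sub>F h in at_right 0. 0 < h \<and> h < d / 2"
    using d_pos by (auto simp: eventually_at_right_field intro!: exI[of _ "d / 2"])
  show ?thesis
  proof (subst (1 2 3) w0r, rule eq_by_vertical_limit[OF c1 c2, where s=1])
    show "complex_of_real (Re w0) \<in> ?A" "complex_of_real (Re w0) \<in> core" using w0 w0r by auto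
    show "\<forall>\<^sub>F h in at_right 0. Complex (Re w0) (1 * h) \<in> ?A \<inter> core \<and>
      2 * pi * \<i> * (q (F (Complex (Re w0) (1 * h))) + cauchy_transform (F (Complex (Re w0) (1 * h)))) = outer (F (Complex (Re w0) (1 * h)))"
      using near
    proof eventually_elim
      case (elim h)
      have "Complex (Re w0) h \<in> core" using elim w0 by (auto simp: core_def in_box_complex_iff)
      then show ?case using elim jump_relation[of "Complex (Re w0) h"] by (auto simp: complex_eq_iff)
    qed
  qed
qed

lemma open_F_core: "open (F ` core)"
  using F_hol F_inj core_subset open_core
  by (intro open_mapping_thm3[of F core]) (auto intro: holomorphic_on_subset inj_on_subset)

text \<open>
  The right-hand side of the jump relation is holomorphic across the arc, so
  $q + h + \frac{i}{2} z^2$ extends to an entire function. It vanishes at infinity, hence identically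
  by Liouville's theorem.
\<close>

theorem cauchy_transform_eq:
  assumes z: "z \<notin> path_image G"
  shows "cauchy_transform z = - (\<i> / 2) * z\<^sup>2 - q z"
proof -
  define A where "A z = outer z / (2 * pi * \<i>) + (\<i> / 2) * z\<^sup>2" for z
  define B where "B z = q z + cauchy_transform z + (\<i> / 2) * z\<^sup>2" for z
  have AB: "A z = B z" if z: "z \<in> F ` core" "z \<in> - path_image G" for z
  proof -
    obtain w where w: "w \<in> core" "z = F w" using z by blast
    then have "w \<notin> complex_of_real ` {0..1}" using z F_in_arc core_subset by blast
    then have "outer z = 2 * pi * \<i> * (q z + cauchy_transform z)" using jump_relation_off_arc[of w] w by simp
    then show ?thesis by (simp add: A_def B_def)
  qed
  have "(\<lambda>z. if z \<in> F ` core then A z else B z) holomorphic_on F ` core \<union> (- path_image G)"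
  proof (rule holomorphic_on_If_Un[OF _ _ open_F_core _ AB])
    show "A holomorphic_on F ` core" unfolding A_def by (intro holomorphic_intros outer_hol) auto
    show "B holomorphic_on - path_image G" unfolding B_def by (intro holomorphic_intros q_hol cauchy_transform_hol)
  qed (use closed_arc in auto)
  moreover have "F ` core \<union> (- path_image G) = UNIV"
    using arc_in_core F_01 by (auto simp: path_image_G) (metis F_01 arc_in_core atLeastAtMost_iff image_eqI)
  ultimately have hol: "(\<lambda>z. if z \<in> F ` core then A z else B z) holomorphic_on UNIV" by simp
  have ev: "\<forall>\<^sub>F z in at_infinity. z \<notin> F ` core"
  proof -
    have "bounded (F ` cbox corner_a corner_b)"
      by (intro compact_imp_bounded compact_continuous_image continuous_on_subset[OF F_cont cbox_subset_slab] compact_cbox)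
    then obtain M where M: "\<And>x. x \<in> F ` cbox corner_a corner_b \<Longrightarrow> norm x \<le> M" unfolding bounded_iff by blast
    have "core \<subseteq> cbox corner_a corner_b" unfolding core_def by (rule box_subset_cbox)
    with M have "z \<notin> F ` core" if "norm z \<ge> M + 1" for z using that by fastforce
    then show ?thesis unfolding eventually_at_infinity by blast
  qed
  have "(B \<longlongrightarrow> 0) at_infinity"
  proof -
    have "(\<lambda>z. q z - (- (1 / 2) * \<i> * z ^ 2 - 1 / z)) \<in> O[at_infinity](\<lambda>z. 1 / z ^ 2)"
      using branch by (simp add: sqrt_Q_branch_def)
    moreover have "((\<lambda>z::complex. 1 / z ^ 2) \<longlongrightarrow> 0) at_infinity"
      by (intro tendsto_divide_0[OF tendsto_const] filterlim_power_at_infinity filterlim_ident) auto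
    ultimately have l: "((\<lambda>z. q z - (- (1 / 2) * \<i> * z ^ 2 - 1 / z)) \<longlongrightarrow> 0) at_infinity"
      by (rule bigo_imp_tendsto_0)
    have "((\<lambda>z::complex. 1 / z) \<longlongrightarrow> 0) at_infinity"
      by (intro tendsto_divide_0[OF tendsto_const] filterlim_ident)
    note tendsto_add[OF tendsto_diff[OF l this] cauchy_transform_tendsto]
    then have lim: "((\<lambda>z. q z - (- (1 / 2) * \<i> * z\<^sup>2 - 1 / z) - 1 / z + cauchy_transform z) \<longlongrightarrow> 0) at_infinity" by simp
    have "B = (\<lambda>z. q z - (- (1 / 2) * \<i> * z\<^sup>2 - 1 / z) - 1 / z + cauchy_transform z)"
    proof
      have "a + c + \<i> / 2 * s = a - (- (1 / 2) * \<i> * s - x) - x + c" for a c s x :: complex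
        by (simp add: algebra_simps)
      then show "B z = q z - (- (1 / 2) * \<i> * z\<^sup>2 - 1 / z) - 1 / z + cauchy_transform z" for z
        unfolding B_def .
    qed
    with lim show ?thesis by simp
  qed
  then have "((\<lambda>z. if z \<in> F ` core then A z else B z) \<longlongrightarrow> 0) at_infinity"
    by (rule Lim_transform_eventually) (rule eventually_mono[OF ev], simp)
  then have E0: "(if z \<in> F ` core then A z else B z) = 0" by (rule Liouville_weak_0[OF hol])
  have "B z = 0"
  proof (cases "z \<in> F ` core")
    case True
    then show ?thesis using E0 AB[OF True] z by simp
  next
    case False
    then show ?thesis using E0 by simp
  qed
  moreover have "cauchy_transform z = B z - (\<i> / 2) * z\<^sup>2 - q z" unfolding B_def by simp
  ultimately show ?thesis by simp
qed

text \<open>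
  The limit of $z\,h(z)$ at infinity, once by the definition of $h$ and once by the expansion of $q$.
\<close>

theorem total_mass: "integral {0..1} dens = 1"
proof -
  have "(\<lambda>z. q z - (- (1 / 2) * \<i> * z ^ 2 - 1 / z)) \<in> O[at_infinity](\<lambda>z. 1 / z ^ 2)"
    using branch by (simp add: sqrt_Q_branch_def)
  then have "(\<lambda>z. z * (q z - (- (1 / 2) * \<i> * z ^ 2 - 1 / z))) \<in> O[at_infinity](\<lambda>z. z * (1 / z ^ 2))"
    by (intro landau_o.big.mult landau_o.big_refl)
  moreover have "((\<lambda>z::complex. z * (1 / z ^ 2)) \<longlongrightarrow> 0) at_infinity"
  proof -
    have "((\<lambda>z::complex. 1 / z) \<longlongrightarrow> 0) at_infinity"
      by (intro tendsto_divide_0[OF tendsto_const] filterlim_ident)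
    moreover have "z * (1 / z ^ 2) = 1 / z" for z :: complex by (cases "z = 0") (auto simp: power2_eq_square)
    ultimately show ?thesis by (simp only:)
  qed
  ultimately have l: "((\<lambda>z. z * (q z - (- (1 / 2) * \<i> * z ^ 2 - 1 / z))) \<longlongrightarrow> 0) at_infinity"
    by (rule bigo_imp_tendsto_0)
  have "\<forall>\<^sub>F z in at_infinity. z \<noteq> 0 \<and> z \<notin> path_image G"
  proof -
    obtain M where M: "\<And>x. x \<in> path_image G \<Longrightarrow> norm x \<le> M"
      using compact_imp_bounded[OF compact_arc] unfolding bounded_iff by blast
    have "z \<noteq> 0 \<and> z \<notin> path_image G" if "norm z \<ge> \<bar>M\<bar> + 1" for z using that M[of z] by auto
    then show ?thesis unfolding eventually_at_infinity by blast
  qed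
  then have "\<forall>\<^sub>F z in at_infinity. 1 - z * (q z - (- (1 / 2) * \<i> * z ^ 2 - 1 / z)) = z * cauchy_transform z"
  proof eventually_elim
    case (elim z)
    then show ?case by (subst cauchy_transform_eq) (auto simp: field_simps)
  qed
  with tendsto_diff[OF tendsto_const[of 1] l] have "((\<lambda>z. z * cauchy_transform z) \<longlongrightarrow> 1 - 0) at_infinity"
    by (rule Lim_transform_eventually)
  from tendsto_unique[OF trivial_limit_at_infinity cauchy_transform_asymp this] show ?thesis by simp
qed

lemma G_01: "G 0 = z1" "G 1 = z2"
  using crit by (auto simp: critical_trajectory_def pathstart_def pathfinish_def)

lemma G_vderiv:
  assumes "- d < t" "t < 1 + d"
  shows "(G has_vector_derivative deriv F (complex_of_real t)) (at t)"
proof (rule has_vector_derivative_transform_within_open[of "\<lambda>t. F (complex_of_real t)" _ _ "{- d<..<1 + d}"])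
  show "((\<lambda>t. F (complex_of_real t)) has_vector_derivative deriv F (complex_of_real t)) (at t)"
    by (rule has_vector_derivative_real_field[OF F_diff]) (use assms d_pos in simp)
qed (use assms F_real in auto)

lemma G_vderiv_at: "t \<in> {0..1} \<Longrightarrow> vector_derivative G (at t) = deriv F (complex_of_real t)"
  by (rule vector_derivative_at[OF G_vderiv]) (use d_pos in auto)

lemma dF_cont_real: "continuous_on {0..1} (\<lambda>t. deriv F (complex_of_real t))"
  by (rule continuous_on_compose2[OF dF_cont]) (auto intro!: continuous_intros)

lemma qp_cont_real: "continuous_on {0..1} (\<lambda>t. qp (complex_of_real t))"
  by (rule continuous_on_compose2[OF qp_cont]) (auto intro!: continuous_intros)

lemma valid_path_G: "valid_path G"
proof -
  have "G differentiable at t" if "t \<in> {0..1}" for t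
    using G_vderiv[of t] that d_pos differentiableI_vector by fastforce
  moreover have "continuous_on {0..1} (\<lambda>t. vector_derivative G (at t))"
    by (rule continuous_on_eq[OF dF_cont_real]) (simp add: G_vderiv_at)
  ultimately have "G C1_differentiable_on {0..1}" by (simp add: C1_differentiable_on_eq)
  then show ?thesis unfolding valid_path_def by (rule C1_differentiable_imp_piecewise)
qed

lemma qp_end: "qp 0 = 0" "qp 1 = 0"
proof -
  have Q0: "Q z1 = 0" "Q z2 = 0"
    by (simp_all add: Q_def z1_def z2_def power2_eq_square algebra_simps flip: of_real_mult)
  show "qp 0 = 0" "qp 1 = 0"
    using qp_sq[of 0] qp_sq[of 1] by (simp_all add: G_01 Q0)
qed

section \<open>The density is real and positive\<close>

definition \<rho> :: "real \<Rightarrow> real" where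
  "\<rho> t = Re (dens t)"

text \<open>
  The branch \<open>r\<close> of the trajectory condition is \<open>qp\<close> or \<open>- qp\<close>. Since the integrals of
  $\frac{1}{\pi i} r$ along the arc are real for all end points, so is their derivative.
\<close>

lemma dens_real: "t \<in> {0..1} \<Longrightarrow> dens t = complex_of_real (\<rho> t)"
proof (cases "t \<in> {0<..<1}")
  case False
  assume "t \<in> {0..1}"
  with False have "t = 0 \<or> t = 1" by auto
  then show ?thesis using qp_end by (auto simp: \<rho>_def dens_def)
next
  case t: True
  obtain r where r: "continuous_on (path_image G) r" "\<And>s. s \<in> path_image G \<Longrightarrow> r s ^ 2 = Q s"
    "\<And>t. t \<in> {0..1} \<Longrightarrow> 1 / (of_real pi * \<i>) * contour_integral (subpath 0 t G) r \<in> \<real>"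
    using crit unfolding critical_trajectory_def by blast
  have rG: "continuous_on {0..1} (\<lambda>t. r (G t))"
    by (rule continuous_on_compose2[OF r(1) G_continuous]) (auto simp: path_image_G)
  obtain c where c: "c = 1 \<or> c = -1" "\<And>t. t \<in> {0<..<1} \<Longrightarrow> r (G t) = c * qp (complex_of_real t)"
  proof (rule eq_up_to_sign[of "{0<..<1}" "\<lambda>t. r (G t)" "\<lambda>t. qp (complex_of_real t)"])
    show "continuous_on {0<..<1} (\<lambda>t. r (G t))" by (rule continuous_on_subset[OF rG]) auto
    show "continuous_on {0<..<1} (\<lambda>t. qp (complex_of_real t))" by (rule continuous_on_subset[OF qp_cont_real]) auto
    show "(r (G t))\<^sup>2 = (qp (complex_of_real t))\<^sup>2" if "t \<in> {0<..<1}" for t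
      using that r(2)[of "G t"] qp_sq[of t] by (auto simp: path_image_G)
  qed (use qp_nz in auto)
  define k where "k t = 1 / (of_real pi * \<i>) * (r (G t) * deriv F (complex_of_real t))" for t
  have kc: "continuous_on {0..1} k" unfolding k_def by (intro continuous_intros rG dF_cont_real)
  have ci: "r contour_integrable_on G"
    unfolding contour_integrable_on
  proof (rule integrable_continuous_real)
    show "continuous_on {0..1} (\<lambda>t. r (G t) * vector_derivative G (at t))"
      by (rule continuous_on_eq[of _ "\<lambda>t. r (G t) * deriv F (complex_of_real t)"])
         (auto intro!: continuous_intros rG dF_cont_real simp: G_vderiv_at)
  qed
  have im: "Im (integral {0..x} k) = 0" if x: "x \<in> {0..1}" for x
  proof -
    have "contour_integral (subpath 0 x G) r = integral {0..x} (\<lambda>t. r (G t) * vector_derivative G (at t))"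
      by (rule contour_integral_subcontour_integral[OF ci valid_path_G]) (use x in auto)
    also have "\<dots> = integral {0..x} (\<lambda>t. r (G t) * deriv F (complex_of_real t))"
      by (rule integral_cong) (use x in \<open>auto simp: G_vderiv_at\<close>)
    finally have "1 / (of_real pi * \<i>) * contour_integral (subpath 0 x G) r = integral {0..x} k"
      unfolding k_def by (simp only: integral_mult_right)
    then show ?thesis using r(3)[OF x] by (simp only: complex_is_Real_iff)
  qed
  have "((\<lambda>x. integral {0..x} k) has_vector_derivative k t) (at t within {0..1})"
    by (rule integral_has_vector_derivative[OF kc]) (use t in auto)
  then have "((\<lambda>x. integral {0..x} k) has_vector_derivative k t) (at t within {0<..<1})"
    by (rule has_vector_derivative_within_subset) auto
  then have "((\<lambda>x. Im (integral {0..x} k)) has_vector_derivative Im (k t)) (at t within {0<..<1})"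
    by (rule bounded_linear.has_vector_derivative[OF bounded_linear_Im])
  then have "((\<lambda>x. Im (integral {0..x} k)) has_vector_derivative Im (k t)) (at t)"
    using t by (simp add: at_within_open[of t "{0<..<1}"])
  moreover have "((\<lambda>x. Im (integral {0..x} k)) has_vector_derivative 0) (at t)"
    by (rule has_vector_derivative_transform_within_open[of "\<lambda>_. 0" _ _ "{0<..<1}"]) (use t im in auto)
  ultimately have "Im (k t) = 0" by (rule vector_derivative_unique_at)
  moreover have "dens t = c * k t"
    using c t by (auto simp: dens_def k_def)
  ultimately have "Im (dens t) = 0" using c(1) by auto
  then show ?thesis by (simp add: \<rho>_def complex_eq_iff)
qed

lemma rho_cont: "continuous_on {0..1} \<rho>"
  unfolding \<rho>_def by (intro continuous_intros dens_cont)

lemma rho_integral: "integral {0..1} \<rho> = 1"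
proof -
  have "(dens has_integral 1) {0..1}"
    using total_mass integrable_continuous_real[OF dens_cont] by (simp add: has_integral_integral)
  then have "((Re \<circ> dens) has_integral Re 1) {0..1}" by (rule has_integral_linear[OF _ bounded_linear_Re])
  then show ?thesis by (simp add: integral_unique \<rho>_def[abs_def] o_def)
qed

text \<open>
  The density has no zeros inside, hence a constant sign, and its integral is 1.
\<close>

lemma rho_pos: "t \<in> {0<..<1} \<Longrightarrow> \<rho> t > 0"
proof -
  have nz: "\<rho> t \<noteq> 0" if t: "t \<in> {0<..<1}" for t
  proof -
    have "dens t \<noteq> 0" using qp_nz[OF t] F_deriv[of "complex_of_real t"] t by (auto simp: dens_def)
    then show ?thesis using dens_real[of t] t by auto
  qed
  have same: "\<rho> t > 0" if pos: "\<rho> s > 0" and st: "s \<in> {0<..<1}" "t \<in> {0<..<1}" for s t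
  proof (rule ccontr)
    assume "\<not> \<rho> t > 0"
    then have neg: "\<rho> t < 0" using nz[OF st(2)] by simp
    have seg: "{min s t..max s t} \<subseteq> {0<..<1}" using st by auto
    have "continuous_on {min s t..max s t} \<rho>"
      by (rule continuous_on_subset[OF rho_cont]) (use seg in auto)
    then have "connected (\<rho> ` {min s t..max s t})" by (intro connected_continuous_image) auto
    moreover have "\<rho> s \<in> \<rho> ` {min s t..max s t}" "\<rho> t \<in> \<rho> ` {min s t..max s t}" by auto
    ultimately have "{\<rho> t..\<rho> s} \<subseteq> \<rho> ` {min s t..max s t}"
      by (intro connected_contains_Icc)
    moreover have "0 \<in> {\<rho> t..\<rho> s}" using pos neg by simp
    ultimately have "0 \<in> \<rho> ` {min s t..max s t}" by (rule subsetD)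
    then obtain x where x: "x \<in> {min s t..max s t}" "\<rho> x = 0" by (elim imageE) simp
    then show False using nz[of x] seg by blast
  qed
  have "\<exists>s\<in>{0<..<1}. \<rho> s > 0"
  proof (rule ccontr)
    assume "\<not> ?thesis"
    then have neg: "\<rho> s \<le> 0" if "s \<in> {0<..<1}" for s using that by force
    have "\<rho> s \<le> 0" if "s \<in> {0..1}" for s
    proof (cases "s \<in> {0<..<1}")
      case False
      then have "s = 0 \<or> s = 1" using that by auto
      then show ?thesis using qp_end by (auto simp: \<rho>_def dens_def)
    qed (rule neg)
    then have "integral {0..1} \<rho> \<le> integral {0..1} (\<lambda>_::real. 0::real)"
      by (intro integral_le integrable_continuous_real rho_cont) auto
    then show False using rho_integral by simp
  qed
  then show "t \<in> {0<..<1} \<Longrightarrow> \<rho> t > 0" using same by blast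
qed

lemma rho_nonneg: "t \<in> {0..1} \<Longrightarrow> \<rho> t \<ge> 0"
proof (cases "t \<in> {0<..<1}")
  case True
  then show ?thesis using rho_pos[OF True] by simp
next
  case False
  assume "t \<in> {0..1}"
  with False have "t = 0 \<or> t = 1" by auto
  then show ?thesis using qp_end by (auto simp: \<rho>_def dens_def)
qed

section \<open>One-sided limits at the arc\<close>

lemma open_F_slab: "open (F ` slab d)"
  using F_hol F_inj open_slab by (intro open_mapping_thm3) auto

definition F_inv :: "complex \<Rightarrow> complex" where "F_inv = the_inv_into (slab d) F"

lemma F_inv_F: "w \<in> slab d \<Longrightarrow> F_inv (F w) = w"
  unfolding F_inv_def by (rule the_inv_into_f_f[OF F_inj])

lemma F_inv_hol: "F_inv holomorphic_on F ` slab d"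
proof -
  obtain g where g: "g holomorphic_on F ` slab d" "\<And>z. z \<in> slab d \<Longrightarrow> g (F z) = z"
    by (rule holomorphic_has_inverse[OF F_hol open_slab F_inj]) (rule that, assumption+)
  from g(1) show ?thesis by (rule holomorphic_transform) (auto simp: F_inv_F g(2))
qed

lemma deriv_F_inv: "w \<in> slab d \<Longrightarrow> deriv F_inv (F w) = 1 / deriv F w"
proof -
  assume w: "w \<in> slab d"
  have "(F_inv has_field_derivative deriv F_inv (F w)) (at (F w))"
    using F_inv_hol open_F_slab w by (intro holomorphic_derivI) auto
  from DERIV_chain2[OF this F_diff[OF w]]
  have "((\<lambda>w. F_inv (F w)) has_field_derivative deriv F_inv (F w) * deriv F w) (at w)" .
  moreover have "((\<lambda>w. F_inv (F w)) has_field_derivative 1) (at w)"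
    by (rule has_field_derivative_transform_within_open[OF DERIV_ident open_slab w]) (simp add: F_inv_F)
  ultimately have "deriv F_inv (F w) * deriv F w = 1" by (rule DERIV_unique)
  then show ?thesis using F_deriv[OF w] by (simp add: field_simps)
qed

text \<open>
  The point at distance \<open>h\<close> from \<open>G u\<close> on the normal, to the left for \<open>s = 1\<close> and to the right for
  \<open>s = - 1\<close>.
\<close>

definition side_pt :: "real \<Rightarrow> real \<Rightarrow> real \<Rightarrow> complex" where
  "side_pt s u h = G u + complex_of_real (s * h) * left_normal G u"

text \<open>
  For \<open>h = 0\<close> the straightened point is \<open>u\<close>, with imaginary part 0. The derivative with respect to
  \<open>h\<close> of its imaginary part, multiplied by \<open>s\<close>, is continuous in \<open>(u, h)\<close> and equals
  $1/|G'(t)| > 0$ at \<open>(t, 0)\<close>.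
\<close>

lemma side_pt_eventually:
  assumes t: "t \<in> {0<..<1}" and s: "s = 1 \<or> s = -1"
  obtains \<epsilon> where "\<epsilon> > 0"
    "\<And>u h. \<bar>u - t\<bar> < \<epsilon> \<Longrightarrow> 0 < h \<Longrightarrow> h < \<epsilon> \<Longrightarrow> side_pt s u h \<in> F ` slab d \<and> s * Im (F_inv (side_pt s u h)) > 0"
proof -
  define m where "m p = F (complex_of_real (fst p)) + complex_of_real (s * snd p) * (\<i> * sgn (deriv F (complex_of_real (fst p))))" for p :: "real \<times> real"
  have ts: "complex_of_real t \<in> slab d" using t by auto
  have id: "((\<lambda>p::real \<times> real. p) \<longlongrightarrow> (t, 0)) (nhds (t, 0::real))" by (rule filterlim_ident)
  have lt: "((\<lambda>p::real \<times> real. complex_of_real (fst p)) \<longlongrightarrow> complex_of_real t) (nhds (t, 0::real))"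
    using tendsto_of_real[OF tendsto_fst[OF id]] by simp
  have l0: "((\<lambda>p::real \<times> real. snd p) \<longlongrightarrow> 0) (nhds (t, 0::real))"
    using tendsto_snd[OF id] by simp
  have evs: "\<forall>\<^sub>F p in nhds (t, 0::real). complex_of_real (fst p) \<in> slab d"
    by (rule topological_tendstoD[OF lt open_slab ts])
  have lF: "((\<lambda>p. F (complex_of_real (fst p))) \<longlongrightarrow> F (complex_of_real t)) (nhds (t, 0::real))"
    by (rule continuous_on_tendsto_compose[OF F_cont lt ts evs])
  have ldF: "((\<lambda>p. deriv F (complex_of_real (fst p))) \<longlongrightarrow> deriv F (complex_of_real t)) (nhds (t, 0::real))"
    by (rule continuous_on_tendsto_compose[OF dF_cont lt ts evs])
  have ln: "((\<lambda>p. \<i> * sgn (deriv F (complex_of_real (fst p)))) \<longlongrightarrow> \<i> * sgn (deriv F (complex_of_real t))) (nhds (t, 0::real))"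
    by (intro tendsto_intros tendsto_sgn ldF F_deriv ts)
  have "(m \<longlongrightarrow> F (complex_of_real t) + complex_of_real (s * 0) * (\<i> * sgn (deriv F (complex_of_real t)))) (nhds (t, 0::real))"
    unfolding m_def by (intro tendsto_intros lF ln l0)
  then have lm: "(m \<longlongrightarrow> F (complex_of_real t)) (nhds (t, 0::real))" by simp
  have inF: "F (complex_of_real t) \<in> F ` slab d" using ts by blast
  have evm: "\<forall>\<^sub>F p in nhds (t, 0::real). m p \<in> F ` slab d"
    by (rule topological_tendstoD[OF lm open_F_slab inF])
  have "continuous_on (F ` slab d) (deriv F_inv)"
    using F_inv_hol open_F_slab by (intro holomorphic_on_imp_continuous_on holomorphic_deriv)
  from continuous_on_tendsto_compose[OF this lm inF evm]
  have "((\<lambda>p. Im (deriv F_inv (m p) * (\<i> * sgn (deriv F (complex_of_real (fst p)))))) \<longlongrightarrow>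
     Im (deriv F_inv (F (complex_of_real t)) * (\<i> * sgn (deriv F (complex_of_real t))))) (nhds (t, 0::real))"
    by (intro tendsto_intros ln)
  moreover have "Im (deriv F_inv (F (complex_of_real t)) * (\<i> * sgn (deriv F (complex_of_real t)))) > 0"
    unfolding deriv_F_inv[OF ts] using F_deriv[OF ts] by (simp add: sgn_eq)
  ultimately have evI: "\<forall>\<^sub>F p in nhds (t, 0::real). Im (deriv F_inv (m p) * (\<i> * sgn (deriv F (complex_of_real (fst p))))) > 0"
    by (rule order_tendstoD)
  have "\<forall>\<^sub>F p in nhds (t, 0::real). fst p \<in> {0<..<1}"
    using topological_tendstoD[OF tendsto_fst[OF id], of "{0<..<1}"] t by simp
  with evm evI have "\<forall>\<^sub>F p in nhds (t, 0::real). fst p \<in> {0<..<1} \<and> m p \<in> F ` slab d \<and>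
      Im (deriv F_inv (m p) * (\<i> * sgn (deriv F (complex_of_real (fst p))))) > 0"
    by eventually_elim simp
  then obtain e where e: "e > 0" "\<And>p. dist p (t, 0) < e \<Longrightarrow> fst p \<in> {0<..<1} \<and> m p \<in> F ` slab d \<and>
      Im (deriv F_inv (m p) * (\<i> * sgn (deriv F (complex_of_real (fst p))))) > 0"
    unfolding eventually_nhds_metric by blast
  have ms: "side_pt s u x = m (u, x)" if "u \<in> {0<..<1}" for u x
    using that F_01[of u] G_vderiv_at[of u] by (simp add: side_pt_def m_def left_normal_def)
  show ?thesis
  proof (rule that[of "e / 2"])
    fix u h assume uh: "\<bar>u - t\<bar> < e / 2" "0 < h" "h < e / 2"
    have near: "dist (u, x) (t, 0) < e" if "0 \<le> x" "x \<le> h" for x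
    proof -
      have "dist (u, x) (t, 0) \<le> dist u t + dist x 0"
        unfolding dist_Pair_Pair by (rule sqrt_sum_squares_le_sum) auto
      also have "\<dots> < e" using uh that by (simp add: dist_real_def)
      finally show ?thesis .
    qed
    have u: "u \<in> {0<..<1}" using e(2)[OF near[of 0]] uh by simp
    let ?n = "\<i> * sgn (deriv F (complex_of_real u))"
    have mu: "m (u, x) = G u + complex_of_real (s * x) * ?n" for x using u F_01[of u] by (simp add: m_def)
    have der: "((\<lambda>x. s * Im (F_inv (m (u, x)))) has_real_derivative Im (deriv F_inv (m (u, x)) * ?n)) (at x)"
      if x: "0 \<le> x" "x \<le> h" for x
    proof -
      have "(F_inv has_field_derivative deriv F_inv (m (u, x))) (at (m (u, x)))"
        using F_inv_hol open_F_slab e(2)[OF near[OF x]] by (intro holomorphic_derivI) auto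
      moreover have "((\<lambda>x. m (u, x)) has_vector_derivative complex_of_real s * ?n) (at x)"
        unfolding mu by (auto intro!: derivative_eq_intros simp: has_vector_derivative_def scaleR_conv_of_real)
      ultimately have "((F_inv \<circ> (\<lambda>x. m (u, x))) has_vector_derivative (complex_of_real s * ?n) * deriv F_inv (m (u, x))) (at x)"
        by (rule field_vector_diff_chain_at[rotated])
      from bounded_linear.has_vector_derivative[OF bounded_linear_Im this]
      have "((\<lambda>x. s * Im (F_inv (m (u, x)))) has_real_derivative s * Im ((complex_of_real s * ?n) * deriv F_inv (m (u, x)))) (at x)"
        unfolding o_def has_real_derivative_iff_has_vector_derivative[symmetric] by (rule DERIV_cmult)
      moreover have "s * Im ((complex_of_real s * ?n) * deriv F_inv (m (u, x))) = Im (deriv F_inv (m (u, x)) * ?n)"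
        using s by (auto simp: algebra_simps)
      ultimately show ?thesis by simp
    qed
    have "s * Im (F_inv (m (u, 0))) < s * Im (F_inv (m (u, h)))"
      by (rule DERIV_pos_imp_increasing[OF uh(2)]) (use der e(2) near in force)
    moreover have "F_inv (m (u, 0)) = complex_of_real u" using u F_inv_F[of "complex_of_real u"] by (simp add: m_def)
    ultimately show "side_pt s u h \<in> F ` slab d \<and> s * Im (F_inv (side_pt s u h)) > 0"
      unfolding ms[OF u] using e(2)[OF near[of h]] uh by simp
  qed (use e in simp)
qed

lemma left_normal_eq: "t \<in> {0..1} \<Longrightarrow> left_normal G t = \<i> * sgn (deriv F (complex_of_real t))"
  by (simp add: left_normal_def G_vderiv_at)

lemma norm_left_normal: "t \<in> {0..1} \<Longrightarrow> norm (left_normal G t) = 1"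
  using F_deriv[of "complex_of_real t"] by (simp add: left_normal_eq norm_mult norm_sgn)

lemma side_pt_notin_arc:
  assumes "side_pt s u h \<in> F ` slab d" "s * Im (F_inv (side_pt s u h)) > 0"
  shows "side_pt s u h \<notin> path_image G"
proof -
  obtain w where w: "w \<in> slab d" "side_pt s u h = F w" using assms(1) by blast
  have "Im w \<noteq> 0" using assms(2) w F_inv_F[OF w(1)] by auto
  then show ?thesis using F_in_arc[OF w(1)] w(2) by auto
qed

text \<open>
  Points on the left are straightened to points above the real axis, where \<open>q\<close> is given by \<open>qp\<close>, and
  points on the right to points below, where it is given by \<open>qm\<close>; at the cut \<open>qm\<close> is \<open>- qp\<close>.
\<close>

lemma side_limit:
  assumes t: "t \<in> {0<..<1}" and s: "s = 1 \<or> s = -1"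
  shows "((\<lambda>(u, h). q (side_pt s u h)) \<longlongrightarrow> complex_of_real s * qp (complex_of_real t)) (nhds t \<times>\<^sub>F at_right 0)"
    and "\<forall>\<^sub>F h in at_right 0. side_pt s t h \<notin> path_image G"
proof -
  obtain \<epsilon> where \<epsilon>: "\<epsilon> > 0"
    "\<And>u h. \<bar>u - t\<bar> < \<epsilon> \<Longrightarrow> 0 < h \<Longrightarrow> h < \<epsilon> \<Longrightarrow> side_pt s u h \<in> F ` slab d \<and> s * Im (F_inv (side_pt s u h)) > 0"
    using side_pt_eventually[OF t s] by blast
  have near: "\<forall>\<^sub>F h in at_right 0. 0 < h \<and> h < \<epsilon>"
    using \<epsilon>(1) by (auto simp: eventually_at_right_field intro!: exI[of _ \<epsilon>])
  show "\<forall>\<^sub>F h in at_right 0. side_pt s t h \<notin> path_image G"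
    using near
  proof eventually_elim
    case (elim h)
    then show ?case using \<epsilon>(2)[of t h] \<epsilon>(1) side_pt_notin_arc by simp
  qed
  let ?L = "nhds t \<times>\<^sub>F at_right (0::real)"
  have evu: "\<forall>\<^sub>F u in nhds t. \<bar>u - t\<bar> < \<epsilon> \<and> u \<in> {0<..<1}"
  proof (rule eventually_conj)
    show "\<forall>\<^sub>F u in nhds t. \<bar>u - t\<bar> < \<epsilon>"
      using \<epsilon>(1) unfolding eventually_nhds_metric dist_real_def by blast
    show "\<forall>\<^sub>F u in nhds t. u \<in> {0<..<1}" using t by (intro eventually_nhds_in_open) auto
  qed
  have ev: "\<forall>\<^sub>F p in ?L. fst p \<in> {0<..<1} \<and> side_pt s (fst p) (snd p) \<in> F ` slab d \<and> s * Im (F_inv (side_pt s (fst p) (snd p))) > 0"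
    unfolding eventually_prod_filter
    by (intro exI[of _ "\<lambda>u. \<bar>u - t\<bar> < \<epsilon> \<and> u \<in> {0<..<1}"] exI[of _ "\<lambda>h. 0 < h \<and> h < \<epsilon>"] conjI evu near)
       (use \<epsilon>(2) in auto)
  have lfst: "filterlim fst (nhds t) ?L" by (rule filterlim_fst)
  have "filterlim snd (at_right 0) ?L" by (rule filterlim_snd)
  then have lsnd: "filterlim snd (nhds (0::real)) ?L" by (rule filterlim_mono) (auto simp: at_within_def)
  have lG: "((\<lambda>p. G (fst p)) \<longlongrightarrow> G t) ?L"
  proof (rule continuous_on_tendsto_compose[OF G_continuous lfst])
    show "\<forall>\<^sub>F p in ?L. fst p \<in> {0..1}" using ev by eventually_elim auto
  qed (use t in auto)
  have l0: "((\<lambda>p. complex_of_real (s * snd p) * left_normal G (fst p)) \<longlongrightarrow> 0) ?L"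
  proof (rule Lim_null_comparison)
    show "\<forall>\<^sub>F p in ?L. norm (complex_of_real (s * snd p) * left_normal G (fst p)) \<le> \<bar>snd p\<bar>"
      using ev by eventually_elim (use s in \<open>auto simp: norm_mult norm_left_normal\<close>)
    show "((\<lambda>p. \<bar>snd p\<bar>) \<longlongrightarrow> 0) ?L" using tendsto_rabs[OF lsnd] by simp
  qed
  have lpt: "((\<lambda>p. side_pt s (fst p) (snd p)) \<longlongrightarrow> G t) ?L"
    unfolding side_pt_def using tendsto_add[OF lG l0] by simp
  have Gt: "G t = F (complex_of_real t)" "complex_of_real t \<in> slab d" using F_01[of t] t by auto
  have lP: "((\<lambda>p. F_inv (side_pt s (fst p) (snd p))) \<longlongrightarrow> F_inv (G t)) ?L"
  proof (rule continuous_on_tendsto_compose[OF holomorphic_on_imp_continuous_on[OF F_inv_hol] lpt])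
    show "\<forall>\<^sub>F p in ?L. side_pt s (fst p) (snd p) \<in> F ` slab d" using ev by eventually_elim simp
  qed (use Gt in simp)
  have PGt: "F_inv (G t) = complex_of_real t" using Gt F_inv_F by simp
  define q1 where "q1 = (if s = 1 then qp else qm)"
  have cont1: "continuous_on (slab d \<inter> {w. s * Im w \<ge> 0}) q1"
    using s qp_cont qm_cont by (auto simp: q1_def)
  have "((\<lambda>p. q1 (F_inv (side_pt s (fst p) (snd p)))) \<longlongrightarrow> q1 (complex_of_real t)) ?L"
  proof (rule continuous_on_tendsto_compose[OF cont1 lP[unfolded PGt]])
    show "\<forall>\<^sub>F p in ?L. F_inv (side_pt s (fst p) (snd p)) \<in> slab d \<inter> {w. s * Im w \<ge> 0}"
      using ev by eventually_elim (auto simp: F_inv_F)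
  qed (use Gt in simp)
  moreover have "q1 (complex_of_real t) = complex_of_real s * qp (complex_of_real t)"
    using s qm_qp[of t] t by (auto simp: q1_def)
  moreover have "\<forall>\<^sub>F p in ?L. q1 (F_inv (side_pt s (fst p) (snd p))) = q (side_pt s (fst p) (snd p))"
    using ev
  proof eventually_elim
    case (elim p)
    then obtain w where w: "w \<in> slab d" "side_pt s (fst p) (snd p) = F w" by blast
    then have "s * Im w > 0" using elim F_inv_F by simp
    moreover from this have "w \<in> slab d - complex_of_real ` {0..1}" using w by auto
    ultimately have "q1 w = q (F w)" using s qp_eq[of w] qm_eq[of w] by (auto simp: q1_def)
    then show ?case using w F_inv_F by simp
  qed
  ultimately have "((\<lambda>p. q (side_pt s (fst p) (snd p))) \<longlongrightarrow> complex_of_real s * qp (complex_of_real t)) ?L"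
    using Lim_transform_eventually by fastforce
  then show "((\<lambda>(u, h). q (side_pt s u h)) \<longlongrightarrow> complex_of_real s * qp (complex_of_real t)) ?L"
    by (simp add: split_beta')
qed

lemma plus_value_eq: "t \<in> {0<..<1} \<Longrightarrow> plus_value G q (G t) = qp (complex_of_real t)"
proof -
  assume t: "t \<in> {0<..<1}"
  have "the_inv_into {0<..<1} G (G t) = t"
    by (rule the_inv_into_f_f[OF inj_on_subset[OF G_inj] t]) simp
  moreover have "Lim (nhds t \<times>\<^sub>F at_right 0) (\<lambda>(u, h). q (G u + complex_of_real h * left_normal G u)) = qp (complex_of_real t)"
  proof (rule tendsto_Lim)
    show "nhds t \<times>\<^sub>F at_right (0::real) \<noteq> bot" by (simp add: prod_filter_eq_bot)
    show "((\<lambda>(u, h). q (G u + complex_of_real h * left_normal G u)) \<longlongrightarrow> qp (complex_of_real t)) (nhds t \<times>\<^sub>F at_right 0)"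
      using side_limit(1)[OF t, of 1] by (simp add: side_pt_def)
  qed
  ultimately show ?thesis by (simp add: plus_value_def Let_def)
qed

section \<open>The measure and its logarithmic singularities\<close>

lemma G_cont_UNIV: "continuous_on UNIV G"
proof -
  obtain G' where "\<And>t. (G has_vector_derivative G' t) (at t)" using analytic_curve_C1[OF G_analytic] by blast
  then show ?thesis by (intro continuous_at_imp_continuous_on ballI) (rule has_vector_derivative_continuous)
qed

lemma G_measurable [measurable]: "G \<in> borel_measurable borel"
  using G_cont_UNIV by (rule borel_measurable_continuous_onI)

definition \<rho>0 :: "real \<Rightarrow> real" where
  "\<rho>0 t = indicator {0..1} t * \<rho> t"

lemma rho0_measurable [measurable]: "\<rho>0 \<in> borel_measurable borel"
  using borel_measurable_continuous_on_indicator[OF _ rho_cont] by (simp add: \<rho>0_def[abs_def])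

lemma rho0_nonneg: "\<rho>0 t \<ge> 0"
  using rho_nonneg by (simp add: \<rho>0_def indicator_def)

lemma rho0_times_integral:
  assumes "continuous_on {0..1} f"
  shows "integrable lborel (\<lambda>t. \<rho>0 t * f t)" "(\<integral>t. \<rho>0 t * f t \<partial>lborel) = integral {0..1} (\<lambda>t. \<rho> t * f t)"
proof -
  have c: "continuous_on {0..1} (\<lambda>t. \<rho> t * f t)" by (intro continuous_intros rho_cont assms)
  have eq: "(\<lambda>t. \<rho>0 t * f t) = (\<lambda>t. indicator {0..1} t *\<^sub>R (\<rho> t * f t))"
    by (simp add: \<rho>0_def fun_eq_iff)
  have si: "set_integrable lborel {0..1} (\<lambda>t. \<rho> t * f t)"
    unfolding set_integrable_def by (rule borel_integrable_compact[OF _ c]) simp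
  then show "integrable lborel (\<lambda>t. \<rho>0 t * f t)" unfolding eq set_integrable_def .
  show "(\<integral>t. \<rho>0 t * f t \<partial>lborel) = integral {0..1} (\<lambda>t. \<rho> t * f t)"
    using set_borel_integral_eq_integral(2)[OF si] unfolding eq set_lebesgue_integral_def .
qed

lemma rho0_integral: "integrable lborel \<rho>0" "(\<integral>t. \<rho>0 t \<partial>lborel) = 1"
  using rho0_times_integral[of "\<lambda>_. 1"] rho_integral by (simp_all add: continuous_on_const)

definition \<mu> :: "complex measure" where
  "\<mu> = distr (density lborel (\<lambda>t. ennreal (\<rho>0 t))) borel G"

lemma sets_mu [simp, measurable_cong]: "sets \<mu> = sets borel"
  by (simp add: \<mu>_def)

lemma nn_integral_mu:
  assumes [measurable]: "f \<in> borel_measurable borel"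
  shows "(\<integral>\<^sup>+s. f s \<partial>\<mu>) = (\<integral>\<^sup>+t. ennreal (\<rho>0 t) * f (G t) \<partial>lborel)"
  unfolding \<mu>_def by (subst nn_integral_distr) (auto simp: nn_integral_density)

lemma integral_mu:
  fixes f :: "complex \<Rightarrow> real"
  assumes [measurable]: "f \<in> borel_measurable borel"
  shows "(\<integral>s. f s \<partial>\<mu>) = (\<integral>t. \<rho>0 t * f (G t) \<partial>lborel)"
  unfolding \<mu>_def by (subst integral_distr) (auto simp: integral_real_density rho0_nonneg)

lemma AE_mu:
  assumes pr: "{s. pr s} \<in> sets borel" and ae: "AE t in lborel. t \<in> {0..1} \<longrightarrow> pr (G t)"
  shows "AE s in \<mu>. pr s"
proof -
  have "AE t in density lborel (\<lambda>t. ennreal (\<rho>0 t)). pr (G t)"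
  proof (subst AE_density)
    show "(\<lambda>t. ennreal (\<rho>0 t)) \<in> borel_measurable lborel" by measurable
    show "AE t in lborel. 0 < ennreal (\<rho>0 t) \<longrightarrow> pr (G t)"
      using ae by eventually_elim (auto simp: \<rho>0_def indicator_def split: if_splits)
  qed
  then show ?thesis unfolding \<mu>_def
    by (subst AE_distr_iff) (use pr in \<open>auto\<close>)
qed

lemma emeasure_mu:
  assumes "A \<in> sets borel"
  shows "emeasure \<mu> A = (\<integral>\<^sup>+t. ennreal (\<rho>0 t) * indicator A (G t) \<partial>lborel)"
  using nn_integral_mu[of "indicator A"] assms by simp

lemma prob_space_mu: "prob_space \<mu>"
proof
  have "emeasure \<mu> (space \<mu>) = (\<integral>\<^sup>+t. ennreal (\<rho>0 t) \<partial>lborel)"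
    using emeasure_mu[of UNIV] by (simp add: \<mu>_def)
  also have "\<dots> = 1"
    using rho0_integral rho0_nonneg by (subst nn_integral_eq_integral) auto
  finally show "emeasure \<mu> (space \<mu>) = 1" .
qed

lemma AE_mu_arc: "AE s in \<mu>. s \<in> path_image G"
  by (rule AE_mu) (use closed_arc in \<open>auto simp: path_image_G intro: borel_closed\<close>)

text \<open>
  The inverse of the straightening map is continuously differentiable, hence Lipschitz on the compact
  arc.
\<close>

lemma arc_inverse_lipschitz:
  obtains L where "L > 0" "\<And>t u. t \<in> {0..1} \<Longrightarrow> u \<in> {0..1} \<Longrightarrow> \<bar>t - u\<bar> \<le> L * norm (G t - G u)"
proof -
  have "local_lipschitz UNIV (F ` slab d) (\<lambda>_::real. F_inv)"
  proof (rule c1_implies_local_lipschitz)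
    show "(F_inv has_derivative blinfun_apply ((\<lambda>p. blinfun_mult_right (deriv F_inv (snd p))) (t, x))) (at x)"
      if "x \<in> F ` slab d" for t :: real and x
      using holomorphic_derivI[OF F_inv_hol open_F_slab that] by (simp add: has_field_derivative_def)
    show "continuous_on (UNIV \<times> F ` slab d) (\<lambda>p::real \<times> complex. blinfun_mult_right (deriv F_inv (snd p)))"
      by (intro continuous_intros continuous_on_compose2[OF holomorphic_on_imp_continuous_on[OF holomorphic_deriv[OF F_inv_hol open_F_slab]]]) auto
  qed (use open_F_slab in auto)
  then have "local_lipschitz {0::real} (path_image G) (\<lambda>_. F_inv)"
    by (rule local_lipschitz_subset) (auto simp: path_image_G F_01[symmetric])
  then obtain L where L: "L-lipschitz_on (path_image G) F_inv"
  proof (rule local_lipschitz_compact_implies_lipschitz[OF _ compact_arc])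
    fix L assume "\<And>t. t \<in> {0::real} \<Longrightarrow> L-lipschitz_on (path_image G) F_inv"
    then show thesis using that by blast
  qed (auto intro: continuous_on_const)
  show ?thesis
  proof (rule that[of "L + 1"])
    show "L + 1 > 0" using lipschitz_on_nonneg[OF L] by simp
    fix t u :: real assume tu: "t \<in> {0..1}" "u \<in> {0..1}"
    have "dist (F_inv (G t)) (F_inv (G u)) \<le> L * dist (G t) (G u)"
      using tu by (intro lipschitz_onD[OF L]) (auto simp: path_image_G)
    moreover have "F_inv (G t) = complex_of_real t" "F_inv (G u) = complex_of_real u"
      using tu F_inv_F[of "complex_of_real t"] F_inv_F[of "complex_of_real u"] by (simp_all add: F_01)
    ultimately have "\<bar>t - u\<bar> \<le> L * norm (G t - G u)"
      by (simp add: dist_norm flip: of_real_diff)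
    also have "\<dots> \<le> (L + 1) * norm (G t - G u)" by (intro mult_right_mono) auto
    finally show "\<bar>t - u\<bar> \<le> (L + 1) * norm (G t - G u)" .
  qed
qed

text \<open>
  If \<open>G \<tau>\<close> is a point of the arc closest to \<open>z\<close>, then $|z - G(t)| \ge |G(t) - G(\tau)|/2$, which is at
  least a constant multiple of $|t-\tau|$. As the density is bounded, the singularity of the kernel is
  no worse than that of $\ln(1/|t-\tau|)$ on the line.
\<close>

lemma log_regular_mu: obtains C R where "log_regular \<mu> C R"
proof -
  obtain L where L: "L > 0" "\<And>t u. t \<in> {0..1} \<Longrightarrow> u \<in> {0..1} \<Longrightarrow> \<bar>t - u\<bar> \<le> L * norm (G t - G u)"
    using arc_inverse_lipschitz by blast
  obtain R where R: "\<And>z. z \<in> path_image G \<Longrightarrow> norm z \<le> R"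
    using compact_imp_bounded[OF compact_arc] unfolding bounded_iff by blast
  have "bounded (\<rho> ` {0..1})" by (intro compact_imp_bounded compact_continuous_image rho_cont) simp
  then obtain M where M: "\<And>t. t \<in> {0..1} \<Longrightarrow> norm (\<rho> t) \<le> M" unfolding bounded_iff by blast
  have M0: "M \<ge> 0" using order_trans[OF norm_ge_zero M[of 0]] by simp
  have rM: "\<rho>0 t \<le> M" for t using M[of t] M0 by (auto simp: \<rho>0_def indicator_def)
  have "log_regular \<mu> (4 * M * L) R"
  proof (rule log_regular.intro[OF prob_space_mu], unfold_locales)
    show "sets \<mu> = sets borel" by simp
    show "4 * M * L \<ge> 0" using M0 L by simp
    show "AE s in \<mu>. norm s \<le> R" using AE_mu_arc by eventually_elim (rule R)
    show "AE s in \<mu>. s \<noteq> z" for z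
    proof (rule AE_mu)
      show "AE t in lborel. t \<in> {0..1} \<longrightarrow> G t \<noteq> z"
      proof (cases "z \<in> range G")
        case True
        then obtain t0 where t0: "z = G t0" by blast
        show ?thesis using AE_lborel_singleton[of t0]
          by eventually_elim (use inj_eq[OF G_inj] t0 in simp)
      next
        case False
        then show ?thesis by (intro AE_I2) auto
      qed
      have "{s. s \<noteq> z} = - {z}" by auto
      then show "{s. s \<noteq> z} \<in> sets borel" by simp
    qed
    fix z :: complex and \<epsilon> :: real assume \<epsilon>: "\<epsilon> > 0"
    obtain \<tau> where \<tau>: "\<tau> \<in> {0..1}" "\<And>t. t \<in> {0..1} \<Longrightarrow> norm (z - G \<tau>) \<le> norm (z - G t)"
    proof -
      have "continuous_on {0..1} (\<lambda>t. norm (z - G t))" by (intro continuous_intros G_continuous)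
      from continuous_attains_inf[OF _ _ this] show ?thesis using that by auto
    qed
    have lower: "\<bar>t - \<tau>\<bar> \<le> 2 * L * norm (z - G t)" if t: "t \<in> {0..1}" for t
    proof -
      have "norm (G t - G \<tau>) \<le> norm (z - G \<tau>) + norm (z - G t)"
        using norm_triangle_ineq4[of "z - G \<tau>" "z - G t"] by simp
      also have "\<dots> \<le> 2 * norm (z - G t)" using \<tau>(2)[OF t] by simp
      finally have "L * norm (G t - G \<tau>) \<le> L * (2 * norm (z - G t))" using L(1) by (intro mult_left_mono) auto
      with L(2)[OF t \<tau>(1)] show ?thesis by simp
    qed
    have "(\<integral>\<^sup>+s. ennreal (max 0 (ln (\<epsilon> / norm (z - s)))) \<partial>\<mu>) =
       (\<integral>\<^sup>+t. ennreal (\<rho>0 t) * ennreal (max 0 (ln (\<epsilon> / norm (z - G t)))) \<partial>lborel)"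
      by (rule nn_integral_mu) measurable
    also have "\<dots> \<le> (\<integral>\<^sup>+t. ennreal M * ennreal (max 0 (ln (2 * L * \<epsilon> / \<bar>t - \<tau>\<bar>))) \<partial>lborel)"
    proof (rule nn_integral_mono_AE, use AE_lborel_singleton[of \<tau>] in eventually_elim)
      fix t assume t: "t \<noteq> \<tau>"
      show "ennreal (\<rho>0 t) * ennreal (max 0 (ln (\<epsilon> / norm (z - G t)))) \<le> ennreal M * ennreal (max 0 (ln (2 * L * \<epsilon> / \<bar>t - \<tau>\<bar>)))"
      proof (cases "t \<in> {0..1}")
        case True
        have p: "\<bar>t - \<tau>\<bar> > 0" using t by simp
        have "2 * L * norm (z - G t) > 0" using lower[OF True] p by linarith
        then have n: "norm (z - G t) > 0" using L(1) by (simp add: zero_less_mult_iff)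
        have "\<epsilon> / norm (z - G t) = 2 * L * \<epsilon> / (2 * L * norm (z - G t))" using L(1) by simp
        also have "\<dots> \<le> 2 * L * \<epsilon> / \<bar>t - \<tau>\<bar>"
          by (rule divide_left_mono[OF lower[OF True]]) (use L(1) \<epsilon> n p in simp_all)
        finally have "ln (\<epsilon> / norm (z - G t)) \<le> ln (2 * L * \<epsilon> / \<bar>t - \<tau>\<bar>)"
          using \<epsilon> n p L(1) by (subst ln_le_cancel_iff) simp_all
        then show ?thesis using rM[of t] by (intro mult_mono ennreal_leI) auto
      qed (simp add: \<rho>0_def)
    qed
    also have "\<dots> = ennreal M * (\<integral>\<^sup>+t. ennreal (max 0 (ln (2 * L * \<epsilon> / \<bar>t - \<tau>\<bar>))) \<partial>lborel)"
      by (rule nn_integral_cmult) measurable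
    also have "\<dots> \<le> ennreal M * ennreal (2 * (2 * L * \<epsilon>))"
      by (intro mult_left_mono nn_integral_log_pole) (use L(1) \<epsilon> in simp_all)
    also have "\<dots> = ennreal (4 * M * L * \<epsilon>)"
      using M0 L(1) \<epsilon> by (subst ennreal_mult[symmetric]) (auto simp: mult_ac)
    finally show "(\<integral>\<^sup>+s. ennreal (max 0 (ln (\<epsilon> / norm (z - s)))) \<partial>\<mu>) \<le> ennreal (4 * M * L * \<epsilon>)" .
  qed
  then show ?thesis by (rule that)
qed

section \<open>The Frostman conditions\<close>

text \<open>
  Near \<open>z0\<close> the potential is the real part of a holomorphic function: replace $\ln|z - G(t)|$ by the
  principal logarithm of $(z-G(t))/(z_0-G(t))$, a number in the right half plane, and differentiate
  under the integral.
\<close>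

lemma potential_deriv:
  assumes z0: "z0 \<notin> path_image G"
  shows "(potential \<mu> has_derivative (\<lambda>v. - Re (cauchy_transform z0 * v))) (at z0)"
proof -
  obtain r where r: "r > 0" "ball z0 r \<subseteq> - path_image G"
    using open_contains_ball_eq[OF open_Compl[OF closed_arc]] z0 by blast
  have far: "norm (z0 - G t) \<ge> r" if "t \<in> {0..1}" for t
  proof (rule ccontr)
    assume "\<not> norm (z0 - G t) \<ge> r"
    then have "G t \<in> ball z0 r" by (simp add: dist_norm)
    then show False using r that by (auto simp: path_image_G)
  qed
  have nz: "z - G t \<noteq> 0" if "z \<in> ball z0 r" "t \<in> {0..1}" for z t
    using that r by (auto simp: path_image_G)
  have z0b: "z0 \<in> ball z0 r" using r by simp
  define w where "w z t = (z - G t) / (z0 - G t)" for z t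
  have w: "w z t \<notin> \<real>\<^sub>\<le>\<^sub>0" if "z \<in> ball z0 r" "t \<in> {0..1}" for z t
  proof -
    have n0: "z0 - G t \<noteq> 0" using nz[OF z0b] that by simp
    have "w z t = 1 + (z - z0) / (z0 - G t)" using n0 by (simp add: w_def field_simps)
    moreover have "norm ((z - z0) / (z0 - G t)) < 1"
      using that far[OF that(2)] r(1) n0 by (simp add: norm_divide dist_norm norm_minus_commute)
    then have "\<bar>Re ((z - z0) / (z0 - G t))\<bar> < 1" using abs_Re_le_cmod le_less_trans by blast
    ultimately have "Re (w z t) > 0" by simp
    then show ?thesis by (auto simp: complex_nonpos_Reals_iff)
  qed
  define L where "L z = integral (cbox 0 1) (\<lambda>t. dens t * Ln (w z t))" for z
  have wc: "continuous_on {0..1} (w z)" for z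
    unfolding w_def using nz[OF z0b] by (intro continuous_intros G_continuous) auto
  have Lder: "(L has_field_derivative integral (cbox 0 1) (\<lambda>t. dens t / (z0 - G t))) (at z0 within ball z0 r)"
    unfolding L_def
  proof (rule leibniz_rule_field_derivative[of "ball z0 r" 0 1 "\<lambda>z t. dens t * Ln (w z t)" "\<lambda>z t. dens t / (z - G t)"])
    fix z t assume zt: "z \<in> ball z0 r" "t \<in> cbox 0 (1::real)"
    then have t: "t \<in> {0..1}" by simp
    have n0: "z0 - G t \<noteq> 0" "z - G t \<noteq> 0" using nz[OF z0b t] nz[OF zt(1) t] by auto
    have "((\<lambda>z. w z t) has_field_derivative 1 / (z0 - G t)) (at z within ball z0 r)"
      unfolding w_def using n0 by (auto intro!: derivative_eq_intros)
    from DERIV_cmult[OF DERIV_chain2[OF has_field_derivative_Ln[OF w[OF zt(1) t]] this], of "dens t"]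
    have "((\<lambda>z. dens t * Ln (w z t)) has_field_derivative dens t * (inverse (w z t) * (1 / (z0 - G t)))) (at z within ball z0 r)"
      .
    also have "dens t * (inverse (w z t) * (1 / (z0 - G t))) = dens t / (z - G t)"
      using n0 by (simp add: w_def)
    finally show "((\<lambda>z. dens t * Ln (w z t)) has_field_derivative dens t / (z - G t)) (at z within ball z0 r)" .
  next
    fix z assume "z \<in> ball z0 r"
    then show "(\<lambda>t. dens t * Ln (w z t)) integrable_on cbox 0 1"
      using w unfolding cbox_interval
      by (intro integrable_continuous_real continuous_intros dens_cont wc) auto
  next
    have nzp: "fst p - G (snd p) \<noteq> 0" if "p \<in> ball z0 r \<times> {0..1}" for p
      using nz[of "fst p" "snd p"] that by (simp add: mem_Times_iff)
    show "continuous_on (ball z0 r \<times> cbox 0 1) (\<lambda>(z, t). dens t / (z - G t))"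
      unfolding split_beta' cbox_interval
      by (intro continuous_intros continuous_on_compose2[OF dens_cont] continuous_on_compose2[OF G_continuous]) (use nzp in auto)
  qed (use z0b in auto)
  then have Lder': "(L has_field_derivative cauchy_transform z0) (at z0)"
    using z0b by (simp add: at_within_open[of _ "ball z0 r"] cauchy_transform_def)
  have eq: "potential \<mu> z = potential \<mu> z0 - Re (L z)" if z: "z \<in> ball z0 r" for z
  proof -
    have pot: "potential \<mu> x = - integral {0..1} (\<lambda>t. \<rho> t * ln (norm (x - G t)))" if "x \<in> ball z0 r" for x
    proof -
      have "continuous_on {0..1} (\<lambda>t. ln (norm (x - G t)))"
        using nz[OF that] by (intro continuous_intros G_continuous) auto
      from rho0_times_integral(2)[OF this] show ?thesis
        unfolding potential_def by (subst integral_mu) auto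
    qed
    have ic: "(\<lambda>t. \<rho> t * ln (norm (x - G t))) integrable_on {0..1}" if "x \<in> ball z0 r" for x
      using nz[OF that] by (intro integrable_continuous_real continuous_intros rho_cont G_continuous) auto
    have "((\<lambda>t. dens t * Ln (w z t)) has_integral L z) {0..1}"
      unfolding L_def cbox_interval
      by (rule integrable_integral, intro integrable_continuous_real continuous_intros dens_cont wc) (use w[OF z] in auto)
    from has_integral_linear[OF this bounded_linear_Re]
    have "((\<lambda>t. Re (dens t * Ln (w z t))) has_integral Re (L z)) {0..1}" by (simp add: o_def)
    moreover have "Re (dens t * Ln (w z t)) = \<rho> t * ln (norm (z - G t)) - \<rho> t * ln (norm (z0 - G t))" if t: "t \<in> {0..1}" for t
    proof -
      have n0: "z0 - G t \<noteq> 0" "z - G t \<noteq> 0" using nz[OF z0b t] nz[OF z t] by auto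
      then have "w z t \<noteq> 0" by (simp add: w_def)
      then have "Re (Ln (w z t)) = ln (norm (z - G t)) - ln (norm (z0 - G t))"
        using n0 by (simp add: w_def norm_divide ln_div)
      then show ?thesis using dens_real[OF t] by (simp add: right_diff_distrib)
    qed
    ultimately have "((\<lambda>t. \<rho> t * ln (norm (z - G t)) - \<rho> t * ln (norm (z0 - G t))) has_integral Re (L z)) {0..1}"
      by (rule has_integral_eq[rotated])
    then have "Re (L z) = integral {0..1} (\<lambda>t. \<rho> t * ln (norm (z - G t))) - integral {0..1} (\<lambda>t. \<rho> t * ln (norm (z0 - G t)))"
      using integral_diff[OF ic[OF z] ic[OF z0b]] by (simp add: integral_unique)
    then show ?thesis using pot[OF z] pot[OF z0b] by simp
  qed
  have "(L has_derivative (*) (cauchy_transform z0)) (at z0)"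
    using Lder' by (simp add: has_field_derivative_def)
  note ReL = bounded_linear.has_derivative[OF bounded_linear_Re this]
  have "((\<lambda>z. potential \<mu> z0 - Re (L z)) has_derivative (\<lambda>v. - Re (cauchy_transform z0 * v))) (at z0)"
    using has_derivative_diff[OF has_derivative_const[of "potential \<mu> z0"] ReL] by simp
  then show ?thesis
    by (rule has_derivative_transform_within_open[OF _ open_ball z0b]) (simp add: eq)
qed

definition W :: "complex \<Rightarrow> real" where
  "W z = 2 * potential \<mu> z + Re (V z)"

lemma W_deriv:
  assumes z: "z \<notin> path_image G"
  shows "(W has_derivative (\<lambda>v. Re (2 * q z * v))) (at z)"
proof -
  have "(V has_field_derivative - \<i> * z\<^sup>2) (at z)"
    unfolding V_def[abs_def] by (auto intro!: derivative_eq_intros)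
  then have "(V has_derivative (*) (- \<i> * z\<^sup>2)) (at z)" by (simp add: has_field_derivative_def)
  from bounded_linear.has_derivative[OF bounded_linear_Re this]
  have "(W has_derivative (\<lambda>v. 2 * - Re (cauchy_transform z * v) + Re ((- \<i> * z\<^sup>2) * v))) (at z)"
    unfolding W_def[abs_def]
    by (intro has_derivative_add has_derivative_mult_right potential_deriv[OF z])
  moreover have "2 * - Re (cauchy_transform z * v) + Re ((- \<i> * z\<^sup>2) * v) = Re (2 * q z * v)" for v
  proof -
    have "2 * - Re (cauchy_transform z * v) + Re ((- \<i> * z\<^sup>2) * v) = Re ((- 2 * cauchy_transform z - \<i> * z\<^sup>2) * v)"
      by (simp add: algebra_simps)
    also have "- 2 * cauchy_transform z - \<i> * z\<^sup>2 = 2 * q z"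
      unfolding cauchy_transform_eq[OF z] by simp
    finally show ?thesis .
  qed
  ultimately show ?thesis by simp
qed

lemma W_cont: "continuous_on UNIV W"
proof -
  obtain C R where "log_regular \<mu> C R" using log_regular_mu .
  from log_regular.U_continuous[OF this] show ?thesis
    unfolding W_def V_def by (intro continuous_intros) auto
qed

lemma W_path_deriv:
  assumes p: "(p has_vector_derivative p') (at t within A)" and off: "p t \<notin> path_image G"
  shows "((\<lambda>t. W (p t)) has_vector_derivative Re (2 * q (p t) * p')) (at t within A)"
proof -
  have "((\<lambda>t. W (p t)) has_derivative (\<lambda>h. Re (2 * q (p t) * (h *\<^sub>R p')))) (at t within A)"
    by (rule has_derivative_compose[OF p[unfolded has_vector_derivative_def] W_deriv[OF off]])
  moreover have "Re (2 * q (p t) * (h *\<^sub>R p')) = h *\<^sub>R Re (2 * q (p t) * p')" for h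
    by (simp add: scaleR_conv_of_real algebra_simps)
  ultimately show ?thesis by (simp only: has_vector_derivative_def)
qed

text \<open>
  Push the piece of the arc between \<open>G a\<close> and \<open>G b\<close> to the left by \<open>h > 0\<close> in the straightened coordinate.
  There the difference of \<open>W\<close> is the real part of an integral of \<open>2 * q\<close>, and both sides are
  continuous as \<open>h \<rightarrow> 0\<close>. In the limit the integrand is the real part of $2\pi i$ times the real density.
\<close>

lemma W_const_on_arc:
  assumes ab: "0 \<le> a" "a \<le> b" "b \<le> 1"
  shows "W (G a) = W (G b)"
proof -
  let ?w = "\<lambda>h u. Complex u h"
  define I where "I h = integral (cbox a b) (\<lambda>u. Re (2 * qp (?w h u) * deriv F (?w h u)))" for h
  define D where "D h = W (F (?w h b)) - W (F (?w h a))" for h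
  have slab: "?w h u \<in> slab d \<inter> {w. Im w \<ge> 0}" if "h \<in> {0..<d}" "u \<in> {a..b}" for h u
    using that ab d_pos by (auto simp: slab_def)
  have cw: "continuous_on X (\<lambda>p. ?w (fst p) (snd p))" for X :: "(real \<times> real) set"
    unfolding Complex_eq by (intro continuous_intros)
  have "continuous_on ({0..<d} \<times> cbox a b) (\<lambda>(h, u). Re (2 * qp (?w h u) * deriv F (?w h u)))"
    unfolding split_beta'
    by (intro continuous_intros continuous_on_compose2[OF qp_cont cw] continuous_on_compose2[OF dF_cont cw])
       (use slab in auto)
  then have Icont: "continuous_on {0..<d} I" unfolding I_def by (rule integral_continuous_on_param)
  have cw1: "continuous_on X (\<lambda>h. ?w h u)" for X :: "real set" and u
    unfolding Complex_eq by (intro continuous_intros)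
  have cw2: "continuous_on X (\<lambda>u. ?w h u)" for X :: "real set" and h
    unfolding Complex_eq by (intro continuous_intros)
  have WF: "continuous_on (slab d) (\<lambda>w. W (F w))"
    by (rule continuous_on_compose2[OF W_cont F_cont]) simp
  have Dcont: "continuous_on {0..<d} D"
    unfolding D_def
    by (intro continuous_intros continuous_on_compose2[OF WF cw1]) (use slab ab in auto)
  have eq: "D h = I h" if h: "h \<in> {0<..<d}" for h
  proof -
    have "((\<lambda>u. Re (2 * qp (?w h u) * deriv F (?w h u))) has_integral W (F (?w h b)) - W (F (?w h a))) {a..b}"
    proof (rule fundamental_theorem_of_calculus[OF ab(2)])
      fix u assume u: "u \<in> {a..b}"
      have ws: "?w h u \<in> slab d" using slab[of h u] h u by auto
      have off: "?w h u \<in> slab d - complex_of_real ` {0..1}" using ws h by (auto simp: complex_eq_iff)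
      have "((\<lambda>u. ?w h u) has_vector_derivative 1) (at u within {a..b})"
        unfolding Complex_eq by (auto intro!: derivative_eq_intros simp: has_vector_derivative_def scaleR_conv_of_real)
      from field_vector_diff_chain_within[OF this has_field_derivative_at_within[OF F_diff[OF ws]]]
      have "((\<lambda>u. F (?w h u)) has_vector_derivative deriv F (?w h u)) (at u within {a..b})" by (simp add: o_def)
      moreover have "F (?w h u) \<notin> path_image G" using F_in_arc[OF ws] off by blast
      ultimately have "((\<lambda>u. W (F (?w h u))) has_vector_derivative Re (2 * q (F (?w h u)) * deriv F (?w h u))) (at u within {a..b})"
        by (rule W_path_deriv)
      then show "((\<lambda>u. W (F (?w h u))) has_vector_derivative Re (2 * qp (?w h u) * deriv F (?w h u))) (at u within {a..b})"
        using qp_eq[OF off] h by simp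
    qed
    then show ?thesis by (simp add: D_def I_def integral_unique)
  qed
  have l0: "((\<lambda>h. D h) \<longlongrightarrow> D 0) (at 0 within {0..<d})" "((\<lambda>h. I h) \<longlongrightarrow> I 0) (at 0 within {0..<d})"
    using Dcont Icont d_pos by (auto simp: continuous_on_def)
  have sub: "{0<..<d} \<subseteq> {0..<d}" by auto
  note l = tendsto_within_subset[OF l0(1) sub] tendsto_within_subset[OF l0(2) sub]
  have ev: "\<forall>\<^sub>F h in at 0 within {0<..<d}. D h = I h"
    unfolding eventually_at_filter by (rule always_eventually) (use eq in blast)
  have nb: "at (0::real) within {0<..<d} \<noteq> bot"
    using islimpt_greaterThanLessThan1[OF d_pos] by (simp add: trivial_limit_within)
  have "D 0 = I 0" by (rule tendsto_unique[OF nb Lim_transform_eventually[OF l(1) ev] l(2)])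
  moreover have "I 0 = 0"
  proof -
    have "I 0 = integral (cbox a b) (\<lambda>_. 0)"
      unfolding I_def
    proof (rule integral_cong)
      fix u assume "u \<in> cbox a b"
      then have u: "u \<in> {0..1}" using ab by auto
      have "2 * qp (complex_of_real u) * deriv F (complex_of_real u) = 2 * (of_real pi * \<i>) * complex_of_real (\<rho> u)"
        unfolding dens_real[OF u, symmetric] by (simp add: dens_def)
      then have "Re (2 * qp (complex_of_real u) * deriv F (complex_of_real u)) = Re (2 * (of_real pi * \<i>) * complex_of_real (\<rho> u))"
        by (rule arg_cong)
      also have "\<dots> = 0" by simp
      finally have "Re (2 * qp (complex_of_real u) * deriv F (complex_of_real u)) = 0" .
      then show "Re (2 * qp (?w 0 u) * deriv F (?w 0 u)) = 0" by (simp add: complex_of_real_def)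
    qed
    then show ?thesis by simp
  qed
  moreover have "D 0 = W (G b) - W (G a)"
    using F_01[of a] F_01[of b] ab by (simp add: D_def complex_of_real_def)
  ultimately show ?thesis by simp
qed

lemma W_on_arc: "t \<in> {0..1} \<Longrightarrow> W (G t) = W (G 0)"
  using W_const_on_arc[of 0 t] by simp

text \<open>
  The two arcs outside of $\gamma$ are treated at once. Only the interior of the path has to avoid
  $\gamma$, as \<open>W\<close> is continuous at its starting point \<open>G u\<close>.
\<close>

lemma W_off_arc:
  assumes pos: "Re (contour_integral (subpath u t G) q) > 0" and u: "u \<in> {0..1}"
    and off: "\<And>x. x \<in> {0<..<1} \<Longrightarrow> (t - u) * x + u \<notin> {0..1}"
  shows "W (G t) > W (G u)"
proof -
  obtain G' where G': "\<And>t. (G has_vector_derivative G' t) (at t)" using analytic_curve_C1[OF G_analytic] by blast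
  let ?g = "\<lambda>x. G ((t - u) * x + u)"
  have gd: "(?g has_vector_derivative complex_of_real (t - u) * G' ((t - u) * x + u)) (at x)" for x
  proof -
    have "((\<lambda>x. (t - u) * x + u) has_vector_derivative (t - u)) (at x)"
      by (auto intro!: derivative_eq_intros simp: has_vector_derivative_def)
    from vector_diff_chain_at[OF this G'] show ?thesis by (simp add: o_def scaleR_conv_of_real)
  qed
  have "q contour_integrable_on subpath u t G"
    using pos not_integrable_contour_integral[of q "subpath u t G"] by force
  then have "(q has_contour_integral contour_integral (subpath u t G) q) (subpath u t G)"
    by (rule has_contour_integral_integral)
  then have "((\<lambda>x. q (?g x) * vector_derivative ?g (at x)) has_integral contour_integral (subpath u t G) q) {0..1}"
    unfolding has_contour_integral subpath_def by simp
  then have "((\<lambda>x. q (?g x) * (complex_of_real (t - u) * G' ((t - u) * x + u))) has_integral contour_integral (subpath u t G) q) {0..1}"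
    unfolding vector_derivative_at[OF gd] .
  from has_integral_linear[OF has_integral_mult_right[OF this, of 2] bounded_linear_Re]
  have 1: "((\<lambda>x. Re (2 * q (?g x) * (complex_of_real (t - u) * G' ((t - u) * x + u)))) has_integral
      2 * Re (contour_integral (subpath u t G) q)) {0..1}" by (simp add: o_def mult.assoc)
  \<comment> \<open>the same integral, computed with the primitive provided by the differential of W\<close>
  have 2: "((\<lambda>x. Re (2 * q (?g x) * (complex_of_real (t - u) * G' ((t - u) * x + u)))) has_integral W (?g 1) - W (?g 0)) {0..1}"
  proof (rule fundamental_theorem_of_calculus_interior)
    show "continuous_on {0..1} (\<lambda>x. W (?g x))"
      by (intro continuous_on_compose2[OF W_cont] continuous_on_compose2[OF G_cont_UNIV] continuous_intros) auto
    fix x :: real assume x: "x \<in> {0<..<1}"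
    have "?g x \<notin> path_image G"
    proof
      assume "?g x \<in> path_image G"
      then obtain v where "v \<in> {0..1}" "?g x = G v" by (auto simp: path_image_G)
      then have "(t - u) * x + u = v" using injD[OF G_inj] by blast
      then show False using off[OF x] \<open>v \<in> {0..1}\<close> by simp
    qed
    then show "((\<lambda>x. W (?g x)) has_vector_derivative Re (2 * q (?g x) * (complex_of_real (t - u) * G' ((t - u) * x + u)))) (at x)"
      by (rule W_path_deriv[OF gd])
  qed simp
  from has_integral_unique[OF 1 2] show ?thesis using pos by simp
qed

lemma W_ge: "z \<in> range G \<Longrightarrow> W z \<ge> W (G 0)"
proof -
  assume "z \<in> range G"
  then obtain t where t: "z = G t" by blast
  consider "t < 0" | "t \<in> {0..1}" | "t > 1" by force
  then show ?thesis
  proof cases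
    case 1
    have "Re (contour_integral (subpath 0 t G) q) > 0" using contour 1 by (simp add: Gamma_contour_def)
    then have "W (G t) > W (G 0)"
      by (rule W_off_arc) (use 1 in \<open>auto simp: mult_less_0_iff not_le\<close>)
    then show ?thesis using t by simp
  next
    case 2
    then show ?thesis using W_on_arc[OF 2] t by simp
  next
    case 3
    have "Re (contour_integral (subpath 1 t G) q) > 0" using contour 3 by (simp add: Gamma_contour_def)
    then have "W (G t) > W (G 1)"
      by (rule W_off_arc) (use 3 in \<open>auto simp: not_le\<close>)
    then show ?thesis using t W_on_arc[of 1] by simp
  qed
qed

text \<open>
  In the directions $\pi/6$ and $5\pi/6$ the cube of \<open>z\<close> points in the direction of \<open>\<i>\<close>, so that
  $\mathrm{Re}\,V(z) \sim |z|^3/3$ at both ends of the contour.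
\<close>

lemma growth: obtains b where "\<And>z. z \<in> range G \<Longrightarrow> Re (V z) \<ge> 1 * norm z - b"
proof -
  have cis3: "cis (pi / 6) ^ 3 = \<i>" "cis (5 * pi / 6) ^ 3 = \<i>"
  proof -
    have eqs: "real 3 * (pi / 6) = pi / 2" "real 3 * (5 * pi / 6) = pi / 2 + 2 * pi" by simp_all
    show "cis (pi / 6) ^ 3 = \<i>" unfolding Complex.DeMoivre eqs by simp
    have "cis (5 * pi / 6) ^ 3 = cis (pi / 2 + 2 * pi)" unfolding Complex.DeMoivre eqs ..
    also have "\<dots> = \<i>" unfolding cis_mult[symmetric] by simp
    finally show "cis (5 * pi / 6) ^ 3 = \<i>" .
  qed
  have far: "\<forall>\<^sub>F t in A. Re (V (G t)) \<ge> norm (G t) - 4"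
    if lim: "((\<lambda>t. sgn (G t)) \<longlongrightarrow> cis \<theta>) A" and c: "cis \<theta> ^ 3 = \<i>" for A \<theta>
  proof -
    have "((\<lambda>t. Re (- \<i> * sgn (G t) ^ 3)) \<longlongrightarrow> Re (- \<i> * cis \<theta> ^ 3)) A" by (intro tendsto_intros lim)
    moreover have "Re (- \<i> * cis \<theta> ^ 3) > 1 / 2" unfolding c by simp
    ultimately have "\<forall>\<^sub>F t in A. Re (- \<i> * sgn (G t) ^ 3) > 1 / 2" by (rule order_tendstoD)
    then show ?thesis
    proof eventually_elim
      case (elim t)
      let ?x = "norm (G t)"
      have "G t = complex_of_real ?x * sgn (G t)" by (simp add: sgn_eq)
      then have "V (G t) = complex_of_real (?x ^ 3 / 3) * (- \<i> * sgn (G t) ^ 3)"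
        unfolding V_def by (metis (no_types, lifting) mult.assoc mult.commute of_real_divide of_real_numeral of_real_power power_mult_distrib times_divide_eq_left)
      then have "Re (V (G t)) = ?x ^ 3 / 3 * Re (- \<i> * sgn (G t) ^ 3)" by simp
      also have "\<dots> \<ge> ?x ^ 3 / 3 * (1 / 2)" using elim by (intro mult_left_mono) auto
      finally have "Re (V (G t)) \<ge> ?x ^ 3 / 6" by simp
      \<comment> \<open>the constant 4 makes the cubic dominate on all of the half line\<close>
      moreover have "?x ^ 3 / 6 \<ge> ?x - 4"
      proof (cases "?x \<le> 4")
        case True
        have "?x ^ 3 / 6 \<ge> 0" by simp
        then show ?thesis using True by linarith
      next
        case False
        then have "?x * ?x \<ge> 4 * 4" by (intro mult_mono) auto
        then have "?x * (?x * ?x) \<ge> ?x * 16" by (intro mult_left_mono) auto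
        then show ?thesis using False by (simp add: power3_eq_cube)
      qed
      ultimately show ?case by linarith
    qed
  qed
  have "\<forall>\<^sub>F t in at_bot. Re (V (G t)) \<ge> norm (G t) - 4" "\<forall>\<^sub>F t in at_top. Re (V (G t)) \<ge> norm (G t) - 4"
    using contour cis3 by (auto simp: Gamma_contour_def intro!: far)
  then obtain a c where ac: "\<And>t. t \<le> a \<Longrightarrow> Re (V (G t)) \<ge> norm (G t) - 4" "\<And>t. t \<ge> c \<Longrightarrow> Re (V (G t)) \<ge> norm (G t) - 4"
    unfolding eventually_at_bot_linorder eventually_at_top_linorder by blast
  have "continuous_on {a..c} (\<lambda>t. norm (G t) - Re (V (G t)))"
    unfolding V_def by (intro continuous_intros continuous_on_subset[OF G_cont_UNIV]) auto
  then have "bounded ((\<lambda>t. norm (G t) - Re (V (G t))) ` {a..c})"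
    by (intro compact_imp_bounded compact_continuous_image) auto
  then obtain B where "\<forall>t\<in>{a..c}. \<bar>norm (G t) - Re (V (G t))\<bar> \<le> B" unfolding bounded_iff by auto
  then have B: "\<bar>norm (G t) - Re (V (G t))\<bar> \<le> B" if "t \<in> {a..c}" for t using that by (rule bspec)
  show ?thesis
  proof (rule that[of "max 4 B"])
    fix z assume "z \<in> range G"
    then obtain t where t: "z = G t" by blast
    consider "t \<le> a" | "t \<ge> c" | "t \<in> {a..c}" by force
    then show "Re (V z) \<ge> 1 * norm z - max 4 B"
    proof cases
      case 1
      then show ?thesis using ac(1)[of t] t by simp
    next
      case 2
      then show ?thesis using ac(2)[of t] t by simp
    next
      case 3
      then show ?thesis using B[OF 3] t by simp
    qed
  qed
qed

theorem equilibrium: "is_equilibrium_measure V (range G) \<mu>"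
proof -
  obtain C R where "log_regular \<mu> C R" using log_regular_mu .
  then interpret log_regular \<mu> C R .
  obtain b where b: "\<And>z. z \<in> range G \<Longrightarrow> Re (V z) \<ge> 1 * norm z - b" using growth by blast
  have Vm: "(\<lambda>z. Re (V z)) \<in> borel_measurable borel" unfolding V_def by measurable
  have ae: "AE z in \<mu>. z \<in> range G" using AE_mu_arc by eventually_elim (auto simp: path_image_G)
  have "bounded ((\<lambda>z. Re (V z)) ` path_image G)"
    unfolding V_def by (intro compact_imp_bounded compact_continuous_image compact_arc continuous_intros) auto
  then obtain B where B: "\<And>z. z \<in> path_image G \<Longrightarrow> \<bar>Re (V z)\<bar> \<le> B" unfolding bounded_iff by auto
  have Vi: "integrable \<mu> (\<lambda>z. Re (V z))"
    by (rule integrable_const_bound[where B=B]) (use AE_mu_arc B Vm in \<open>auto elim!: eventually_mono\<close>)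
  have eq: "AE z in \<mu>. 2 * potential \<mu> z + Re (V z) = W (G 0)"
    using AE_mu_arc
  proof eventually_elim
    case (elim z)
    then obtain t where t: "t \<in> {0..1}" "z = G t" unfolding path_image_G by blast
    show ?case using W_on_arc[OF t(1)] unfolding t(2) W_def .
  qed
  show ?thesis
  proof (rule Frostman_imp_equilibrium[OF ae Vm Vi _ b eq])
    show "W (G 0) \<le> 2 * potential \<mu> z + Re (V z)" if "z \<in> range G" for z
      using W_ge[OF that] unfolding W_def .
  qed simp
qed

section \<open>The S-property\<close>

text \<open>
  The same value occurs for \<open>s = 1\<close> and \<open>s = - 1\<close>, because \<open>s\<close> enters both the direction and the
  boundary value of \<open>q\<close>. The one-sided derivative at the arc is obtained by l'Hospital's rule as the
  limit of the derivatives at the points of the normal.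
\<close>

lemma dir_derivative:
  assumes t: "t \<in> {0<..<1}" and s: "s = 1 \<or> s = -1"
  shows "has_dir_derivative (\<lambda>z. 2 * real_of_ereal (log_potential \<mu> z) + Re (V z)) (G t)
     (complex_of_real s * left_normal G t) (Re (2 * qp (complex_of_real t) * left_normal G t))"
proof -
  let ?n = "left_normal G t"
  obtain C R where "log_regular \<mu> C R" using log_regular_mu .
  from log_regular.log_potential_eq[OF this]
  have Weq: "(\<lambda>z. 2 * real_of_ereal (log_potential \<mu> z) + Re (V z)) = W" by (simp add: W_def fun_eq_iff)
  define g where "g h = W (side_pt s t h)" for h
  have geq: "(\<lambda>h. W (G t + complex_of_real h * (complex_of_real s * ?n))) = g"
    by (simp add: g_def side_pt_def fun_eq_iff mult_ac)
  have spd: "((\<lambda>h. side_pt s t h) has_vector_derivative complex_of_real s * ?n) (at h)" for h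
    unfolding side_pt_def
    by (auto intro!: derivative_eq_intros simp: has_vector_derivative_def scaleR_conv_of_real)
  have gd: "\<forall>\<^sub>F h in at_right 0. DERIV (\<lambda>h. g h - g 0) h :> Re (2 * q (side_pt s t h) * (complex_of_real s * ?n))"
    using side_limit(2)[OF t s]
  proof eventually_elim
    case (elim h)
    have "(g has_vector_derivative Re (2 * q (side_pt s t h) * (complex_of_real s * ?n))) (at h)"
      unfolding g_def by (rule W_path_deriv[OF spd elim])
    then have "DERIV g h :> Re (2 * q (side_pt s t h) * (complex_of_real s * ?n))"
      unfolding has_real_derivative_iff_has_vector_derivative .
    from DERIV_diff[OF this DERIV_const] show ?case by simp
  qed
  have gcont: "(g \<longlongrightarrow> g 0) (at_right 0)"
  proof -
    have 1: "isCont (\<lambda>h. side_pt s t h) 0" by (rule has_vector_derivative_continuous[OF spd])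
    have "isCont W (side_pt s t 0)" using W_cont by (simp add: continuous_on_eq_continuous_at)
    from isCont_o2[OF 1 this] have "isCont (\<lambda>h. W (side_pt s t h)) 0" .
    then show ?thesis unfolding isCont_def g_def by (rule tendsto_within_subset) simp
  qed
  have ql: "((\<lambda>h. q (side_pt s t h)) \<longlongrightarrow> complex_of_real s * qp (complex_of_real t)) (at_right 0)"
  proof -
    have "filterlim (\<lambda>h. (t, h)) (nhds t \<times>\<^sub>F at_right 0) (at_right (0::real))"
      by (intro filterlim_Pair tendsto_const filterlim_ident)
    from filterlim_compose[OF side_limit(1)[OF t s] this] show ?thesis by simp
  qed
  have "((\<lambda>h. Re (2 * q (side_pt s t h) * (complex_of_real s * ?n)) / 1) \<longlongrightarrow>
      Re (2 * (complex_of_real s * qp (complex_of_real t)) * (complex_of_real s * ?n)) / 1) (at_right 0)"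
    by (intro tendsto_intros ql) simp
  moreover have "2 * (complex_of_real s * qp (complex_of_real t)) * (complex_of_real s * ?n) = 2 * qp (complex_of_real t) * ?n"
    using s by auto
  ultimately have lim: "((\<lambda>h. Re (2 * q (side_pt s t h) * (complex_of_real s * ?n)) / 1) \<longlongrightarrow>
      Re (2 * qp (complex_of_real t) * ?n)) (at_right 0)" by simp
  have "((\<lambda>h. (g h - g 0) / h) \<longlongrightarrow> Re (2 * qp (complex_of_real t) * ?n)) (at_right 0)"
  proof (rule lhopital_right_0[OF _ _ _ _ gd _ lim])
    show "((\<lambda>h. g h - g 0) \<longlongrightarrow> 0) (at_right 0)" using tendsto_diff[OF gcont tendsto_const[of "g 0"]] by simp
    show "((\<lambda>h. h) \<longlongrightarrow> 0) (at_right (0::real))" by (rule tendsto_ident_at)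
    show "\<forall>\<^sub>F h in at_right (0::real). h \<noteq> 0" by (simp add: eventually_at_filter)
    show "\<forall>\<^sub>F h in at_right (0::real). (1::real) \<noteq> 0" by simp
    show "\<forall>\<^sub>F h in at_right (0::real). DERIV (\<lambda>h. h) h :> 1" by simp
  qed
  then show ?thesis
    unfolding has_dir_derivative_def Weq geq by (simp add: has_field_derivative_iff)
qed

lemma msupport_mu: "msupport \<mu> = path_image G"
proof (intro equalityI subsetI)
  fix z assume z: "z \<in> msupport \<mu>"
  show "z \<in> path_image G"
  proof (rule ccontr)
    assume "z \<notin> path_image G"
    then have "emeasure \<mu> (- path_image G) > 0"
      using z closed_arc unfolding msupport_def by (auto simp: open_Compl)
    moreover have "emeasure \<mu> (- path_image G) = 0"
    proof (subst emeasure_mu)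
      show "- path_image G \<in> sets borel" using closed_arc by auto
      have "(\<integral>\<^sup>+t. ennreal (\<rho>0 t) * indicator (- path_image G) (G t) \<partial>lborel) = (\<integral>\<^sup>+t. 0 \<partial>(lborel :: real measure))"
        by (intro nn_integral_cong) (auto simp: \<rho>0_def indicator_def path_image_G)
      then show "(\<integral>\<^sup>+t. ennreal (\<rho>0 t) * indicator (- path_image G) (G t) \<partial>lborel) = 0" by simp
    qed
    ultimately show False by simp
  qed
next
  fix z assume "z \<in> path_image G"
  then obtain t where t: "t \<in> {0..1}" "z = G t" by (auto simp: path_image_G)
  show "z \<in> msupport \<mu>"
    unfolding msupport_def
  proof (intro CollectI allI impI)
    fix O' assume O': "open O' \<and> z \<in> O'"
    have "isCont G t" using G_cont_UNIV by (auto simp: continuous_on_eq_continuous_at)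
    then have "\<forall>\<^sub>F u in nhds t. G u \<in> O'"
      using O' t by (intro topological_tendstoD[of G "G t"]) (auto simp: continuous_within tendsto_at_iff_tendsto_nhds)
    then obtain e where e: "e > 0" "\<And>u. dist u t < e \<Longrightarrow> G u \<in> O'"
      unfolding eventually_nhds_metric by blast
    define a b where "a = max 0 (t - e)" and "b = min 1 (t + e)"
    have ab: "a < b" using t e by (auto simp: a_def b_def)
    have in_ab: "u \<in> {0<..<1} \<and> G u \<in> O'" if "u \<in> {a<..<b}" for u
      using that e(2)[of u] by (auto simp: a_def b_def dist_real_def)
    have "emeasure \<mu> O' \<noteq> 0"
    proof
      assume "emeasure \<mu> O' = 0"
      moreover have O'm: "O' \<in> sets borel" using O' by auto
      ultimately have "(\<integral>\<^sup>+t. ennreal (\<rho>0 t) * indicator O' (G t) \<partial>lborel) = 0" by (simp add: emeasure_mu)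
      then have "AE u in lborel. ennreal (\<rho>0 u) * indicator O' (G u) = 0"
        using O'm by (subst (asm) nn_integral_0_iff_AE) auto
      then have "AE u in lborel. u \<notin> {a<..<b}"
      proof eventually_elim
        case (elim u)
        show ?case
        proof
          assume "u \<in> {a<..<b}"
          then have "u \<in> {0<..<1}" "G u \<in> O'" using in_ab by auto
          then show False using elim rho_pos[of u] by (auto simp: \<rho>0_def)
        qed
      qed
      then have "{a<..<b} \<in> null_sets lborel" by (subst AE_iff_null_sets) auto
      then have "emeasure lborel {a<..<b} = 0" by blast
      then show False using ab by simp
    qed
    then show "emeasure \<mu> O' > 0" by (simp add: zero_less_iff_neq_zero)
  qed
qed

theorem S_property_contour: "S_property V G"
  unfolding S_property_def
proof (intro conjI G_analytic exI[of _ \<mu>] exI[of _ "{(0, 1)} :: (real \<times> real) set"] equilibrium)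
  show "msupport \<mu> = (\<Union>(a, b)\<in>{(0, 1)}. G ` {a..b})" by (simp add: msupport_mu path_image_G)
  show "\<forall>(a, b)\<in>{(0, 1)}. \<forall>t\<in>{a<..<b}. \<exists>D.
      has_dir_derivative (\<lambda>z. 2 * real_of_ereal (log_potential \<mu> z) + Re (V z)) (G t) (left_normal G t) D \<and>
      has_dir_derivative (\<lambda>z. 2 * real_of_ereal (log_potential \<mu> z) + Re (V z)) (G t) (- left_normal G t) D"
    using dir_derivative[of _ 1] dir_derivative[of _ "-1"] by force
qed (auto simp: disjoint_family_on_def)

lemma line_measure: "is_line_measure \<mu> G (\<lambda>s. 1 / (of_real pi * \<i>) * plus_value G q s)"
  unfolding is_line_measure_def
proof (intro conjI ballI)
  show "sets \<mu> = sets borel" by simp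
  fix B :: "complex set" assume B[measurable]: "B \<in> sets borel"
  have "measure \<mu> B = (\<integral>t. \<rho>0 t * indicator B (G t) \<partial>lborel)"
    using integral_mu[of "indicator B"] B by (simp add: \<mu>_def)
  moreover have int: "integrable lborel (\<lambda>t. \<rho>0 t * indicator B (G t))"
    by (rule Bochner_Integration.integrable_bound[OF rho0_integral(1)]) (auto simp: indicator_def)
  ultimately have "((\<lambda>t. \<rho>0 t * indicator B (G t)) has_integral measure \<mu> B) UNIV"
    using has_integral_integral_lborel[OF int] by simp
  from has_integral_linear[OF this bounded_linear_of_real[where 'a=complex]]
  have "((\<lambda>t. complex_of_real (\<rho>0 t * indicator B (G t))) has_integral complex_of_real (measure \<mu> B)) UNIV"
    by (simp add: o_def)
  moreover have "(\<lambda>t. complex_of_real (\<rho>0 t * indicator B (G t))) =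
     (\<lambda>t. if t \<in> {0..1} then complex_of_real (\<rho> t * indicator B (G t)) else 0)"
    by (auto simp: \<rho>0_def indicator_def fun_eq_iff)
  ultimately have "((\<lambda>t. complex_of_real (\<rho> t * indicator B (G t))) has_integral complex_of_real (measure \<mu> B)) {0..1}"
    by (simp only: has_integral_restrict_UNIV)
  then show "((\<lambda>s. indicator B s * (1 / (of_real pi * \<i>) * plus_value G q s)) has_contour_integral of_real (measure \<mu> B)) G"
    unfolding has_contour_integral
  proof (rule has_integral_spike_finite[of "{0, 1}", rotated 2])
    fix t :: real assume t: "t \<in> {0..1} - {0, 1}"
    then have t': "t \<in> {0<..<1}" "t \<in> {0..1}" by auto
    have "1 / (of_real pi * \<i>) * plus_value G q (G t) * vector_derivative G (at t) = complex_of_real (\<rho> t)"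
      unfolding plus_value_eq[OF t'(1)] G_vderiv_at[OF t'(2)] dens_real[OF t'(2), symmetric] dens_def ..
    then show "indicator B (G t) * (1 / (of_real pi * \<i>) * plus_value G q (G t)) * vector_derivative G (at t) =
        complex_of_real (\<rho> t * indicator B (G t))"
      by (simp add: indicator_def)
  qed simp
qed

lemma mu_on_arc: "\<mu> \<in> prob_measures_on (path_image G)"
  using prob_space_mu AE_mu_arc by (simp add: prob_measures_on_def)

end

section \<open>Conclusion\<close>

lemma straightened_exists:
  assumes "Gamma_contour G q"
  obtains F d qp qm where "straightened G q F d qp qm"
proof -
  have crit: "critical_trajectory G" and branch: "sqrt_Q_branch G q" and inj: "inj G" and an: "analytic_curve_on UNIV G"
    using assms by (auto simp: Gamma_contour_def)
  have G01: "G 0 = z1" "G 1 = z2" and Qnz: "\<And>t. t \<in> {0<..<1} \<Longrightarrow> Q (G t) \<noteq> 0"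
    using crit by (auto simp: critical_trajectory_def pathstart_def pathfinish_def)
  have mi: "- \<i> \<notin> G ` {0..1}"
  proof
    assume "- \<i> \<in> G ` {0..1}"
    then obtain t where t: "t \<in> {0..1}" "G t = - \<i>" by auto
    show False
    proof (cases "t \<in> {0<..<1}")
      case True
      then show False using Qnz[of t] t by (simp add: Q_def)
    next
      case False
      then have "t = 0 \<or> t = 1" using t by auto
      then show False using t G01 by (auto simp: z1_def z2_def complex_eq_iff)
    qed
  qed
  obtain F d where F: "d > 0" "F holomorphic_on slab d" "inj_on F (slab d)" "- \<i> \<notin> F ` slab d"
    "\<And>t. - d < t \<Longrightarrow> t < 1 + d \<Longrightarrow> F (complex_of_real t) = G t"
    "\<And>w. w \<in> slab d \<Longrightarrow> deriv F w \<noteq> 0"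
    by (rule straightening_exists[OF an inj mi]) (rule that, assumption+)
  have F01: "F 0 = z1" "F 1 = z2" using F(5)[of 0] F(5)[of 1] F(1) G01 by auto
  have FG: "F (complex_of_real t) = G t" if "t \<in> {0..1}" for t using F(1,5) that by auto
  \<comment> \<open>by injectivity of the straightening map\<close>
  have off: "F w \<in> - path_image G" if w: "w \<in> slab d - complex_of_real ` {0..1}" for w
  proof
    assume "F w \<in> path_image G"
    then obtain t where t: "t \<in> {0..1}" "F w = F (complex_of_real t)" by (auto simp: path_image_def FG)
    then have "w = complex_of_real t" using inj_onD[OF F(3) t(2)] w F(1) by auto
    then show False using w t by blast
  qed
  have qh: "q holomorphic_on - path_image G" and qs: "\<And>z. z \<in> - path_image G \<Longrightarrow> (q z)\<^sup>2 = Q z"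
    using branch by (auto simp: sqrt_Q_branch_def)
  have qc: "continuous_on (slab d - complex_of_real ` {0..1}) (\<lambda>w. q (F w))"
    by (rule continuous_on_compose2[OF holomorphic_on_imp_continuous_on[OF qh]
          continuous_on_subset[OF holomorphic_on_imp_continuous_on[OF F(2)]]]) (use off in auto)
  show ?thesis
  proof (rule boundary_values_exist[OF F(1-4) F01 qc])
    show "(q (F w))\<^sup>2 = Q (F w)" if "w \<in> slab d - complex_of_real ` {0..1}" for w
      using off[OF that] by (rule qs)
  next
    fix qp qm
    assume h: "continuous_on (slab d \<inter> {w. Im w \<ge> 0}) qp" "continuous_on (slab d \<inter> {w. Im w \<le> 0}) qm"
      "\<And>w. w \<in> slab d - complex_of_real ` {0..1} \<Longrightarrow> Im w \<ge> 0 \<Longrightarrow> qp w = q (F w)"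
      "\<And>w. w \<in> slab d - complex_of_real ` {0..1} \<Longrightarrow> Im w \<le> 0 \<Longrightarrow> qm w = q (F w)"
      "\<And>t. t \<in> {0..1} \<Longrightarrow> qm (complex_of_real t) = - qp (complex_of_real t)"
      "\<And>t. t \<in> {0..1} \<Longrightarrow> (qp (complex_of_real t))\<^sup>2 = Q (F (complex_of_real t))"
      "\<And>t. t \<in> {0<..<1} \<Longrightarrow> qp (complex_of_real t) \<noteq> 0"
    have "straightened G q F d qp qm"
      by (unfold_locales; (rule assms F h | assumption)?) (simp_all add: h(6) FG[symmetric])
    then show ?thesis by (rule that)
  qed
qed

theorem theorem2p2:
  fixes G :: "real \<Rightarrow> complex" and q :: "complex \<Rightarrow> complex"
  assumes "Gamma_contour G q"
  shows "S_property V G \<and>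
    (\<exists>\<mu>. \<mu> \<in> prob_measures_on (path_image G) \<and>
         is_line_measure \<mu> G (\<lambda>s. 1 / (of_real pi * \<i>) * plus_value G q s) \<and>
         is_equilibrium_measure V (range G) \<mu>)"
proof -
  obtain F d qp qm where "straightened G q F d qp qm" using straightened_exists[OF assms] .
  then interpret straightened G q F d qp qm .
  show ?thesis using S_property_contour mu_on_arc line_measure equilibrium by blast
qed

end
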